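(* Suppose the differential expression $\mathcal{M}$ is of Sims Case II or Case III type at $x=b$, and let $M$ and $M_n$ be the operators on $[a,b)$ and $[a,b_n]$, where $M_n$ has the boundary condition $[y,\psi(\cdot,\lambda')](b_n)=0$ at $b_n$. Then: (a) for every $\lambda$ in the spectrum of $M$, there exists a convergent sequence $(\lambda^{(n)})_{n\in\mathbb{N}}$, with $\lambda^{(n)}$ in the spectrum of $M_n$, whose limit is $\lambda$; (b) if $(\lambda^{(n)})_{n\in\mathbb{N}}$ is a convergent sequence with limit $\lambda$ and $\lambda^{(n)}$ lies in the spectrum of $M_n$ for each $n$, then $\lambda$ lies in the spectrum of $M$.
   Context: Setting. $-\infty<a<b\le\infty$; $w>0$ and $p\ne0$ a.e. on $[a,b)$; $p,q$ are complex-valued; $w,1/p,q\in L^1_{loc}[a,b)$; and $Q=\overline{\mathrm{co}}\{q(x)/w(x)+rp(x):x\in[a,b),\,0<r<\infty\}\ne\mathbb{C}$ (closed convex hull). Put $\mathcal{M}[y]=\frac1w[-(py')'+qy]$. The endpoint $a$ is regular; $b$ is singular, i.e. $b=+\infty$ or $\int_a^b(w+1/|p|+|q|)\,dx=\infty$. "The differential equation" is $\mathcal{M}[y]=\lambda y$, and $L^2_w[a,b)$ is the space of $f$ with $\int_a^b|f|^2w\,dx<\infty$. Admissible pairs. $S$ is the set of pairs $(\eta,K)$ arising as follows: for some $\lambda_0\in\mathbb{C}\setminus Q$, $K$ is the point of $Q$ nearest to $\lambda_0$ and $\eta$ is a real angle such that $\Re[(rp(x)+q(x)/w(x)-K)e^{i\eta}]\ge0$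 for all $x\in[a,b)$, $r\in(0,\infty)$, and $\Re[(\lambda_0-K)e^{i\eta}]<0$. $\Lambda_{\eta,K}=\{\lambda\in\mathbb{C}:\Re[(\lambda-K)e^{i\eta}]\le0\}$. A (possibly complex) number $\alpha$ is fixed; $S(\alpha)$ is the set of $(\eta,K)\in S$ with $\Re[e^{i\eta}\cos\alpha\,\overline{\sin\alpha}]\le0$, assumed nonempty, and $(\eta,K)\in S(\alpha)$ is fixed. Solutions. $\theta(\cdot,\lambda),\phi(\cdot,\lambda)$ are the solutions with $\phi(a,\lambda)=\sin\alpha$, $p\phi'(a,\lambda)=-\cos\alpha$, $\theta(a,\lambda)=\cos\alpha$, $p\theta'(a,\lambda)=\sin\alpha$. $[f,g]=p(fg'-f'g)$. Sims Cases II and III. Consider the condition ( * ): $\int_a^b\Re[e^{i\eta}\{p|y'|^2+(q-Kw)|y|^2\}]dx+\int_a^b|y|^2w\,dx<\infty$. For $\lambda\in\Lambda_{\eta,K}$ (the classification is known not to depend on $\lambda$): Case II means that there is a unique (up to constant multiples) nontrivial solution satisfying ( * ), but all solutions lie in $L^2_w[a,b)$; Case III means that all solutions lie in $L^2_w[a,b)$ and satisfy ( * ). In both cases all solutions for all $\lambda\in\mathbb{C}$ lie in $L^2_w[a,b)$. Operators. Fix $\lambda'\in\Lambda_{\eta,K}$ and $\psi(\cdot,\lambda')=\theta(\cdot,\lambda')+m(\lambda')\phi(\cdot,\lambda')$, an $L^2_w$-solution for $\lambda=\lambda'$, where $m(\lambda')\in\mathbb{C}$ is the chosen value specifying the boundary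 condition at $b$. $M$ is the realization $My=\mathcal{M}[y]$ in $L^2_w[a,b)$, with domain the $y\in L^2_w[a,b)$ such that $y,py'$ are locally absolutely continuous on $[a,b)$, $\mathcal{M}[y]\in L^2_w[a,b)$, $(\cos\alpha)y(a)+(\sin\alpha)py'(a)=0$ and $[y,\psi(\cdot,\lambda')](b)=0$. Let $b_n\nearrow b$ be a sequence in $(a,b)$. $M_n$ is the regular operator $M_ny=\mathcal{M}[y]$ on $[a,b_n]$ (in $L^2_w[a,b_n]$) with boundary conditions $(\cos\alpha)y(a)+(\sin\alpha)py'(a)=0$ and $[y,\psi(\cdot,\lambda')](b_n)=0$. *)

theory Defs
  imports "HOL-Analysis.Analysis"
begin

section \<open>Intervals and absolute continuity\<close>

definition co_interval :: "real \<Rightarrow> ereal \<Rightarrow> real set" where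
  "co_interval a b = {x. a \<le> x \<and> ereal x < b}"

text \<open>Local notions on an interval \<open>I\<close> refer to all compact subintervals of \<open>I\<close>; for
  \<open>I = [a,b)\<close> this includes the endpoint \<open>a\<close>, and for compact \<open>I\<close> the word ``local'' is void.\<close>

definition loc_integrable_on :: "real set \<Rightarrow> (real \<Rightarrow> 'a::euclidean_space) \<Rightarrow> bool" where
  "loc_integrable_on I f \<longleftrightarrow> (\<forall>c d. {c..d} \<subseteq> I \<longrightarrow> f absolutely_integrable_on {c..d})"

text \<open>\<open>D division_of \<Union>D\<close> says that \<open>D\<close> is a finite family of non-overlapping compact
  intervals, so this is the usual \<open>\<epsilon>\<close>-\<open>\<delta>\<close> definition of absolute continuity on \<open>[c,d]\<close>.\<close>

definition abs_cont_on :: "real \<Rightarrow> real \<Rightarrow> (real \<Rightarrow> complex) \<Rightarrow> bool" where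
  "abs_cont_on c d f \<longleftrightarrow>
     (\<forall>\<epsilon>>0. \<exists>\<delta>>0. \<forall>D. D division_of \<Union>D \<and> \<Union>D \<subseteq> {c..d} \<and> (\<Sum>J\<in>D. Sup J - Inf J) < \<delta>
        \<longrightarrow> (\<Sum>J\<in>D. cmod (f (Sup J) - f (Inf J))) < \<epsilon>)"

definition loc_abs_cont_on :: "real set \<Rightarrow> (real \<Rightarrow> complex) \<Rightarrow> bool" where
  "loc_abs_cont_on I f \<longleftrightarrow> (\<forall>c d. {c..d} \<subseteq> I \<longrightarrow> abs_cont_on c d f)"

section \<open>The weighted space and spectra of operators in it\<close>

definition L2w :: "real set \<Rightarrow> (real \<Rightarrow> real) \<Rightarrow> (real \<Rightarrow> complex) set" where
  "L2w I w = {f. f \<in> borel_measurable (lebesgue_on I) \<and>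
                 integrable (lebesgue_on I) (\<lambda>x. (cmod (f x))\<^sup>2 * w x)}"

definition L2w_norm :: "real set \<Rightarrow> (real \<Rightarrow> real) \<Rightarrow> (real \<Rightarrow> complex) \<Rightarrow> real" where
  "L2w_norm I w f = sqrt (integral\<^sup>L (lebesgue_on I) (\<lambda>x. (cmod (f x))\<^sup>2 * w x))"

text \<open>Elements of the Hilbert space are represented by functions, equal when they agree a.e. on
  \<open>I\<close>; an operator \<open>T\<close> is represented by a set \<open>G\<close> of pairs \<open>(y, T y)\<close>. The resolvent set consists
  of those \<open>\<zeta>\<close> for which \<open>T - \<zeta>\<close> is injective on its domain, maps onto the whole space, and has
  a bounded inverse.\<close>

definition L2w_resolvent_set ::
    "real set \<Rightarrow> (real \<Rightarrow> real) \<Rightarrow> ((real \<Rightarrow> complex) \<times> (real \<Rightarrow> complex)) set \<Rightarrow> complex set" where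
  "L2w_resolvent_set I w G = {\<zeta>.
     (\<forall>(y, z)\<in>G. (AE x in lebesgue_on I. z x - \<zeta> * y x = 0) \<longrightarrow> (AE x in lebesgue_on I. y x = 0)) \<and>
     (\<forall>f\<in>L2w I w. \<exists>(y, z)\<in>G. AE x in lebesgue_on I. z x - \<zeta> * y x = f x) \<and>
     (\<exists>C. \<forall>(y, z)\<in>G. L2w_norm I w y \<le> C * L2w_norm I w (\<lambda>x. z x - \<zeta> * y x))}"

definition L2w_spectrum ::
    "real set \<Rightarrow> (real \<Rightarrow> real) \<Rightarrow> ((real \<Rightarrow> complex) \<times> (real \<Rightarrow> complex)) set \<Rightarrow> complex set" where
  "L2w_spectrum I w G = - L2w_resolvent_set I w G"

section \<open>The differential expression\<close>

text \<open>\<open>y1\<close> is the locally absolutely continuous representative of \<open>p y'\<close>, which as a pointwise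
  product is defined only a.e.; it is unique on \<open>I\<close>, and it gives meaning to the values of
  \<open>p y'\<close> at individual points.\<close>

definition quasi_derivative ::
    "real set \<Rightarrow> (real \<Rightarrow> complex) \<Rightarrow> (real \<Rightarrow> complex) \<Rightarrow> (real \<Rightarrow> complex) \<Rightarrow> bool" where
  "quasi_derivative I p y y1 \<longleftrightarrow>
     loc_abs_cont_on I y \<and> loc_abs_cont_on I y1 \<and>
     (AE x in lebesgue_on I. y differentiable at x \<and> y1 differentiable at x \<and>
        y1 x = p x * vector_derivative y (at x))"

definition sl_expr ::
    "(real \<Rightarrow> real) \<Rightarrow> (real \<Rightarrow> complex) \<Rightarrow> (real \<Rightarrow> complex) \<Rightarrow> (real \<Rightarrow> complex) \<Rightarrow> real \<Rightarrow> complex" where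
  "sl_expr w q y y1 x = (1 / of_real (w x)) * (- vector_derivative y1 (at x) + q x * y x)"

definition sl_solution ::
    "real set \<Rightarrow> (real \<Rightarrow> real) \<Rightarrow> (real \<Rightarrow> complex) \<Rightarrow> (real \<Rightarrow> complex) \<Rightarrow> complex \<Rightarrow>
     (real \<Rightarrow> complex) \<Rightarrow> (real \<Rightarrow> complex) \<Rightarrow> bool" where
  "sl_solution I w p q \<zeta> y y1 \<longleftrightarrow>
     quasi_derivative I p y y1 \<and> (AE x in lebesgue_on I. sl_expr w q y y1 x = \<zeta> * y x)"

text \<open>\<open>[f,g] = p (f g' - f' g)\<close>, in terms of \<open>f1 = p f'\<close> and \<open>g1 = p g'\<close>.\<close>

definition bracket ::
    "(real \<Rightarrow> complex) \<Rightarrow> (real \<Rightarrow> complex) \<Rightarrow> (real \<Rightarrow> complex) \<Rightarrow> (real \<Rightarrow> complex) \<Rightarrow> real \<Rightarrow> complex" where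
  "bracket f f1 g g1 x = f x * g1 x - f1 x * g x"

text \<open>The realization on \<open>I\<close>, whose left endpoint is \<open>a\<close>. The predicate \<open>B\<close>, applied to \<open>y\<close>
  and \<open>p y'\<close>, is the boundary condition at the right endpoint.\<close>

definition sl_operator ::
    "real set \<Rightarrow> real \<Rightarrow> (real \<Rightarrow> real) \<Rightarrow> (real \<Rightarrow> complex) \<Rightarrow> (real \<Rightarrow> complex) \<Rightarrow> complex \<Rightarrow>
     ((real \<Rightarrow> complex) \<Rightarrow> (real \<Rightarrow> complex) \<Rightarrow> bool) \<Rightarrow>
     ((real \<Rightarrow> complex) \<times> (real \<Rightarrow> complex)) set" where
  "sl_operator I a w p q \<alpha> B = {(y, z).
     y \<in> L2w I w \<and> z \<in> L2w I w \<and>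
     (\<exists>y1. quasi_derivative I p y y1 \<and>
           (AE x in lebesgue_on I. z x = sl_expr w q y y1 x) \<and>
           cos \<alpha> * y a + sin \<alpha> * y1 a = 0 \<and>
           B y y1)}"

definition sl_operator_singular ::
    "real \<Rightarrow> ereal \<Rightarrow> (real \<Rightarrow> real) \<Rightarrow> (real \<Rightarrow> complex) \<Rightarrow> (real \<Rightarrow> complex) \<Rightarrow> complex \<Rightarrow>
     (real \<Rightarrow> complex) \<Rightarrow> (real \<Rightarrow> complex) \<Rightarrow> ((real \<Rightarrow> complex) \<times> (real \<Rightarrow> complex)) set" where
  "sl_operator_singular a b w p q \<alpha> \<psi> \<psi>1 =
     sl_operator (co_interval a b) a w p q \<alpha>
       (\<lambda>y y1. ((bracket y y1 \<psi> \<psi>1 \<circ> real_of_ereal) \<longlongrightarrow> 0) (at_left b))"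

definition sl_operator_regular ::
    "real \<Rightarrow> real \<Rightarrow> (real \<Rightarrow> real) \<Rightarrow> (real \<Rightarrow> complex) \<Rightarrow> (real \<Rightarrow> complex) \<Rightarrow> complex \<Rightarrow>
     (real \<Rightarrow> complex) \<Rightarrow> (real \<Rightarrow> complex) \<Rightarrow> ((real \<Rightarrow> complex) \<times> (real \<Rightarrow> complex)) set" where
  "sl_operator_regular a c w p q \<alpha> \<psi> \<psi>1 =
     sl_operator {a..c} a w p q \<alpha> (\<lambda>y y1. bracket y y1 \<psi> \<psi>1 c = 0)"

section \<open>Sims' classification\<close>

text \<open>Points with \<open>w x = 0\<close> (a null set) are left out, as \<open>q x / w x\<close> is meaningless there;
  in HOL it would be \<open>0\<close>.\<close>

definition sims_Q ::
    "real set \<Rightarrow> (real \<Rightarrow> real) \<Rightarrow> (real \<Rightarrow> complex) \<Rightarrow> (real \<Rightarrow> complex) \<Rightarrow> complex set" where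
  "sims_Q I w p q =
     closure (convex hull {q x / of_real (w x) + of_real r * p x | x r. x \<in> I \<and> w x \<noteq> 0 \<and> 0 < r})"

definition sims_S ::
    "real set \<Rightarrow> (real \<Rightarrow> real) \<Rightarrow> (real \<Rightarrow> complex) \<Rightarrow> (real \<Rightarrow> complex) \<Rightarrow> (real \<times> complex) set" where
  "sims_S I w p q = {(\<eta>, K). \<exists>\<zeta>0. \<zeta>0 \<notin> sims_Q I w p q \<and>
     K = closest_point (sims_Q I w p q) \<zeta>0 \<and>
     (\<forall>x\<in>I. \<forall>r>0. w x \<noteq> 0 \<longrightarrow> Re ((of_real r * p x + q x / of_real (w x) - K) * cis \<eta>) \<ge> 0) \<and>
     Re ((\<zeta>0 - K) * cis \<eta>) < 0}"

definition sims_S_bc ::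
    "real set \<Rightarrow> (real \<Rightarrow> real) \<Rightarrow> (real \<Rightarrow> complex) \<Rightarrow> (real \<Rightarrow> complex) \<Rightarrow> complex \<Rightarrow>
     (real \<times> complex) set" where
  "sims_S_bc I w p q \<alpha> =
     {(\<eta>, K) \<in> sims_S I w p q. Re (cis \<eta> * cos \<alpha> * cnj (sin \<alpha>)) \<le> 0}"

definition sims_Lambda :: "real \<Rightarrow> complex \<Rightarrow> complex set" where
  "sims_Lambda \<eta> K = {\<zeta>. Re ((\<zeta> - K) * cis \<eta>) \<le> 0}"

text \<open>For \<open>(\<eta>, K)\<close> in \<open>sims_S\<close> both integrands are nonnegative a.e., so no information is lost by
  the truncation in \<open>ennreal\<close>.\<close>

definition sims_finite_form ::
    "real set \<Rightarrow> (real \<Rightarrow> real) \<Rightarrow> (real \<Rightarrow> complex) \<Rightarrow> (real \<Rightarrow> complex) \<Rightarrow> real \<Rightarrow> complex \<Rightarrow>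
     (real \<Rightarrow> complex) \<Rightarrow> bool" where
  "sims_finite_form I w p q \<eta> K y \<longleftrightarrow>
     (\<integral>\<^sup>+x. ennreal (Re (cis \<eta> *
          (p x * of_real ((cmod (vector_derivative y (at x)))\<^sup>2)
           + (q x - K * of_real (w x)) * of_real ((cmod (y x))\<^sup>2)))) \<partial>lebesgue_on I)
     + (\<integral>\<^sup>+x. ennreal ((cmod (y x))\<^sup>2 * w x) \<partial>lebesgue_on I) < \<infinity>"

definition sims_case_II ::
    "real set \<Rightarrow> (real \<Rightarrow> real) \<Rightarrow> (real \<Rightarrow> complex) \<Rightarrow> (real \<Rightarrow> complex) \<Rightarrow> real \<Rightarrow> complex \<Rightarrow>
     complex \<Rightarrow> bool" where
  "sims_case_II I w p q \<eta> K \<zeta> \<longleftrightarrow>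
     (\<exists>y y1. sl_solution I w p q \<zeta> y y1 \<and> (\<exists>x\<in>I. y x \<noteq> 0) \<and> sims_finite_form I w p q \<eta> K y \<and>
        (\<forall>v v1. sl_solution I w p q \<zeta> v v1 \<and> (\<exists>x\<in>I. v x \<noteq> 0) \<and> sims_finite_form I w p q \<eta> K v
           \<longrightarrow> (\<exists>c. \<forall>x\<in>I. v x = c * y x))) \<and>
     (\<forall>y y1. sl_solution I w p q \<zeta> y y1 \<longrightarrow> y \<in> L2w I w)"

definition sims_case_III ::
    "real set \<Rightarrow> (real \<Rightarrow> real) \<Rightarrow> (real \<Rightarrow> complex) \<Rightarrow> (real \<Rightarrow> complex) \<Rightarrow> real \<Rightarrow> complex \<Rightarrow>
     complex \<Rightarrow> bool" where
  "sims_case_III I w p q \<eta> K \<zeta> \<longleftrightarrow>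
     (\<forall>y y1. sl_solution I w p q \<zeta> y y1 \<longrightarrow> y \<in> L2w I w \<and> sims_finite_form I w p q \<eta> K y)"

end

(* Written in a fundamental system at \<zeta>', a solution y = u \<phi> + v \<psi> satisfies a linear system for (u, v) whose
   coefficients w \<phi>^2, w \<phi> \<psi>, w \<psi>^2 are integrable up to b, because in Cases II and III all solutions are in
   L^2_w. Hence u = [y, \<psi>] converges at b, locally uniformly in the spectral parameter \<lambda>, and the spectra
   of M_n and M are the zero sets of the entire functions D_n(\<lambda>) = [\<phi>(., \<lambda>), \<psi>](b_n) and of their limit D.
   Since D_n(\<zeta>') = 1 for all n, D does not vanish identically, and Hurwitz's theorem applies.

   Part (a) moreover needs a zero of D_n for every n, including small ones. D_n has order at most 1/2, so if it
   had no zeros it would be constant. For \<lambda> in the half-plane Re((\<lambda> - K) e^(i \<eta>)) < 0 the energy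
   Re(e^(i \<eta>) p y' cnj y) of y = \<phi>(., \<lambda>) is nonnegative and increasing. If \<psi>(b_n) \<noteq> 0, this forces
   \<phi>(b_n, \<lambda>) to tend to 0 in a sector and, by a Phragmen-Lindelof argument, to vanish identically; if
   \<psi>(b_n) = 0, it contradicts the vanishing of the trace of the resolvent of M_n. *)

theory Submission
  imports Defs "HOL-Complex_Analysis.Complex_Analysis"
begin

hide_const (open) Polynomial.content

section \<open>Absolutely continuous functions and indefinite integrals\<close>

text \<open>The regular problems are not self-adjoint: \<open>p\<close> and \<open>q\<close> are
  complex and only confined to a half-plane, so no spectral theorem provides an eigenvalue of M_n,
  and Hurwitz's theorem alone yields zeros of D_n for large n only. This obstacle brings in the
  growth theory of entire functions. The order 1/2 comes from the norm r |y| + |p y'| with r of size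
  sqrt |lambda - K|, in which every coefficient of the first-order system is at most r times a fixed
  integrable function. The two cases at b_n differ because a bracket [phi(., lambda), psi](b_n)
  constantly equal to 1 controls p y' / y at b_n only if psi(b_n) is not 0; otherwise it merely
  freezes the value phi(b_n, lambda), and the usable information is that its derivative in lambda
  vanishes. Taking psi itself as second basis solution makes D_n one of the two coefficients of
  phi(., lambda), so that holomorphy, convergence in n and the value at zeta' come from one power
  series. As the coefficients are merely integrable, everything rests on primitives of integrable
  functions and exceptional null sets.\<close>

lemma negligible_subset_open_small:
  assumes "negligible N" "0 < (e::real)"
  obtains U where "open U" "N \<subseteq> U" "U \<in> lmeasurable" "measure lebesgue U < e"
proof -
  have N: "N \<in> null_sets lebesgue"
    using assms(1) by (simp add: negligible_iff_null_sets)
  then have "N \<in> sets lebesgue" by auto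
  then obtain U where U: "open U" "N \<subseteq> U" "U - N \<in> lmeasurable" "emeasure lebesgue (U - N) < ennreal e"
    using sets_lebesgue_outer_open assms(2) by blast
  have Um: "U \<in> sets lebesgue" using U(1) by (simp add: borel_open)
  have "emeasure lebesgue (U - N) = emeasure lebesgue U"
    using N Um by (rule emeasure_Diff_null_set)
  with U(4) have eU: "emeasure lebesgue U < ennreal e" by simp
  then have Ul: "U \<in> lmeasurable" using Um
    by (intro fmeasurableI) (auto simp: top.extremum_strict intro: order.strict_trans)
  then have "measure lebesgue U < e"
    using eU \<open>0 < e\<close> by (simp add: emeasure_eq_measure2 ennreal_less_iff)
  with U Ul that show ?thesis by blast
qed

text \<open>The bridge from the length sums in the definition of absolute continuity to Lebesgue
  measure: members of a division overlap in degenerate boxes only, so their lengths add up to the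
  measure of the union.\<close>

lemma sum_content_division_le:
  fixes D :: "real set set"
  assumes D: "D division_of \<Union>D" and sub: "\<Union>D \<subseteq> U" and U: "U \<in> lmeasurable"
  shows "(\<Sum>J\<in>D. Sup J - Inf J) \<le> measure lebesgue U"
proof -
  have len: "Sup J - Inf J = measure lebesgue J" if "J \<in> D" for J
  proof -
    obtain u v where "J = cbox u v" using division_ofD(4)[OF D \<open>J \<in> D\<close>] by blast
    moreover have "J \<noteq> {}" using division_ofD(3)[OF D that] .
    ultimately show ?thesis by auto
  qed
  have fin: "finite D" using D by blast
  have "(\<Sum>J\<in>D. Sup J - Inf J) = (\<Sum>J\<in>D. measure lebesgue J)"
    using len by auto
  also have "\<dots> = measure lebesgue (\<Union>D)"
  proof (rule measure_negligible_finite_Union[symmetric])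
    show "finite D" by (fact fin)
    show "\<And>S. S \<in> D \<Longrightarrow> S \<in> lmeasurable" using division_ofD(4)[OF D] by (metis lmeasurable_cbox)
    show "pairwise (\<lambda>S T. negligible (S \<inter> T)) D"
      unfolding pairwise_def
    proof (intro ballI impI)
      fix S T assume ST: "S \<in> D" "T \<in> D" "S \<noteq> T"
      obtain u v u' v' where eq: "S = cbox u v" "T = cbox u' v'"
        using division_ofD(4)[OF D] ST by metis
      have "interior S \<inter> interior T = {}" using division_ofD(5)[OF D] ST by blast
      then have "interior (S \<inter> T) = {}" by simp
      moreover have "S \<inter> T = cbox (max u u') (min v v')" using eq by auto
      ultimately show "negligible (S \<inter> T)" by (metis negligible_interval(1) interior_cbox)
    qed
  qed
  also have "\<dots> \<le> measure lebesgue U"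
  proof (rule measure_mono_fmeasurable[OF sub _ U])
    have "\<Union>D \<in> lmeasurable"
    proof (rule fmeasurable.finite_Union[OF fin], rule subsetI)
      fix J assume "J \<in> D"
      then obtain u v where "J = cbox u v" using division_ofD(4)[OF D] by blast
      then show "J \<in> lmeasurable" by (metis lmeasurable_cbox)
    qed
    then show "\<Union>D \<in> sets lebesgue" by blast
  qed
  finally show ?thesis .
qed

text \<open>A Henstock-Kurzweil argument: tags outside \<open>N\<close> are controlled by the
  derivative, while intervals tagged in \<open>N\<close> are confined to an open set of measure
  below the threshold of absolute continuity, so the increments of \<open>f\<close> over them sum to
  little. Integrability of \<open>h\<close> is part of the conclusion.\<close>

lemma abs_cont_has_integral:
  fixes f h :: "real \<Rightarrow> complex"
  assumes cd: "c \<le> d" and ac: "abs_cont_on c d f" and N: "negligible N"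
    and der: "\<And>x. x \<in> {c..d} - N \<Longrightarrow> (f has_vector_derivative h x) (at x)"
  shows "(h has_integral (f d - f c)) {c..d}"
proof -
  \<comment> \<open>Setting the derivative to 0 on \<open>N\<close> removes the exceptional tags
    from the Riemann sum and leaves only the increments of \<open>f\<close> there.\<close>
  define h' where "h' = (\<lambda>x. if x \<in> N then 0 else h x)"
  have "(h' has_integral (f d - f c)) {c..d}"
    unfolding has_integral_real
  proof (intro allI impI)
    fix e :: real assume "e > 0"
    \<comment> \<open>The summand 1 keeps \<open>e'\<close> positive when
      \<open>c = d\<close>.\<close>
    define e' where "e' = e / (2 * (d - c + 1))"
    have e': "e' > 0" "e' * (d - c) < e / 2"
      using \<open>e > 0\<close> cd by (auto simp: e'_def field_simps)
    obtain \<delta> where \<delta>: "\<delta> > 0" and ac': "\<And>D. D division_of \<Union>D \<Longrightarrow> \<Union>D \<subseteq> {c..d} \<Longrightarrow>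
        (\<Sum>J\<in>D. Sup J - Inf J) < \<delta> \<Longrightarrow> (\<Sum>J\<in>D. cmod (f (Sup J) - f (Inf J))) < e / 2"
      using ac[unfolded abs_cont_on_def, rule_format, OF half_gt_zero[OF \<open>e > 0\<close>]] by blast
    obtain U where U: "open U" "N \<subseteq> U" "U \<in> lmeasurable" "measure lebesgue U < \<delta>"
      using negligible_subset_open_small[OF N \<delta>] by blast
    have "\<exists>r>0. x \<in> {c..d} - N \<longrightarrow> (\<forall>y. \<bar>y - x\<bar> < r \<longrightarrow> cmod (f y - f x - (y - x) *\<^sub>R h x) \<le> e' * \<bar>y - x\<bar>)" for x
    proof (cases "x \<in> {c..d} - N")
      case True
      then have "(f has_derivative (\<lambda>t. t *\<^sub>R h x)) (at x)"
        using der by (simp add: has_vector_derivative_def)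
      then show ?thesis using e'(1)
        unfolding has_derivative_at_alt by (auto simp: real_norm_def)
    qed (auto intro: exI[of _ 1])
    then obtain r where r: "\<And>x. r x > 0"
      "\<And>x y. x \<in> {c..d} - N \<Longrightarrow> \<bar>y - x\<bar> < r x \<Longrightarrow> cmod (f y - f x - (y - x) *\<^sub>R h x) \<le> e' * \<bar>y - x\<bar>"
      by metis
    \<comment> \<open>On \<open>N\<close> the gauge is the covering open set itself instead of a
      ball, so that every interval tagged in \<open>N\<close> lies in \<open>U\<close>.\<close>
    define \<gamma> where "\<gamma> = (\<lambda>x. if x \<in> N then U else ball x (r x))"
    have "gauge \<gamma>"
      unfolding gauge_def \<gamma>_def using U r(1) by auto
    moreover have "norm ((\<Sum>(x, k)\<in>p. content k *\<^sub>R h' x) - (f d - f c)) < e"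
      if p: "p tagged_division_of {c..d}" "\<gamma> fine p" for p
    proof -
      have finp: "finite p" using p(1) by blast
      define P where "P = {xk \<in> p. fst xk \<in> N}"
      have pk: "\<exists>u v. k = {u..v} \<and> u \<le> v \<and> x \<in> k \<and> k \<subseteq> {c..d} \<and> k \<subseteq> \<gamma> x" if xk: "(x, k) \<in> p" for x k
      proof -
        obtain u v where "k = cbox u v" using tagged_division_ofD(4)[OF p(1) xk] by blast
        moreover have "x \<in> k" "k \<subseteq> {c..d}" using tagged_division_ofD(2,3)[OF p(1) xk] by auto
        moreover have "k \<subseteq> \<gamma> x" using p(2) xk by (auto simp: fine_def)
        ultimately show ?thesis by (intro exI[of _ u] exI[of _ v]) auto
      qed
      have tele: "(\<Sum>(x, k)\<in>p. f (Sup k) - f (Inf k)) = f d - f c"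
        using additive_tagged_division_1[OF cd p(1)] .
      have "(\<Sum>(x, k)\<in>p. content k *\<^sub>R h' x) - (f d - f c)
          = (\<Sum>(x, k)\<in>p. content k *\<^sub>R h' x - (f (Sup k) - f (Inf k)))"
        by (simp add: tele[symmetric] sum_subtractf split_def)
      also have "norm \<dots> \<le> (\<Sum>(x, k)\<in>p. norm (content k *\<^sub>R h' x - (f (Sup k) - f (Inf k))))"
        by (rule order.trans[OF norm_sum]) (simp add: split_def)
      also have "\<dots> = (\<Sum>(x, k)\<in>p - P. norm (content k *\<^sub>R h' x - (f (Sup k) - f (Inf k))))
                   + (\<Sum>(x, k)\<in>P. norm (content k *\<^sub>R h' x - (f (Sup k) - f (Inf k))))"
        using finp by (intro sum.subset_diff) (auto simp: P_def)
      also have "(\<Sum>(x, k)\<in>p - P. norm (content k *\<^sub>R h' x - (f (Sup k) - f (Inf k))))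
          \<le> (\<Sum>(x, k)\<in>p - P. e' * content k)"
      proof (rule sum_mono, clarify)
        fix x k assume xk: "(x, k) \<in> p" "(x, k) \<notin> P"
        then have xN: "x \<notin> N" by (auto simp: P_def)
        obtain u v where k: "k = {u..v}" "u \<le> v" "x \<in> k" "k \<subseteq> {c..d}" "k \<subseteq> \<gamma> x"
          using pk xk by metis
        have b: "k \<subseteq> ball x (r x)" using k(5) xN by (simp add: \<gamma>_def)
        have "u \<in> k" "v \<in> k" using k by auto
        then have "u \<in> ball x (r x)" "v \<in> ball x (r x)" using b by blast+
        then have uv: "\<bar>u - x\<bar> < r x" "\<bar>v - x\<bar> < r x" by (auto simp: dist_real_def)
        have x: "x \<in> {c..d} - N" using k xN by auto
        \<comment> \<open>The increment over \<open>{u..v}\<close> is split at the tag, where the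
          derivative estimate applies on both sides.\<close>
        have "content k *\<^sub>R h' x - (f (Sup k) - f (Inf k))
           = (f u - f x - (u - x) *\<^sub>R h x) - (f v - f x - (v - x) *\<^sub>R h x)"
          using k xN by (simp add: h'_def algebra_simps)
        also have "norm \<dots> \<le> e' * \<bar>u - x\<bar> + e' * \<bar>v - x\<bar>"
          using r(2)[OF x uv(1)] r(2)[OF x uv(2)] norm_triangle_ineq4 add_mono order.trans by blast
        also have "\<dots> = e' * content k" using k by (auto simp: algebra_simps)
        finally show "norm (content k *\<^sub>R h' x - (f (Sup k) - f (Inf k))) \<le> e' * content k" .
      qed
      also have "(\<Sum>(x, k)\<in>p - P. e' * content k) \<le> (\<Sum>(x, k)\<in>p. e' * content k)"
        using finp e'(1) by (intro sum_mono2) auto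
      also have "(\<Sum>(x, k)\<in>p. e' * content k) = e' * (d - c)"
        using additive_content_tagged_division[of p c d] p(1) cd
        by (simp add: sum_distrib_left[symmetric] split_def)
      also have "(\<Sum>(x, k)\<in>P. norm (content k *\<^sub>R h' x - (f (Sup k) - f (Inf k))))
          = (\<Sum>(x, k)\<in>P. cmod (f (Sup k) - f (Inf k)))"
        by (rule sum.cong) (auto simp: P_def h'_def norm_minus_commute)
      also have "\<dots> < e / 2"
      proof -
        have "P tagged_partial_division_of {c..d}"
        proof (rule tagged_partial_division_subset)
          show "p tagged_partial_division_of {c..d}" using p(1) by (simp add: tagged_division_of_def)
          show "P \<subseteq> p" by (auto simp: P_def)
        qed
        then have D: "(snd ` P) division_of \<Union>(snd ` P)"
          by (rule partial_division_of_tagged_division)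
        have sub: "\<Union>(snd ` P) \<subseteq> U" "\<Union>(snd ` P) \<subseteq> {c..d}"
        proof -
          have "k \<subseteq> U \<and> k \<subseteq> {c..d}" if "(x, k) \<in> P" for x k
            using pk[of x k] that by (auto simp: P_def \<gamma>_def)
          then show "\<Union>(snd ` P) \<subseteq> U" "\<Union>(snd ` P) \<subseteq> {c..d}" by fastforce+
        qed
        have "(\<Sum>k\<in>snd ` P. cmod (f (Sup k) - f (Inf k))) = (\<Sum>xk\<in>P. cmod (f (Sup (snd xk)) - f (Inf (snd xk))))"
        proof (rule sum.reindex_nontrivial[where g="\<lambda>k. cmod (f (Sup k) - f (Inf k))" and h=snd, unfolded o_def])
          show "finite P" using finp by (simp add: P_def)
          \<comment> \<open>One interval can carry two tags only if it is degenerate, and then its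
            increment is 0; passing from tagged pairs to intervals therefore loses nothing.\<close>
          fix xk yl assume A: "xk \<in> P" "yl \<in> P" "xk \<noteq> yl" "snd xk = snd yl"
          obtain x k y where eq: "xk = (x, k)" "yl = (y, k)" using A(4) by (metis prod.collapse)
          obtain u v where k: "k = {u..v}" "u \<le> v" using pk[of x k] A(1) eq by (auto simp: P_def)
          have "interior k \<inter> interior k = {}"
            using tagged_division_ofD(5)[OF p(1), of x k y k] A eq by (auto simp: P_def)
          then have "u = v" using k by auto
          then show "cmod (f (Sup (snd xk)) - f (Inf (snd xk))) = 0" using k eq by simp
        qed
        moreover have "(\<Sum>k\<in>snd ` P. cmod (f (Sup k) - f (Inf k))) < e / 2"
          using ac'[OF D sub(2)] sum_content_division_le[OF D sub(1) U(3)] U(4) by linarith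
        ultimately show ?thesis by (simp add: split_def)
      qed
      finally show ?thesis using e'(2) by linarith
    qed
    ultimately show "\<exists>\<gamma>. gauge \<gamma> \<and> (\<forall>\<D>. \<D> tagged_division_of {c..d} \<and> \<gamma> fine \<D> \<longrightarrow>
        norm ((\<Sum>(x, k)\<in>\<D>. content k *\<^sub>R h' x) - (f d - f c)) < e)"
      by (intro exI[of _ \<gamma>]) simp
  qed
  then show ?thesis
    by (rule has_integral_spike[OF N, rotated]) (auto simp: h'_def)
qed

text \<open>Lebesgue differentiation over boxes with lower corner \<open>x\<close> gives right-hand
  quotients only. The division is cleared so that the estimate fits the definition of a
  derivative.\<close>

lemma indefinite_integral_right_derivative:
  fixes g :: "real \<Rightarrow> complex"
  assumes "\<And>a b. g integrable_on {a..b}"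
  obtains N where "negligible N"
    "\<And>x e. x \<notin> N \<Longrightarrow> 0 < e \<Longrightarrow> \<exists>r>0. \<forall>h. 0 < h \<and> h < r \<longrightarrow> norm (integral {x..x+h} g - h *\<^sub>R g x) \<le> e * h"
proof -
  obtain N where N: "negligible N" and "\<And>x e. \<lbrakk>x \<notin> N; 0 < e\<rbrakk> \<Longrightarrow>
      \<exists>r>0. \<forall>h. 0 < h \<and> h < r \<longrightarrow> norm (integral (cbox x (x + h *\<^sub>R One)) g /\<^sub>R h ^ DIM(real) - g x) < e"
    using integrable_ccontinuous_explicit[of g] assms by (metis box_real(2))
  then have *: "\<And>x e. \<lbrakk>x \<notin> N; 0 < e\<rbrakk> \<Longrightarrow>
      \<exists>r>0. \<forall>h. 0 < h \<and> h < r \<longrightarrow> norm (integral {x..x+h} g /\<^sub>R h - g x) < e"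
    by simp
  have "\<exists>r>0. \<forall>h. 0 < h \<and> h < r \<longrightarrow> norm (integral {x..x+h} g - h *\<^sub>R g x) \<le> e * h"
    if x: "x \<notin> N" "0 < e" for x e
  proof -
    obtain r where r: "r > 0" "\<And>h. 0 < h \<Longrightarrow> h < r \<Longrightarrow> norm (integral {x..x+h} g /\<^sub>R h - g x) < e"
      using *[OF x] by blast
    have "norm (integral {x..x+h} g - h *\<^sub>R g x) \<le> e * h" if h: "0 < h" "h < r" for h
    proof -
      have "integral {x..x+h} g - h *\<^sub>R g x = h *\<^sub>R (integral {x..x+h} g /\<^sub>R h - g x)"
        using h by (simp add: scaleR_diff_right)
      then have "norm (integral {x..x+h} g - h *\<^sub>R g x) = h * norm (integral {x..x+h} g /\<^sub>R h - g x)"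
        using h by simp
      also have "\<dots> \<le> h * e" using r(2)[OF h] h by (intro mult_left_mono) auto
      finally show ?thesis by (simp add: mult.commute)
    qed
    with r(1) show ?thesis by blast
  qed
  with N that show ?thesis by blast
qed

text \<open>Right-hand quotients come from \<open>g\<close> extended by 0, left-hand ones from the
  reflected function; the two exceptional sets, the second one reflected back, and the end points
  form \<open>N\<close>.\<close>

lemma indefinite_integral_ae_derivative:
  fixes g :: "real \<Rightarrow> complex"
  assumes g: "g integrable_on {c..d}"
  obtains N where "negligible N"
    "\<And>x. x \<in> {c..d} - N \<Longrightarrow> ((\<lambda>x. integral {c..x} g) has_vector_derivative g x) (at x)"
proof -
  define G where "G = (\<lambda>x. if x \<in> {c..d} then g x else 0)"
  have "(G has_integral integral {c..d} g) UNIV"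
    using integrable_integral[OF g] unfolding G_def by (simp only: has_integral_restrict_UNIV)
  then have GU: "G integrable_on UNIV" by blast
  have G: "G integrable_on {a..b}" for a b
    using integrable_on_subcbox[of G UNIV a b] GU by simp
  define H where "H = (\<lambda>x. G (- x))"
  have H: "H integrable_on {a..b}" for a b
    using Henstock_Kurzweil_Integration.integrable_reflect_real[of G "-a" "-b"] G by (simp add: H_def)
  obtain N1 where N1: "negligible N1"
    "\<And>x e. x \<notin> N1 \<Longrightarrow> 0 < e \<Longrightarrow> \<exists>r>0. \<forall>h. 0 < h \<and> h < r \<longrightarrow> norm (integral {x..x+h} G - h *\<^sub>R G x) \<le> e * h"
    using indefinite_integral_right_derivative[OF G] by blast
  obtain N2 where N2: "negligible N2"
    "\<And>x e. x \<notin> N2 \<Longrightarrow> 0 < e \<Longrightarrow> \<exists>r>0. \<forall>h. 0 < h \<and> h < r \<longrightarrow> norm (integral {x..x+h} H - h *\<^sub>R H x) \<le> e * h"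
    using indefinite_integral_right_derivative[OF H] by blast
  have N2': "negligible (uminus ` N2)"
    using N2(1) by (intro negligible_differentiable_image_negligible) (auto intro!: derivative_intros simp: differentiable_on_def)
  define N where "N = N1 \<union> uminus ` N2 \<union> {c, d}"
  have "negligible N" unfolding N_def using N1(1) N2' by auto
  moreover have "((\<lambda>x. integral {c..x} g) has_vector_derivative g x) (at x)" if x: "x \<in> {c..d} - N" for x
  proof -
    have xcd: "x \<in> {c<..<d}" using x by (auto simp: N_def)
    have xN: "x \<notin> N1" "- x \<notin> N2" using x by (auto simp: N_def image_iff)
    have Gx: "G x = g x" "H (-x) = g x" using xcd by (auto simp: G_def H_def)
    have "((\<lambda>x. integral {c..x} G) has_derivative (\<lambda>t. t *\<^sub>R g x)) (at x)"
      unfolding has_derivative_at_alt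
    proof (intro conjI allI impI)
      show "bounded_linear (\<lambda>t. t *\<^sub>R g x)" by (rule bounded_linear_scaleR_left)
      fix e :: real assume e: "0 < e"
      obtain r1 where r1: "r1 > 0" "\<And>h. 0 < h \<Longrightarrow> h < r1 \<Longrightarrow> norm (integral {x..x+h} G - h *\<^sub>R g x) \<le> e * h"
        using N1(2)[OF xN(1) e] Gx by auto
      obtain r2 where r2: "r2 > 0" "\<And>h. 0 < h \<Longrightarrow> h < r2 \<Longrightarrow> norm (integral {-x..-x+h} H - h *\<^sub>R g x) \<le> e * h"
        using N2(2)[OF xN(2) e] Gx by auto
      have "norm (integral {c..y} G - integral {c..x} G - (y - x) *\<^sub>R g x) \<le> e * norm (y - x)"
        if y: "norm (y - x) < min (min r1 r2) (x - c)" for y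
      proof -
        consider "y = x" | "y > x" | "y < x" by linarith
        then show ?thesis
        proof cases
          case 2
          have "integral {c..x} G + integral {x..y} G = integral {c..y} G"
            using xcd 2 by (intro Henstock_Kurzweil_Integration.integral_combine G) auto
          then have "integral {c..y} G - integral {c..x} G - (y - x) *\<^sub>R g x
              = integral {x..x+(y-x)} G - (y - x) *\<^sub>R g x"
            by (simp add: algebra_simps)
          then show ?thesis using r1(2)[of "y - x"] 2 y by simp
        next
          case 3
          have "integral {c..y} G + integral {y..x} G = integral {c..x} G"
            using xcd 3 y by (intro Henstock_Kurzweil_Integration.integral_combine G) auto
          moreover have "integral {-x..-y} H = integral {y..x} G"
            unfolding H_def by (metis Henstock_Kurzweil_Integration.integral_reflect_real)
          ultimately have "integral {c..y} G - integral {c..x} G - (y - x) *\<^sub>R g x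
               = - (integral {-x..-x+(x-y)} H - (x - y) *\<^sub>R g x)"
            by (simp add: algebra_simps)
          then have "norm (integral {c..y} G - integral {c..x} G - (y - x) *\<^sub>R g x)
               = norm (integral {-x..-x+(x-y)} H - (x - y) *\<^sub>R g x)"
            by (simp only: norm_minus_cancel)
          also have "\<dots> \<le> e * (x - y)" using r2(2)[of "x - y"] 3 y by simp
          finally show ?thesis using 3 by simp
        qed simp
      qed
      moreover have "min (min r1 r2) (x - c) > 0" using r1 r2 xcd by auto
      ultimately show "\<exists>r>0. \<forall>y. norm (y - x) < r \<longrightarrow>
           norm (integral {c..y} G - integral {c..x} G - (y - x) *\<^sub>R g x) \<le> e * norm (y - x)"
        by blast
    qed
    then have "((\<lambda>x. integral {c..x} G) has_vector_derivative g x) (at x)"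
      by (simp add: has_vector_derivative_def)
    moreover have "integral {c..y} G = integral {c..y} g" if "y \<in> {c<..<d}" for y
      using that by (intro integral_cong) (auto simp: G_def)
    ultimately show ?thesis
      using has_vector_derivative_transform_within_open[of "\<lambda>y. integral {c..y} G" "g x" x "{c<..<d}"] xcd
      by simp
  qed
  ultimately show ?thesis using that by blast
qed

section \<open>Closure properties of absolute continuity, and indefinite integrals\<close>

text \<open>A domination principle: it spares a new epsilon-delta argument for products, for
  exponentials of primitives, and for functions that differ from an integral by a constant.\<close>

lemma abs_cont_on_dominated:
  assumes f: "abs_cont_on c d f" and g: "abs_cont_on c d g"
    and le: "\<And>s t. s \<in> {c..d} \<Longrightarrow> t \<in> {c..d} \<Longrightarrow>
      cmod (h s - h t) \<le> A * cmod (f s - f t) + B * cmod (g s - g t)"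
  shows "abs_cont_on c d h"
  unfolding abs_cont_on_def
proof (intro allI impI)
  fix e :: real assume "e > 0"
  \<comment> \<open>At least 1, so that \<open>e / (2 * M)\<close> is a positive threshold whatever
    the signs of \<open>A\<close> and \<open>B\<close>.\<close>
  define M where "M = max 1 (max A B)"
  have M: "M > 0" "A \<le> M" "B \<le> M" by (auto simp: M_def)
  have eM: "e / (2 * M) > 0" using \<open>e > 0\<close> M by simp
  obtain d1 where d1: "d1 > 0" "\<And>D. D division_of \<Union>D \<Longrightarrow> \<Union>D \<subseteq> {c..d} \<Longrightarrow>
      (\<Sum>J\<in>D. Sup J - Inf J) < d1 \<Longrightarrow> (\<Sum>J\<in>D. cmod (f (Sup J) - f (Inf J))) < e / (2 * M)"
    using f[unfolded abs_cont_on_def, rule_format, OF eM] by blast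
  obtain d2 where d2: "d2 > 0" "\<And>D. D division_of \<Union>D \<Longrightarrow> \<Union>D \<subseteq> {c..d} \<Longrightarrow>
      (\<Sum>J\<in>D. Sup J - Inf J) < d2 \<Longrightarrow> (\<Sum>J\<in>D. cmod (g (Sup J) - g (Inf J))) < e / (2 * M)"
    using g[unfolded abs_cont_on_def, rule_format, OF eM] by blast
  have "(\<Sum>J\<in>D. cmod (h (Sup J) - h (Inf J))) < e"
    if D: "D division_of \<Union>D" "\<Union>D \<subseteq> {c..d}" "(\<Sum>J\<in>D. Sup J - Inf J) < min d1 d2" for D
  proof -
    have "(\<Sum>J\<in>D. cmod (h (Sup J) - h (Inf J)))
        \<le> (\<Sum>J\<in>D. M * cmod (f (Sup J) - f (Inf J)) + M * cmod (g (Sup J) - g (Inf J)))"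
    proof (rule sum_mono)
      fix J assume J: "J \<in> D"
      obtain u v where uv: "J = cbox u v" using division_ofD(4)[OF D(1) J] by blast
      have ne: "J \<noteq> {}" using division_ofD(3)[OF D(1) J] .
      have "Sup J \<in> J" "Inf J \<in> J" using uv ne by auto
      then have "Sup J \<in> {c..d}" "Inf J \<in> {c..d}" using D(2) J by auto
      then have "cmod (h (Sup J) - h (Inf J)) \<le> A * cmod (f (Sup J) - f (Inf J)) + B * cmod (g (Sup J) - g (Inf J))"
        by (rule le)
      also have "\<dots> \<le> M * cmod (f (Sup J) - f (Inf J)) + M * cmod (g (Sup J) - g (Inf J))"
        using M by (intro add_mono mult_right_mono) auto
      finally show "cmod (h (Sup J) - h (Inf J)) \<le> \<dots>" .
    qed
    also have "\<dots> = M * ((\<Sum>J\<in>D. cmod (f (Sup J) - f (Inf J))) + (\<Sum>J\<in>D. cmod (g (Sup J) - g (Inf J))))"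
      by (simp add: sum.distrib sum_distrib_left algebra_simps)
    also have "\<dots> < M * (e / (2 * M) + e / (2 * M))"
      using d1(2)[OF D(1,2)] d2(2)[OF D(1,2)] D(3) M by (intro mult_strict_left_mono add_strict_mono) auto
    also have "\<dots> = e" using M by simp
    finally show ?thesis .
  qed
  then show "\<exists>\<delta>>0. \<forall>D. D division_of \<Union> D \<and> \<Union> D \<subseteq> {c..d} \<and> (\<Sum>J\<in>D. Sup J - Inf J) < \<delta> \<longrightarrow>
       (\<Sum>J\<in>D. cmod (h (Sup J) - h (Inf J))) < e"
    using d1(1) d2(1) by (intro exI[of _ "min d1 d2"]) auto
qed

lemma abs_cont_on_imp_continuous_on:
  assumes "abs_cont_on c d f"
  shows "continuous_on {c..d} f"
  unfolding continuous_on_iff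
proof (intro ballI allI impI)
  fix x e :: real assume x: "x \<in> {c..d}" and e: "0 < e"
  obtain r where r: "r > 0" "\<And>D. D division_of \<Union>D \<Longrightarrow> \<Union>D \<subseteq> {c..d} \<Longrightarrow>
      (\<Sum>J\<in>D. Sup J - Inf J) < r \<Longrightarrow> (\<Sum>J\<in>D. cmod (f (Sup J) - f (Inf J))) < e"
    using assms[unfolded abs_cont_on_def, rule_format, OF e] by blast
  have *: "cmod (f v - f u) < e" if "u \<in> {c..d}" "v \<in> {c..d}" "u \<le> v" "v - u < r" for u v
  proof -
    have "{{u..v}} division_of \<Union>{{u..v}}"
      using division_of_self[of u v] that by simp
    from r(2)[OF this] that show ?thesis by auto
  qed
  have "dist (f y) (f x) < e" if "y \<in> {c..d}" "dist y x < r" for y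
    using *[of x y] *[of y x] that x
    by (cases "x \<le> y") (auto simp: dist_norm norm_minus_commute)
  with r(1) show "\<exists>d'>0. \<forall>x'\<in>{c..d}. dist x' x < d' \<longrightarrow> dist (f x') (f x) < e" by blast
qed

lemma abs_cont_on_mult:
  assumes f: "abs_cont_on c d f" and g: "abs_cont_on c d g"
  shows "abs_cont_on c d (\<lambda>x. f x * g x)"
proof -
  have "bounded (f ` {c..d})" "bounded (g ` {c..d})"
    using f g by (intro compact_imp_bounded compact_continuous_image abs_cont_on_imp_continuous_on; simp)+
  then obtain A B where A: "\<And>x. x \<in> {c..d} \<Longrightarrow> cmod (f x) \<le> A" and B: "\<And>x. x \<in> {c..d} \<Longrightarrow> cmod (g x) \<le> B"
    unfolding bounded_iff by (metis imageI)
  show ?thesis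
  proof (rule abs_cont_on_dominated[OF f g, of _ B A])
    fix s t assume st: "s \<in> {c..d}" "t \<in> {c..d}"
    have "f s * g s - f t * g t = (f s - f t) * g s + f t * (g s - g t)"
      by (simp add: algebra_simps)
    then have "cmod (f s * g s - f t * g t) \<le> cmod (f s - f t) * cmod (g s) + cmod (f t) * cmod (g s - g t)"
      by (metis norm_mult norm_triangle_ineq)
    also have "\<dots> \<le> cmod (f s - f t) * B + A * cmod (g s - g t)"
      using A B st by (intro add_mono mult_left_mono mult_right_mono) auto
    finally show "cmod (f s * g s - f t * g t) \<le> B * cmod (f s - f t) + A * cmod (g s - g t)"
      by (simp add: mult.commute)
  qed
qed

lemma abs_cont_on_subinterval:
  "abs_cont_on c d f \<Longrightarrow> {c'..d'} \<subseteq> {c..d} \<Longrightarrow> abs_cont_on c' d' f"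
  unfolding abs_cont_on_def
proof (intro allI impI)
  fix e :: real assume f: "\<forall>\<epsilon>>0. \<exists>\<delta>>0. \<forall>D. D division_of \<Union> D \<and> \<Union> D \<subseteq> {c..d} \<and> (\<Sum>J\<in>D. Sup J - Inf J) < \<delta>
      \<longrightarrow> (\<Sum>J\<in>D. cmod (f (Sup J) - f (Inf J))) < \<epsilon>" and sub: "{c'..d'} \<subseteq> {c..d}" and "e > 0"
  from f[rule_format, OF \<open>e > 0\<close>] obtain \<delta> where \<delta>: "\<delta> > 0"
    "\<And>D. D division_of \<Union> D \<and> \<Union> D \<subseteq> {c..d} \<and> (\<Sum>J\<in>D. Sup J - Inf J) < \<delta>
      \<Longrightarrow> (\<Sum>J\<in>D. cmod (f (Sup J) - f (Inf J))) < e" by blast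
  show "\<exists>\<delta>>0. \<forall>D. D division_of \<Union> D \<and> \<Union> D \<subseteq> {c'..d'} \<and> (\<Sum>J\<in>D. Sup J - Inf J) < \<delta>
      \<longrightarrow> (\<Sum>J\<in>D. cmod (f (Sup J) - f (Inf J))) < e"
    using \<delta>(1) by (intro exI[of _ \<delta>] conjI allI impI \<delta>(2)) (use sub in auto)
qed

text \<open>The excess of \<open>cmod (g x)\<close> over the level \<open>n\<close> is eventually 0
  at each point and dominated by \<open>cmod (g x)\<close>, so dominated convergence makes its
  integral small.\<close>

lemma absolutely_integrable_truncation_small:
  fixes g :: "real \<Rightarrow> complex"
  assumes g: "g absolutely_integrable_on {c..d}" and "e > 0"
  obtains n :: nat where "(\<lambda>x. max (cmod (g x) - real n) 0) absolutely_integrable_on {c..d}"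
    "integral {c..d} (\<lambda>x. max (cmod (g x) - real n) 0) < e"
proof -
  have ng: "(\<lambda>x. cmod (g x)) absolutely_integrable_on {c..d}"
    using absolutely_integrable_norm[OF g] by (simp add: o_def)
  have int: "(\<lambda>x. max (cmod (g x) - real n) 0) absolutely_integrable_on {c..d}" for n
    by (intro absolutely_integrable_max_1 set_integral_diff(1) ng) (auto intro!: absolutely_integrable_on_const simp del: box_real simp: box_real(2)[symmetric])
  have "(\<lambda>n. integral {c..d} (\<lambda>x. max (cmod (g x) - real n) 0)) \<longlonglongrightarrow> integral {c..d} (\<lambda>x. 0 :: real)"
  proof (rule dominated_convergence(2))
    show "(\<lambda>x. max (cmod (g x) - real n) 0) integrable_on {c..d}" for n
      using int by (simp add: set_lebesgue_integral_eq_integral(1))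
    show "(\<lambda>x. cmod (g x)) integrable_on {c..d}"
      using ng by (simp add: set_lebesgue_integral_eq_integral(1))
    show "norm (max (cmod (g x) - real n) 0) \<le> cmod (g x)" for n x by auto
    show "(\<lambda>n. max (cmod (g x) - real n) 0) \<longlonglongrightarrow> 0" for x
    proof (rule tendsto_eventually)
      obtain N where "cmod (g x) \<le> real N" using real_arch_simple by blast
      then show "\<forall>\<^sub>F n in sequentially. max (cmod (g x) - real n) 0 = 0"
        unfolding eventually_sequentially
        by (intro exI[of _ N]) (auto simp: max_def intro: order.trans)
    qed
  qed
  then have "(\<lambda>n. integral {c..d} (\<lambda>x. max (cmod (g x) - real n) 0)) \<longlonglongrightarrow> 0" by simp
  from order_tendstoD(2)[OF this \<open>e > 0\<close>] obtain n where
    "integral {c..d} (\<lambda>x. max (cmod (g x) - real n) 0) < e"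
    by (auto simp: eventually_sequentially)
  with int that show ?thesis by blast
qed

text \<open>Splitting |g| at a level \<open>n\<close>: the part below \<open>n\<close> contributes
  little over short intervals, and the excess has small integral over the whole of
  \<open>{c..d}\<close>.\<close>

lemma abs_cont_on_indefinite_integral:
  fixes g :: "real \<Rightarrow> complex"
  assumes g: "g absolutely_integrable_on {c..d}"
  shows "abs_cont_on c d (\<lambda>x. integral {c..x} g)"
  unfolding abs_cont_on_def
proof (intro allI impI)
  fix e :: real assume "e > 0"
  define F where "F = (\<lambda>x. integral {c..x} g)"
  obtain n :: nat where n: "(\<lambda>x. max (cmod (g x) - real n) 0) absolutely_integrable_on {c..d}"
    "integral {c..d} (\<lambda>x. max (cmod (g x) - real n) 0) < e / 2"
    using absolutely_integrable_truncation_small[OF g, of "e / 2"] \<open>e > 0\<close> by auto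
  define h where "h = (\<lambda>x. max (cmod (g x) - real n) 0)"
  have hi: "h integrable_on {c..d}"
    using n(1) by (simp add: h_def set_lebesgue_integral_eq_integral(1))
  have gi: "g integrable_on {c..d}" using g by (simp add: set_lebesgue_integral_eq_integral(1))
  \<comment> \<open>\<open>real n + 1\<close> instead of \<open>real n\<close> keeps the threshold
    positive at \<open>n = 0\<close>.\<close>
  define r where "r = e / (2 * (real n + 1))"
  have r: "r > 0" "real n * r \<le> e / 2" using \<open>e > 0\<close> by (auto simp: r_def field_simps)
  have "(\<Sum>J\<in>D. cmod (F (Sup J) - F (Inf J))) < e"
    if D: "D division_of \<Union>D" "\<Union>D \<subseteq> {c..d}" "(\<Sum>J\<in>D. Sup J - Inf J) < r" for D
  proof -
    have J: "\<exists>u v. J = {u..v} \<and> u \<le> v \<and> {u..v} \<subseteq> {c..d}" if J: "J \<in> D" for J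
    proof -
      obtain u v where uv: "J = cbox u v" using division_ofD(4)[OF D(1) J] by blast
      have "J \<noteq> {}" using division_ofD(3)[OF D(1) J] .
      moreover have "J \<subseteq> {c..d}" using D(2) J by blast
      ultimately show ?thesis using uv by (intro exI[of _ u] exI[of _ v]) auto
    qed
    have hJ: "h integrable_on J" if "J \<in> D" for J
      using J[OF that] integrable_on_subinterval[OF hi] by metis
    have "(\<Sum>J\<in>D. cmod (F (Sup J) - F (Inf J))) \<le> (\<Sum>J\<in>D. real n * (Sup J - Inf J) + integral J h)"
    proof (rule sum_mono)
      fix J assume "J \<in> D"
      from J[OF this] obtain u v where uv: "J = {u..v}" "u \<le> v" "{u..v} \<subseteq> {c..d}" by blast
      have "integral {c..u} g + integral {u..v} g = integral {c..v} g"
        using uv by (intro Henstock_Kurzweil_Integration.integral_combine integrable_on_subinterval[OF gi]) auto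
      then have "F (Sup J) - F (Inf J) = integral {u..v} g" using uv by (simp add: F_def algebra_simps)
      moreover have "cmod (integral {u..v} g) \<le> integral {u..v} (\<lambda>x. real n + h x)"
      proof (rule integral_norm_bound_integral)
        show "g integrable_on {u..v}" using integrable_on_subinterval[OF gi] uv by blast
        show "(\<lambda>x. real n + h x) integrable_on {u..v}"
          using integrable_on_subinterval[OF hi] uv by (intro integrable_add) auto
      qed (auto simp: h_def)
      moreover have "integral {u..v} (\<lambda>x. real n + h x) = real n * (v - u) + integral {u..v} h"
        using integrable_on_subinterval[OF hi] uv
        by (subst Henstock_Kurzweil_Integration.integral_add) auto
      ultimately show "cmod (F (Sup J) - F (Inf J)) \<le> real n * (Sup J - Inf J) + integral J h"
        using uv by simp
    qed
    also have "\<dots> = real n * (\<Sum>J\<in>D. Sup J - Inf J) + integral (\<Union>D) h"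
      using integral_combine_division_bottomup[OF D(1) hJ] by (simp add: sum.distrib sum_distrib_left)
    also have "integral (\<Union>D) h \<le> integral {c..d} h"
    proof (rule integral_subset_le[OF D(2) _ hi])
      show "h integrable_on \<Union>D"
        using integrable_combine_division[OF D(1) hJ] .
    qed (auto simp: h_def)
    also have "real n * (\<Sum>J\<in>D. Sup J - Inf J) \<le> real n * r"
      using D(3) by (intro mult_left_mono) auto
    finally show ?thesis using r n(2) unfolding h_def by linarith
  qed
  then show "\<exists>\<delta>>0. \<forall>D. D division_of \<Union> D \<and> \<Union> D \<subseteq> {c..d} \<and> (\<Sum>J\<in>D. Sup J - Inf J) < \<delta> \<longrightarrow>
       (\<Sum>J\<in>D. cmod (integral {c..Sup J} g - integral {c..Inf J} g)) < e"
    unfolding F_def using r(1) by (intro exI[of _ r]) auto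
qed

text \<open>Exceptional sets become explicit negligible sets, which gauge integrals accept and which
  can be united freely.\<close>

lemma AE_lebesgue_on_iff_negligible:
  assumes "S \<in> sets lebesgue"
  shows "(AE x in lebesgue_on S. P x) \<longleftrightarrow> (\<exists>N. negligible N \<and> (\<forall>x\<in>S - N. P x))"
proof -
  have "(AE x in lebesgue_on S. P x) \<longleftrightarrow> (AE x in lebesgue. x \<in> S \<longrightarrow> P x)"
    using assms by (subst AE_restrict_space_iff) auto
  also have "\<dots> \<longleftrightarrow> (\<exists>N. negligible N \<and> (\<forall>x\<in>S - N. P x))"
  proof
    assume "AE x in lebesgue. x \<in> S \<longrightarrow> P x"
    then obtain N where "{x \<in> space lebesgue. \<not> (x \<in> S \<longrightarrow> P x)} \<subseteq> N" "N \<in> null_sets lebesgue"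
      by (auto simp: eventually_ae_filter)
    then show "\<exists>N. negligible N \<and> (\<forall>x\<in>S - N. P x)"
      by (intro exI[of _ N]) (auto simp: negligible_iff_null_sets)
  next
    assume "\<exists>N. negligible N \<and> (\<forall>x\<in>S - N. P x)"
    then obtain N where "N \<in> null_sets lebesgue" "\<forall>x\<in>S - N. P x"
      by (auto simp: negligible_iff_null_sets)
    then show "AE x in lebesgue. x \<in> S \<longrightarrow> P x"
      by (intro AE_I'[of N]) auto
  qed
  finally show ?thesis .
qed

section \<open>Primitives on an interval with least point \<open>a\<close>\<close>

text \<open>The right end may be included, excluded or infinite, so that \<open>[a, b)\<close> and
  the compact intervals \<open>[a, b_n]\<close> fall under one theory.\<close>

definition initial_interval :: "real \<Rightarrow> real set \<Rightarrow> bool" where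
  "initial_interval a J \<longleftrightarrow> a \<in> J \<and> is_interval J \<and> (\<forall>x\<in>J. a \<le> x)"

lemma initial_interval_sub:
  assumes "initial_interval a J" "x \<in> J"
  shows "{a..x} \<subseteq> J" "a \<le> x" "a \<in> J"
proof -
  show "a \<in> J" "a \<le> x" using assms by (simp_all add: initial_interval_def)
  have "is_interval J" using assms by (simp add: initial_interval_def)
  then show "{a..x} \<subseteq> J" using \<open>a \<in> J\<close> assms(2) unfolding is_interval_1 by fastforce
qed

lemma initial_interval_Icc: "a \<le> c \<Longrightarrow> initial_interval a {a..c}"
  by (simp add: initial_interval_def is_interval_cc)

lemma initial_interval_co_interval: "ereal a < b \<Longrightarrow> initial_interval a (co_interval a b)"
  unfolding initial_interval_def is_interval_1
proof (intro conjI ballI allI impI)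
  assume ab: "ereal a < b"
  show "a \<in> co_interval a b" using ab by (simp add: co_interval_def)
  show "a \<le> x" if "x \<in> co_interval a b" for x using that by (simp add: co_interval_def)
  fix u v x assume "u \<in> co_interval a b" "v \<in> co_interval a b" "u \<le> x \<and> x \<le> v"
  moreover have "ereal x \<le> ereal v" using calculation by simp
  ultimately show "x \<in> co_interval a b"
    unfolding co_interval_def using order.strict_trans1[of "ereal x" "ereal v" b] by auto
qed

lemma initial_interval_sets_lebesgue:
  assumes "initial_interval a J" shows "J \<in> sets lebesgue"
proof -
  have "J \<in> sets borel" using assms by (simp add: initial_interval_def real_interval_borel_measurable)
  then show ?thesis by simp
qed

text \<open>Encodes y' = g for a locally absolutely continuous y in integrated form.
  \<open>g\<close> is any representative, so an equation between derivatives has to hold only off a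
  null set.\<close>

definition primitive_on :: "real set \<Rightarrow> real \<Rightarrow> (real \<Rightarrow> complex) \<Rightarrow> (real \<Rightarrow> complex) \<Rightarrow> bool" where
  "primitive_on J a g y \<longleftrightarrow>
     (\<forall>x\<in>J. g absolutely_integrable_on {a..x} \<and> y x = y a + integral {a..x} g)"

lemma primitive_on_integrable:
  assumes "primitive_on J a g y" "x \<in> J"
  shows "g absolutely_integrable_on {a..x}" "g integrable_on {a..x}"
proof -
  show "g absolutely_integrable_on {a..x}" using assms unfolding primitive_on_def by blast
  then show "g integrable_on {a..x}" by (rule set_lebesgue_integral_eq_integral(1))
qed

lemma primitive_on_value:
  "primitive_on J a g y \<Longrightarrow> x \<in> J \<Longrightarrow> y x = y a + integral {a..x} g"
  unfolding primitive_on_def by blast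

lemma primitive_on_subset: "primitive_on J a g y \<Longrightarrow> J' \<subseteq> J \<Longrightarrow> primitive_on J' a g y"
  unfolding primitive_on_def by blast

lemma primitive_on_abs_cont:
  assumes J: "initial_interval a J" and y: "primitive_on J a g y" and cd: "{c..d} \<subseteq> J"
  shows "abs_cont_on c d y"
proof (cases "c \<le> d")
  case True
  then have d: "d \<in> J" using cd by auto
  have ac: "abs_cont_on a d (\<lambda>x. integral {a..x} g)"
    by (rule abs_cont_on_indefinite_integral[OF primitive_on_integrable(1)[OF y d]])
  have "abs_cont_on a d y"
  proof (rule abs_cont_on_dominated[OF ac ac, of _ 1 0])
    fix s t assume "s \<in> {a..d}" "t \<in> {a..d}"
    then have "s \<in> J" "t \<in> J" using initial_interval_sub[OF J d] by auto
    then show "cmod (y s - y t) \<le> 1 * cmod (integral {a..s} g - integral {a..t} g) + 0 * cmod (integral {a..s} g - integral {a..t} g)"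
      using primitive_on_value[OF y] by simp
  qed
  moreover have "{c..d} \<subseteq> {a..d}" using cd J by (auto simp: initial_interval_def)
  ultimately show ?thesis by (rule abs_cont_on_subinterval)
next
  case False
  have "abs_cont_on c d (\<lambda>x. 0)" unfolding abs_cont_on_def by (auto intro: exI[of _ 1])
  then show ?thesis
    by (rule abs_cont_on_dominated[of c d "\<lambda>x. 0" "\<lambda>x. 0" y 0 0]) (use \<open>abs_cont_on c d (\<lambda>x. 0)\<close> False in auto)
qed

lemma primitive_on_continuous:
  assumes "initial_interval a J" "primitive_on J a g y" "{c..d} \<subseteq> J"
  shows "continuous_on {c..d} y"
  by (rule abs_cont_on_imp_continuous_on[OF primitive_on_abs_cont[OF assms]])

text \<open>The null sets belonging to uncountably many \<open>c\<close> cannot be united. Rational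
  \<open>c\<close> suffice, except at a possible greatest element of \<open>J\<close>, beyond which
  \<open>J\<close> has no rational.\<close>

lemma initial_interval_negligible:
  assumes J: "initial_interval a J"
    and neg: "\<And>c. c \<in> J \<Longrightarrow> \<exists>N. negligible N \<and> (\<forall>x\<in>{a<..<c} - N. P x)"
  obtains N where "negligible N" "\<And>x. x \<in> J - N \<Longrightarrow> P x"
proof -
  define E where "E = {x \<in> J. \<forall>r\<in>J. r \<le> x}"
  \<comment> \<open>\<open>E\<close> contains at most the greatest element of \<open>J\<close>; the
    choice term avoids deciding whether there is one.\<close>
  have "E \<subseteq> {SOME x. x \<in> E}" 
  proof
    fix x assume x: "x \<in> E"
    then have "(SOME x. x \<in> E) \<in> E" by (rule someI)
    with x show "x \<in> {SOME x. x \<in> E}" unfolding E_def by (auto intro: order.antisym)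
  qed
  then have E: "negligible E" using negligible_subset[OF negligible_sing] by blast
  obtain M where M: "\<And>c. c \<in> J \<Longrightarrow> negligible (M c)" "\<And>c x. c \<in> J \<Longrightarrow> x \<in> {a<..<c} - M c \<Longrightarrow> P x"
    using neg by metis
  define N where "N = {a} \<union> E \<union> (\<Union>r\<in>J \<inter> \<rat>. M r)"
  have "countable (J \<inter> \<rat>)" using countable_rat by (rule countable_Int2)
  then have "negligible N" unfolding N_def using E M(1)
    by (intro negligible_Un negligible_countable_Union) auto
  moreover have "P x" if x: "x \<in> J - N" for x
  proof -
    obtain r' where r': "r' \<in> J" "x < r'" using x unfolding N_def E_def by fastforce
    obtain r where r: "r \<in> \<rat>" "x < r" "r < r'" using Rats_dense_in_real r'(2) by blast
    have ax: "a < x" using x J by (auto simp: N_def initial_interval_def less_le)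
    have "r \<in> J" using initial_interval_sub(1)[OF J r'(1)] r ax by auto
    with r ax x show ?thesis by (intro M(2)[of r]) (auto simp: N_def)
  qed
  ultimately show ?thesis using that by blast
qed

lemma primitive_on_derivative:
  assumes J: "initial_interval a J" and y: "primitive_on J a g y"
  obtains N where "negligible N" "\<And>x. x \<in> J - N \<Longrightarrow> (y has_vector_derivative g x) (at x)"
proof -
  have "\<exists>N. negligible N \<and> (\<forall>x\<in>{a<..<c} - N. (y has_vector_derivative g x) (at x))" if c: "c \<in> J" for c
  proof -
    obtain N where N: "negligible N"
      "\<And>x. x \<in> {a..c} - N \<Longrightarrow> ((\<lambda>x. integral {a..x} g) has_vector_derivative g x) (at x)"
      using indefinite_integral_ae_derivative[OF primitive_on_integrable(2)[OF y c]] by blast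
    have "(y has_vector_derivative g x) (at x)" if x: "x \<in> {a<..<c} - N" for x
    proof (rule has_vector_derivative_transform_within_open[of _ _ _ "{a<..<c}"])
      show "((\<lambda>x. y a + integral {a..x} g) has_vector_derivative g x) (at x)"
        using N(2)[of x] x by (intro derivative_eq_intros) auto
      show "y a + integral {a..t} g = y t" if "t \<in> {a<..<c}" for t
      proof -
        have "t \<in> J" using initial_interval_sub(1)[OF J c] that by (auto simp: subset_iff)
        from primitive_on_value[OF y this] show ?thesis by simp
      qed
    qed (use x in auto)
    with N(1) show ?thesis by blast
  qed
  from initial_interval_negligible[OF J this] that show ?thesis by blast
qed

text \<open>The way back from absolute continuity and an almost-everywhere derivative; here the
  fundamental theorem for absolutely continuous functions enters.\<close>

lemma primitive_onI:
  assumes J: "initial_interval a J" and ac: "\<And>x. x \<in> J \<Longrightarrow> abs_cont_on a x y"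
    and N: "negligible N" and der: "\<And>x. x \<in> J - N \<Longrightarrow> (y has_vector_derivative g x) (at x)"
    and int: "\<And>x. x \<in> J \<Longrightarrow> g absolutely_integrable_on {a..x}"
  shows "primitive_on J a g y"
  unfolding primitive_on_def
proof (intro ballI conjI int)
  fix x assume x: "x \<in> J"
  have "(g has_integral (y x - y a)) {a..x}"
    using initial_interval_sub[OF J x] by (intro abs_cont_has_integral[OF _ ac[OF x] N] der) auto
  then show "y x = y a + integral {a..x} g" by (simp add: integral_unique)
qed

lemma primitive_on_cong_ae:
  assumes y: "primitive_on J a g y" and J: "initial_interval a J" and N: "negligible N"
    and eq: "\<And>x. x \<in> J - N \<Longrightarrow> g x = h x"
  shows "primitive_on J a h y"
  unfolding primitive_on_def
proof (intro ballI conjI)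
  fix x assume x: "x \<in> J"
  have sub: "{a..x} \<subseteq> J" using initial_interval_sub[OF J x] by blast
  show "h absolutely_integrable_on {a..x}"
    by (rule absolutely_integrable_spike[OF primitive_on_integrable(1)[OF y x] N]) (use eq sub in auto)
  have "integral {a..x} g = integral {a..x} h"
    by (rule integral_spike[OF N]) (use eq sub in auto)
  then show "y x = y a + integral {a..x} h" using primitive_on_value[OF y x] by simp
qed

lemma absolutely_integrable_mult_continuous:
  fixes f g :: "real \<Rightarrow> complex"
  assumes f: "continuous_on {c..d} f" and g: "g absolutely_integrable_on {c..d}"
  shows "(\<lambda>x. f x * g x) absolutely_integrable_on {c..d}" "(\<lambda>x. g x * f x) absolutely_integrable_on {c..d}"
proof -
  have "f \<in> borel_measurable (lebesgue_on {c..d})"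
    using f by (intro continuous_imp_measurable_on_sets_lebesgue) auto
  moreover have "bounded (f ` {c..d})"
    using f by (intro compact_imp_bounded compact_continuous_image) auto
  ultimately show *: "(\<lambda>x. f x * g x) absolutely_integrable_on {c..d}"
    using g by (intro absolutely_integrable_bounded_measurable_product[OF bilinear_times]) auto
  then show "(\<lambda>x. g x * f x) absolutely_integrable_on {c..d}"
    by (simp add: mult.commute)
qed

text \<open>Integration by parts in disguise: the product is again absolutely continuous, and
  Leibniz' rule identifies its derivative off a null set.\<close>

lemma primitive_on_mult:
  assumes J: "initial_interval a J" and y: "primitive_on J a g y" and z: "primitive_on J a h z"
  shows "primitive_on J a (\<lambda>x. g x * z x + y x * h x) (\<lambda>x. y x * z x)"
proof -
  obtain N1 where N1: "negligible N1" "\<And>x. x \<in> J - N1 \<Longrightarrow> (y has_vector_derivative g x) (at x)"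
    using primitive_on_derivative[OF J y] by blast
  obtain N2 where N2: "negligible N2" "\<And>x. x \<in> J - N2 \<Longrightarrow> (z has_vector_derivative h x) (at x)"
    using primitive_on_derivative[OF J z] by blast
  show ?thesis
  proof (rule primitive_onI[OF J])
    show "abs_cont_on a x (\<lambda>x. y x * z x)" if "x \<in> J" for x
      using that initial_interval_sub[OF J that] y z by (intro abs_cont_on_mult primitive_on_abs_cont[OF J])
    show "negligible (N1 \<union> N2)" using N1 N2 by simp
    show "((\<lambda>x. y x * z x) has_vector_derivative g x * z x + y x * h x) (at x)" if "x \<in> J - (N1 \<union> N2)" for x
      using has_vector_derivative_mult[OF N1(2) N2(2), of x] that by (simp add: add.commute)
    show "(\<lambda>x. g x * z x + y x * h x) absolutely_integrable_on {a..x}" if x: "x \<in> J" for x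
      using primitive_on_continuous[OF J y initial_interval_sub(1)[OF J x]]
        primitive_on_continuous[OF J z initial_interval_sub(1)[OF J x]]
        primitive_on_integrable(1)[OF y x] primitive_on_integrable(1)[OF z x]
      by (intro set_integral_add absolutely_integrable_mult_continuous)
  qed
qed

lemma primitive_on_add:
  assumes y: "primitive_on J a g y" and z: "primitive_on J a h z"
  shows "primitive_on J a (\<lambda>x. g x + h x) (\<lambda>x. y x + z x)"
  unfolding primitive_on_def
proof (intro ballI conjI)
  fix x assume x: "x \<in> J"
  show "(\<lambda>x. g x + h x) absolutely_integrable_on {a..x}"
    using set_integral_add(1)[OF primitive_on_integrable(1)[OF y x] primitive_on_integrable(1)[OF z x]] .
  show "y x + z x = y a + z a + integral {a..x} (\<lambda>x. g x + h x)"
    using primitive_on_value[OF y x] primitive_on_value[OF z x]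
      Henstock_Kurzweil_Integration.integral_add[OF primitive_on_integrable(2)[OF y x] primitive_on_integrable(2)[OF z x]]
    by (simp only: ac_simps)
qed

lemma primitive_on_bounded_linear:
  assumes y: "primitive_on J a g y" and f: "bounded_linear f"
  shows "primitive_on J a (\<lambda>x. f (g x)) (\<lambda>x. f (y x))"
  unfolding primitive_on_def
proof (intro ballI conjI)
  fix x assume x: "x \<in> J"
  show "(\<lambda>x. f (g x)) absolutely_integrable_on {a..x}"
    using absolutely_integrable_linear[OF primitive_on_integrable(1)[OF y x] f] unfolding o_def .
  have "f (y x) = f (y a) + f (integral {a..x} g)"
    using primitive_on_value[OF y x] linear_add[OF bounded_linear.linear[OF f]] by metis
  then show "f (y x) = f (y a) + integral {a..x} (\<lambda>x. f (g x))"
    using integral_linear[OF primitive_on_integrable(2)[OF y x] f] unfolding o_def by metis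
qed

lemma primitive_on_cmult:
  "primitive_on J a g y \<Longrightarrow> primitive_on J a (\<lambda>x. c * g x) (\<lambda>x. c * y x)"
  using primitive_on_bounded_linear[OF _ bounded_linear_mult_right] .

lemma primitive_on_cnj:
  "primitive_on J a g y \<Longrightarrow> primitive_on J a (\<lambda>x. cnj (g x)) (\<lambda>x. cnj (y x))"
  using primitive_on_bounded_linear[OF _ bounded_linear_cnj] .

lemma primitive_on_diff:
  "primitive_on J a g y \<Longrightarrow> primitive_on J a h z \<Longrightarrow> primitive_on J a (\<lambda>x. g x - h x) (\<lambda>x. y x - z x)"
  using primitive_on_add[of J a g y "\<lambda>x. -1 * h x" "\<lambda>x. -1 * z x"] primitive_on_cmult[of J a h z "-1"] by simp

lemma primitive_on_constant:
  assumes J: "initial_interval a J" and y: "primitive_on J a g y" and N: "negligible N"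
    and g: "\<And>x. x \<in> J - N \<Longrightarrow> g x = 0" and x: "x \<in> J"
  shows "y x = y a"
  using primitive_on_value[OF primitive_on_cong_ae[OF y J N, of "\<lambda>x. 0"] x] g by simp

lemma primitive_on_integral:
  assumes J: "initial_interval a J" and g: "\<And>x. x \<in> J \<Longrightarrow> g absolutely_integrable_on {a..x}"
  shows "primitive_on J a g (\<lambda>x. c + integral {a..x} g)"
  unfolding primitive_on_def using g by simp

lemma primitive_on_increment:
  assumes J: "initial_interval a J" and y: "primitive_on J a g y" and uv: "u \<in> J" "v \<in> J" "u \<le> v"
  shows "y v - y u = integral {u..v} g" "g absolutely_integrable_on {u..v}" "g integrable_on {u..v}"
proof -
  have sub: "{u..v} \<subseteq> {a..v}" using initial_interval_sub[OF J uv(1)] by auto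
  show *: "g absolutely_integrable_on {u..v}"
    using set_integrable_subset[OF primitive_on_integrable(1)[OF y uv(2)]] sub by simp
  then show "g integrable_on {u..v}" by (simp add: set_lebesgue_integral_eq_integral(1))
  have "integral {a..u} g + integral {u..v} g = integral {a..v} g"
    using uv initial_interval_sub[OF J uv(1)] primitive_on_integrable(2)[OF y uv(2)]
    by (intro Henstock_Kurzweil_Integration.integral_combine) auto
  then show "y v - y u = integral {u..v} g"
    using primitive_on_value[OF y uv(1)] primitive_on_value[OF y uv(2)] by (simp add: algebra_simps)
qed

lemma primitive_on_Re_mono:
  assumes J: "initial_interval a J" and y: "primitive_on J a g y"
    and uv: "u \<in> J" "v \<in> J" "u \<le> v" and N: "negligible N"
    and g: "\<And>t. t \<in> J - N \<Longrightarrow> t \<in> {u..v} \<Longrightarrow> 0 \<le> Re (g t)"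
  shows "Re (y u) \<le> Re (y v)"
proof -
  note inc = primitive_on_increment[OF J y uv]
  have sub: "{u..v} \<subseteq> J"
    using initial_interval_sub[OF J uv(1)] initial_interval_sub(1)[OF J uv(2)] by auto
  have "((\<lambda>t. Re (g t)) has_integral Re (y v - y u)) {u..v}"
    using has_integral_linear[OF integrable_integral[OF inc(3)] bounded_linear_Re] inc(1) by (simp add: o_def)
  then have "((\<lambda>t. if t \<in> N then 0 else Re (g t)) has_integral Re (y v - y u)) {u..v}"
    by (rule has_integral_spike[OF N, rotated]) auto
  then have "0 \<le> Re (y v - y u)"
    by (rule has_integral_nonneg) (use g sub in auto)
  then show ?thesis by simp
qed

text \<open>The integrated form of |y'| \<le> z'. The majorant is itself a primitive, so bounds can
  be found by guessing a function and differentiating it.\<close>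

lemma primitive_on_norm_le:
  assumes J: "initial_interval a J" and y: "primitive_on J a g y" and z: "primitive_on J a h z"
    and uv: "u \<in> J" "v \<in> J" "u \<le> v" and N: "negligible N"
    and g: "\<And>t. t \<in> J - N \<Longrightarrow> t \<in> {u..v} \<Longrightarrow> cmod (g t) \<le> Re (h t)"
  shows "cmod (y v - y u) \<le> Re (z v - z u)"
proof -
  note iy = primitive_on_increment[OF J y uv] and iz = primitive_on_increment[OF J z uv]
  have sub: "{u..v} \<subseteq> J"
    using initial_interval_sub[OF J uv(1)] initial_interval_sub(1)[OF J uv(2)] by auto
  have h: "((\<lambda>t. Re (h t)) has_integral Re (z v - z u)) {u..v}"
    using has_integral_linear[OF integrable_integral[OF iz(3)] bounded_linear_Re] iz(1) by (simp add: o_def)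
  have h': "((\<lambda>t. if t \<in> N then 0 else Re (h t)) has_integral Re (z v - z u)) {u..v}"
    by (rule has_integral_spike[OF N _ h]) auto
  have "(g has_integral (y v - y u)) {u..v}"
    using integrable_integral[OF iy(3)] iy(1) by simp
  then have g': "((\<lambda>t. if t \<in> N then 0 else g t) has_integral (y v - y u)) {u..v}"
    by (rule has_integral_spike[OF N, rotated]) auto
  have "norm (integral {u..v} (\<lambda>t. if t \<in> N then 0 else g t)) \<le> integral {u..v} (\<lambda>t. if t \<in> N then 0 else Re (h t))"
    by (rule integral_norm_bound_integral[OF has_integral_integrable[OF g'] has_integral_integrable[OF h']])
      (use g sub in auto)
  then show ?thesis using g' h' by (simp add: integral_unique)
qed

text \<open>The kernel is merely integrable, so the integrating factor exp (- int k) is handled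
  within the calculus of primitives: its product with the right-hand side of \<open>le\<close> is
  nonincreasing.\<close>

lemma gronwall_L1:
  fixes k n :: "real \<Rightarrow> real"
  assumes k: "k absolutely_integrable_on {a..c}" and k0: "\<And>x. x \<in> {a..c} \<Longrightarrow> k x \<ge> 0"
    and n: "continuous_on {a..c} n" and "0 \<le> C"
    and le: "\<And>x. x \<in> {a..c} \<Longrightarrow> n x \<le> C + integral {a..x} (\<lambda>t. k t * n t)" and x: "x \<in> {a..c}"
  shows "n x \<le> C * exp (integral {a..x} k)"
proof -
  have J: "initial_interval a {a..c}" using x by (intro initial_interval_Icc) auto
  have kc: "(\<lambda>t. complex_of_real (k t)) absolutely_integrable_on {a..x}" if "x \<in> {a..c}" for x
    using set_integrable_subset[OF k, of "{a..x}"] that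
    by (intro absolutely_integrable_linear[OF _ bounded_linear_of_real, unfolded o_def]) auto
  have "primitive_on {a..c} a (\<lambda>t. complex_of_real (k t)) (\<lambda>x. 0 + integral {a..x} (\<lambda>t. complex_of_real (k t)))"
    using kc by (rule primitive_on_integral[OF J])
  moreover have "integral {a..x} (\<lambda>t. complex_of_real (k t)) = complex_of_real (integral {a..x} k)" if "x \<in> {a..c}" for x
  proof -
    have "k integrable_on {a..x}" using set_integrable_subset[OF k, of "{a..x}"] that
      by (intro set_lebesgue_integral_eq_integral(1)) auto
    from integral_linear[OF this bounded_linear_of_real] show ?thesis by (simp add: o_def)
  qed
  ultimately have K: "primitive_on {a..c} a (\<lambda>t. complex_of_real (k t)) (\<lambda>x. complex_of_real (integral {a..x} k))"
    unfolding primitive_on_def by simp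
  define m where "m = (\<lambda>t. k t * n t)"
  have nc: "continuous_on {a..x} (\<lambda>t. complex_of_real (n t))" if "x \<in> {a..c}" for x
    using that by (intro continuous_on_of_real continuous_on_subset[OF n]) auto
  have mc: "(\<lambda>t. complex_of_real (m t)) absolutely_integrable_on {a..x}" if "x \<in> {a..c}" for x
    using absolutely_integrable_mult_continuous(2)[OF nc kc] that by (simp add: m_def)
  have mi: "m integrable_on {a..x}" if "x \<in> {a..c}" for x
  proof -
    have "(\<lambda>t. Re (complex_of_real (m t))) integrable_on {a..x}"
      using integrable_linear[OF set_lebesgue_integral_eq_integral(1)[OF mc[OF that]] bounded_linear_Re] by (simp add: o_def)
    then show ?thesis by simp
  qed
  define R where "R = (\<lambda>x. C + integral {a..x} m)"
  have "integral {a..x} (\<lambda>t. complex_of_real (m t)) = complex_of_real (integral {a..x} m)" if "x \<in> {a..c}" for x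
    using integral_linear[OF mi[OF that] bounded_linear_of_real] by (simp add: o_def)
  moreover have "primitive_on {a..c} a (\<lambda>t. complex_of_real (m t)) (\<lambda>x. C + integral {a..x} (\<lambda>t. complex_of_real (m t)))"
    using mc by (rule primitive_on_integral[OF J])
  ultimately have R: "primitive_on {a..c} a (\<lambda>t. complex_of_real (m t)) (\<lambda>x. complex_of_real (R x))"
    unfolding primitive_on_def R_def by simp
  define e where "e = (\<lambda>x. exp (- integral {a..x} k))"
  have E: "primitive_on {a..c} a (\<lambda>t. complex_of_real (- k t * e t)) (\<lambda>x. complex_of_real (e x))"
  proof -
    obtain N where N: "negligible N" "\<And>x. x \<in> {a..c} - N \<Longrightarrow>
        ((\<lambda>x. complex_of_real (integral {a..x} k)) has_vector_derivative complex_of_real (k x)) (at x)"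
      using primitive_on_derivative[OF J K] by blast
    have Kac: "abs_cont_on a x (\<lambda>x. complex_of_real (integral {a..x} k))" if "x \<in> {a..c}" for x
      using that by (intro primitive_on_abs_cont[OF J K]) auto
    have K0: "integral {a..x} k \<ge> 0" if "x \<in> {a..c}" for x
    proof (rule integral_nonneg)
      show "k integrable_on {a..x}" using set_integrable_subset[OF k, of "{a..x}"] that
        by (intro set_lebesgue_integral_eq_integral(1)) auto
    qed (use k0 that in auto)
    have ac: "abs_cont_on a x (\<lambda>x. complex_of_real (e x))" if x: "x \<in> {a..c}" for x
    proof (rule abs_cont_on_dominated[OF Kac[OF x] Kac[OF x], of _ 1 0])
      \<comment> \<open>For nonnegative arguments s -> exp (- s) has Lipschitz constant 1, so the
        integrating factor inherits absolute continuity from the integral of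
        \<open>k\<close>.\<close>
      have *: "\<bar>exp (- s) - exp (- t)\<bar> \<le> \<bar>s - t\<bar>" if "0 \<le> s" "s \<le> t" for s t :: real
      proof -
        have "exp (- s) - exp (- t) = exp (- s) * (1 - exp (- (t - s)))"
          by (simp add: algebra_simps flip: exp_add)
        also have "\<dots> \<le> 1 * (t - s)"
        proof (rule mult_mono)
          show "1 - exp (- (t - s)) \<le> t - s"
            using exp_ge_add_one_self[of "- (t - s)"] by linarith
        qed (use that in auto)
        finally show ?thesis using that by simp
      qed
      fix s t assume "s \<in> {a..x}" "t \<in> {a..x}"
      then have "s \<in> {a..c}" "t \<in> {a..c}" using x by auto
      then have "integral {a..s} k \<ge> 0" "integral {a..t} k \<ge> 0" using K0 by auto
      then have "\<bar>e s - e t\<bar> \<le> \<bar>integral {a..s} k - integral {a..t} k\<bar>"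
        unfolding e_def using *[of "integral {a..s} k" "integral {a..t} k"] *[of "integral {a..t} k" "integral {a..s} k"]
        by (cases "integral {a..s} k \<le> integral {a..t} k") auto
      then show "cmod (complex_of_real (e s) - complex_of_real (e t))
         \<le> 1 * cmod (complex_of_real (integral {a..s} k) - complex_of_real (integral {a..t} k))
           + 0 * cmod (complex_of_real (integral {a..s} k) - complex_of_real (integral {a..t} k))"
        by (simp flip: of_real_diff)
    qed
    show ?thesis
    proof (rule primitive_onI[OF J ac N(1)])
      fix x assume x: "x \<in> {a..c} - N"
      have "((\<lambda>x. exp (- complex_of_real (integral {a..x} k))) has_vector_derivative
          - complex_of_real (k x) * exp (- complex_of_real (integral {a..x} k))) (at x)"
        using field_vector_diff_chain_at[OF has_vector_derivative_minus[OF N(2)[OF x]], of exp "exp (- complex_of_real (integral {a..x} k))"]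
        by (simp add: o_def)
      then show "((\<lambda>x. complex_of_real (e x)) has_vector_derivative complex_of_real (- k x * e x)) (at x)"
        by (simp add: e_def flip: exp_of_real)
    next
      fix x assume x: "x \<in> {a..c}"
      have "(\<lambda>t. complex_of_real (k t) * complex_of_real (- e t)) absolutely_integrable_on {a..x}"
        using abs_cont_on_imp_continuous_on[OF ac[OF x]]
        by (intro absolutely_integrable_mult_continuous kc x) (auto intro!: continuous_intros)
      then show "(\<lambda>t. complex_of_real (- k t * e t)) absolutely_integrable_on {a..x}" by simp
    qed
  qed
  have P: "primitive_on {a..c} a (\<lambda>t. complex_of_real (- k t * e t) * complex_of_real (R t) + complex_of_real (e t) * complex_of_real (m t))
     (\<lambda>x. complex_of_real (e x) * complex_of_real (R x))"
    by (rule primitive_on_mult[OF J E R])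
  have "Re (complex_of_real (e a) * complex_of_real (R a) - complex_of_real (e x) * complex_of_real (R x)) \<ge> 0"
  proof -
    \<comment> \<open>The derivative of \<open>e * R\<close> is \<open>k * e * (n - R)\<close>,
      nonpositive by the hypothesis \<open>le\<close>; the minus signs turn the monotonicity lemma
      around.\<close>
    have "Re (- (complex_of_real (e a) * complex_of_real (R a))) \<le> Re (- (complex_of_real (e x) * complex_of_real (R x)))"
    proof (rule primitive_on_Re_mono[OF J primitive_on_bounded_linear[OF P bounded_linear_minus[OF bounded_linear_ident]] _ _ _ negligible_empty])
      fix t assume t: "t \<in> {a..c} - {}"
      then have t: "t \<in> {a..c}" by simp
      have "Re (complex_of_real (- k t * e t) * complex_of_real (R t) + complex_of_real (e t) * complex_of_real (m t))
         = k t * e t * (n t - R t)" by (simp add: m_def algebra_simps)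
      also have "\<dots> \<le> 0" using le[OF t] k0[OF t] by (intro mult_nonneg_nonpos) (auto simp: e_def R_def m_def)
      finally show "0 \<le> Re (- (complex_of_real (- k t * e t) * complex_of_real (R t) + complex_of_real (e t) * complex_of_real (m t)))"
        by simp
    qed (use x in auto)
    then show ?thesis by simp
  qed
  then have "e x * R x \<le> C" by (simp add: e_def R_def)
  then have "R x \<le> C * exp (integral {a..x} k)" by (simp add: e_def exp_minus field_simps)
  then show ?thesis using le[OF x] by (simp add: R_def m_def)
qed

section \<open>The equation as a first-order system\<close>

text \<open>\<open>z\<close> stands for the value of the differential expression on \<open>y\<close>
  and is a separate argument: a multiple of \<open>y\<close> gives the eigenvalue equation, a
  general square-integrable \<open>z\<close> the elements of the operator.\<close>

definition sl_system ::
    "real set \<Rightarrow> real \<Rightarrow> (real \<Rightarrow> real) \<Rightarrow> (real \<Rightarrow> complex) \<Rightarrow> (real \<Rightarrow> complex) \<Rightarrow>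
     (real \<Rightarrow> complex) \<Rightarrow> (real \<Rightarrow> complex) \<Rightarrow> (real \<Rightarrow> complex) \<Rightarrow> bool" where
  "sl_system J a w p q y y1 z \<longleftrightarrow>
     primitive_on J a (\<lambda>x. y1 x / p x) y \<and>
     primitive_on J a (\<lambda>x. q x * y x - of_real (w x) * z x) y1"

lemma sl_system_add:
  assumes "sl_system J a w p q y y1 z" "sl_system J a w p q v v1 s"
  shows "sl_system J a w p q (\<lambda>x. y x + v x) (\<lambda>x. y1 x + v1 x) (\<lambda>x. z x + s x)"
  using primitive_on_add[of J a "\<lambda>x. y1 x / p x" y "\<lambda>x. v1 x / p x" v]
    primitive_on_add[of J a "\<lambda>x. q x * y x - of_real (w x) * z x" y1 "\<lambda>x. q x * v x - of_real (w x) * s x" v1] assms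
  unfolding sl_system_def by (simp add: algebra_simps add_divide_distrib)

lemma sl_system_cmult:
  assumes "sl_system J a w p q y y1 z"
  shows "sl_system J a w p q (\<lambda>x. c * y x) (\<lambda>x. c * y1 x) (\<lambda>x. c * z x)"
  using primitive_on_cmult[of J a "\<lambda>x. y1 x / p x" y c]
    primitive_on_cmult[of J a "\<lambda>x. q x * y x - of_real (w x) * z x" y1 c] assms
  unfolding sl_system_def by (simp add: algebra_simps)

lemma sl_system_subset: "sl_system J a w p q y y1 z \<Longrightarrow> J' \<subseteq> J \<Longrightarrow> sl_system J' a w p q y y1 z"
  unfolding sl_system_def using primitive_on_subset by blast

section \<open>Lagrange's identity and uniqueness of solutions\<close>

locale sl_coefficients =
  fixes a :: real and J :: "real set" and w :: "real \<Rightarrow> real" and p q :: "real \<Rightarrow> complex"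
  assumes J: "initial_interval a J"
    and w_pos: "AE x in lebesgue_on J. w x > 0" and p_nz: "AE x in lebesgue_on J. p x \<noteq> 0"
    and w_int: "loc_integrable_on J w" and p_int: "loc_integrable_on J (\<lambda>x. 1 / p x)"
    and q_int: "loc_integrable_on J q"
begin

abbreviation "system \<equiv> sl_system J a w p q"
abbreviation "prim \<equiv> primitive_on J a"

lemma a_in: "a \<in> J" using J by (simp add: initial_interval_def)

lemma sub: "x \<in> J \<Longrightarrow> {a..x} \<subseteq> J" using initial_interval_sub(1)[OF J] .

lemma J_lebesgue: "J \<in> sets lebesgue" using initial_interval_sets_lebesgue[OF J] .

lemma exceptional_set:
  obtains N where "negligible N" "\<And>x. x \<in> J - N \<Longrightarrow> w x > 0" "\<And>x. x \<in> J - N \<Longrightarrow> p x \<noteq> 0"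
proof -
  obtain N1 N2 where "negligible N1" "\<forall>x\<in>J - N1. w x > 0" "negligible N2" "\<forall>x\<in>J - N2. p x \<noteq> 0"
    using w_pos p_nz unfolding AE_lebesgue_on_iff_negligible[OF J_lebesgue] by blast
  then show ?thesis using that[of "N1 \<union> N2"] by auto
qed

lemma weight_integrable: "x \<in> J \<Longrightarrow> (\<lambda>t. complex_of_real (w t)) absolutely_integrable_on {a..x}"
  using w_int sub unfolding loc_integrable_on_def
  by (intro absolutely_integrable_linear[OF _ bounded_linear_of_real, unfolded o_def]) auto

lemma continuous_weight_integrable:
  assumes "x \<in> J" "continuous_on {a..x} f"
  shows "(\<lambda>t. complex_of_real (w t) * f t) absolutely_integrable_on {a..x}"
  using absolutely_integrable_mult_continuous(2)[OF assms(2) weight_integrable[OF assms(1)]] .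

lemma system_continuous:
  assumes "system y y1 z" "x \<in> J"
  shows "continuous_on {a..x} y" "continuous_on {a..x} y1"
  using assms primitive_on_continuous[OF J _ sub[OF assms(2)]] unfolding sl_system_def by blast+

text \<open>The hypothesis on \<open>w z\<close> supplies the integrability of the derivative of
  \<open>y1\<close>; it is met by continuous \<open>z\<close> as well as by \<open>z\<close> in the
  weighted space.\<close>

lemma system_of_quasi_derivative:
  assumes y: "quasi_derivative J p y y1" and z: "AE x in lebesgue_on J. z x = sl_expr w q y y1 x"
    and int: "\<And>x. x \<in> J \<Longrightarrow> (\<lambda>t. of_real (w t) * z t) absolutely_integrable_on {a..x}"
  shows "system y y1 z"
proof -
  have ac: "abs_cont_on a x y" "abs_cont_on a x y1" if "x \<in> J" for x
    using y sub[OF that] unfolding quasi_derivative_def loc_abs_cont_on_def by blast+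
  note cont = ac[THEN abs_cont_on_imp_continuous_on]
  obtain N1 where N1: "negligible N1" "\<And>x. x \<in> J - N1 \<Longrightarrow> y differentiable at x \<and> y1 differentiable at x \<and>
        y1 x = p x * vector_derivative y (at x)"
    using y unfolding quasi_derivative_def AE_lebesgue_on_iff_negligible[OF J_lebesgue] by blast
  obtain N2 where N2: "negligible N2" "\<And>x. x \<in> J - N2 \<Longrightarrow> z x = sl_expr w q y y1 x"
    using z unfolding AE_lebesgue_on_iff_negligible[OF J_lebesgue] by blast
  obtain N0 where N0: "negligible N0" "\<And>x. x \<in> J - N0 \<Longrightarrow> w x > 0" "\<And>x. x \<in> J - N0 \<Longrightarrow> p x \<noteq> 0"
    using exceptional_set by blast
  define N where "N = N0 \<union> N1 \<union> N2"
  have N: "negligible N" using N0(1) N1(1) N2(1) by (simp add: N_def)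
  show ?thesis unfolding sl_system_def
  proof
    show "prim (\<lambda>x. y1 x / p x) y"
    proof (rule primitive_onI[OF J ac(1) N])
      fix x assume x: "x \<in> J - N"
      have "(y has_vector_derivative vector_derivative y (at x)) (at x)"
        using N1(2)[of x] x by (simp add: N_def vector_derivative_works)
      moreover have "vector_derivative y (at x) = y1 x / p x"
        using N1(2)[of x] N0(3)[of x] x by (simp add: N_def)
      ultimately show "(y has_vector_derivative y1 x / p x) (at x)" by simp
    next
      fix x assume x: "x \<in> J"
      have "(\<lambda>x. 1 / p x) absolutely_integrable_on {a..x}"
        using p_int sub[OF x] by (simp add: loc_integrable_on_def)
      from absolutely_integrable_mult_continuous(1)[OF cont(2)[OF x] this]
      show "(\<lambda>x. y1 x / p x) absolutely_integrable_on {a..x}" by simp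
    qed
    show "prim (\<lambda>x. q x * y x - of_real (w x) * z x) y1"
    proof (rule primitive_onI[OF J ac(2) N])
      fix x assume x: "x \<in> J - N"
      have "(y1 has_vector_derivative vector_derivative y1 (at x)) (at x)"
        using N1(2)[of x] x by (simp add: N_def vector_derivative_works)
      moreover have "vector_derivative y1 (at x) = q x * y x - of_real (w x) * z x"
        using N2(2)[of x] N0(2)[of x] x by (simp add: N_def sl_expr_def)
      ultimately show "(y1 has_vector_derivative q x * y x - of_real (w x) * z x) (at x)" by simp
    next
      fix x assume x: "x \<in> J"
      have "q absolutely_integrable_on {a..x}"
        using q_int sub[OF x] by (simp add: loc_integrable_on_def)
      from absolutely_integrable_mult_continuous(2)[OF cont(1)[OF x] this]
      show "(\<lambda>x. q x * y x - of_real (w x) * z x) absolutely_integrable_on {a..x}"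
        by (rule set_integral_diff(1)) (rule int[OF x])
    qed
  qed
qed

lemma system_of_solution:
  assumes "sl_solution J w p q \<zeta> y y1"
  shows "system y y1 (\<lambda>x. \<zeta> * y x)"
proof (rule system_of_quasi_derivative)
  show y: "quasi_derivative J p y y1" using assms by (simp add: sl_solution_def)
  show "AE x in lebesgue_on J. \<zeta> * y x = sl_expr w q y y1 x"
    using assms by (simp add: sl_solution_def eq_commute)
  fix x assume x: "x \<in> J"
  have "continuous_on {a..x} y"
    using y sub[OF x] unfolding quasi_derivative_def loc_abs_cont_on_def
    by (intro abs_cont_on_imp_continuous_on) auto
  then show "(\<lambda>t. complex_of_real (w t) * (\<zeta> * y t)) absolutely_integrable_on {a..x}"
    by (intro continuous_weight_integrable x continuous_intros)
qed

text \<open>Needed to return from functions constructed by integration to the differential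
  expression in its pointwise form.\<close>

lemma quasi_derivative_of_system:
  assumes "system y y1 z"
  shows "quasi_derivative J p y y1" "AE x in lebesgue_on J. sl_expr w q y y1 x = z x"
proof -
  have y: "prim (\<lambda>x. y1 x / p x) y" and y1: "prim (\<lambda>x. q x * y x - of_real (w x) * z x) y1"
    using assms by (auto simp: sl_system_def)
  obtain N1 where N1: "negligible N1" "\<And>x. x \<in> J - N1 \<Longrightarrow> (y has_vector_derivative y1 x / p x) (at x)"
    using primitive_on_derivative[OF J y] by blast
  obtain N2 where N2: "negligible N2" "\<And>x. x \<in> J - N2 \<Longrightarrow>
      (y1 has_vector_derivative q x * y x - of_real (w x) * z x) (at x)"
    using primitive_on_derivative[OF J y1] by blast
  obtain N0 where N0: "negligible N0" "\<And>x. x \<in> J - N0 \<Longrightarrow> w x > 0" "\<And>x. x \<in> J - N0 \<Longrightarrow> p x \<noteq> 0"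
    using exceptional_set by blast
  define N where "N = N0 \<union> N1 \<union> N2"
  have N: "negligible N" using N0(1) N1(1) N2(1) by (simp add: N_def)
  have d: "(y has_vector_derivative y1 x / p x) (at x)"
    "(y1 has_vector_derivative q x * y x - of_real (w x) * z x) (at x)" "w x > 0" "p x \<noteq> 0" if "x \<in> J - N" for x
    using that N1(2) N2(2) N0(2,3) by (auto simp: N_def)
  show "quasi_derivative J p y y1"
    unfolding quasi_derivative_def AE_lebesgue_on_iff_negligible[OF J_lebesgue] loc_abs_cont_on_def
  proof (intro conjI allI impI exI[of _ N] N ballI)
    show "abs_cont_on c d y" "abs_cont_on c d y1" if "{c..d} \<subseteq> J" for c d
      using primitive_on_abs_cont[OF J _ that] y y1 by blast+
    fix x assume x: "x \<in> J - N"
    show "y differentiable at x" "y1 differentiable at x"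
      using d[OF x] by (auto intro: differentiableI_vector)
    show "y1 x = p x * vector_derivative y (at x)"
      using d[OF x] by (simp add: vector_derivative_at)
  qed
  show "AE x in lebesgue_on J. sl_expr w q y y1 x = z x"
    unfolding AE_lebesgue_on_iff_negligible[OF J_lebesgue]
  proof (intro exI[of _ N] conjI ballI N)
    fix x assume x: "x \<in> J - N"
    show "sl_expr w q y y1 x = z x"
      using d[OF x] by (simp add: sl_expr_def vector_derivative_at)
  qed
qed

lemma solution_of_system: "system y y1 (\<lambda>x. \<zeta> * y x) \<Longrightarrow> sl_solution J w p q \<zeta> y y1"
  unfolding sl_solution_def using quasi_derivative_of_system by blast

text \<open>Lagrange's identity: in the derivative of the bracket the terms with
  \<open>1 / p\<close> and with \<open>q\<close> cancel, and only the weight remains.\<close>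

lemma bracket_primitive:
  assumes "system y y1 z" "system v v1 s"
  shows "prim (\<lambda>x. of_real (w x) * (z x * v x - y x * s x)) (bracket y y1 v v1)"
proof -
  have *: "prim (\<lambda>x. y1 x / p x) y" "prim (\<lambda>x. q x * y x - of_real (w x) * z x) y1"
    "prim (\<lambda>x. v1 x / p x) v" "prim (\<lambda>x. q x * v x - of_real (w x) * s x) v1"
    using assms by (auto simp: sl_system_def)
  have "prim (\<lambda>x. (y1 x / p x * v1 x + y x * (q x * v x - of_real (w x) * s x)) -
       ((q x * y x - of_real (w x) * z x) * v x + y1 x * (v1 x / p x)))
     (\<lambda>x. y x * v1 x - y1 x * v x)"
    by (intro primitive_on_diff primitive_on_mult[OF J] *)
  moreover have "(\<lambda>x. (y1 x / p x * v1 x + y x * (q x * v x - of_real (w x) * s x)) -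
       ((q x * y x - of_real (w x) * z x) * v x + y1 x * (v1 x / p x)))
     = (\<lambda>x. of_real (w x) * (z x * v x - y x * s x))"
    by (auto simp: fun_eq_iff algebra_simps)
  ultimately show ?thesis unfolding bracket_def by simp
qed

lemma bracket_constant:
  assumes "system y y1 (\<lambda>x. \<zeta> * y x)" "system v v1 (\<lambda>x. \<zeta> * v x)" "x \<in> J"
  shows "bracket y y1 v v1 x = bracket y y1 v v1 a"
  by (rule primitive_on_constant[OF J bracket_primitive[OF assms(1,2)] negligible_empty _ assms(3)])
    (simp add: mult_ac)

text \<open>Uniqueness without a contraction argument: the brackets with two basis solutions are
  constant, and together they recover \<open>y\<close> and \<open>y1\<close> at every point.\<close>

lemma solution_determined_by_initial_values:
  assumes y: "system y y1 (\<lambda>x. \<zeta> * y x)" and v: "system v v1 (\<lambda>x. \<zeta> * v x)"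
    and f: "system f f1 (\<lambda>x. \<zeta> * f x)" and g: "system g g1 (\<lambda>x. \<zeta> * g x)" and fg: "bracket f f1 g g1 a = 1"
    and eq: "y a = v a" "y1 a = v1 a" and x: "x \<in> J"
  shows "y x = v x" "y1 x = v1 x"
proof -
  have "bracket y y1 f f1 x = bracket v v1 f f1 x" "bracket y y1 g g1 x = bracket v v1 g g1 x"
    using bracket_constant[OF y f x] bracket_constant[OF v f x] bracket_constant[OF y g x] bracket_constant[OF v g x] eq
    by (auto simp: bracket_def)
  moreover have "bracket f f1 g g1 x = 1" using bracket_constant[OF f g x] fg by simp
  moreover have "h x * bracket f f1 g g1 x = f x * bracket h h1 g g1 x - g x * bracket h h1 f f1 x"
    "h1 x * bracket f f1 g g1 x = f1 x * bracket h h1 g g1 x - g1 x * bracket h h1 f f1 x" for h h1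
    by (auto simp: bracket_def algebra_simps)
  ultimately show "y x = v x" "y1 x = v1 x" by (metis mult.right_neutral)+
qed

end

section \<open>Variation of constants\<close>

text \<open>A fundamental system with Wronskian 1. In the application \<open>f\<close> and
  \<open>g\<close> are phi and psi at zeta', and the locale is interpreted again at other
  parameters.\<close>

locale sl_basis = sl_coefficients +
  fixes \<zeta> :: complex and f f1 g g1 :: "real \<Rightarrow> complex"
  assumes f: "sl_system J a w p q f f1 (\<lambda>x. \<zeta> * f x)" and g: "sl_system J a w p q g g1 (\<lambda>x. \<zeta> * g x)"
    and wronskian_a: "bracket f f1 g g1 a = 1"
begin

lemma wronskian: "x \<in> J \<Longrightarrow> bracket f f1 g g1 x = 1"
  using bracket_constant[OF f g] wronskian_a by simp

text \<open>Cramer's rule with determinant 1, valid for arbitrary functions \<open>y\<close> and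
  \<open>y1\<close>.\<close>

lemma decompose:
  assumes "x \<in> J"
  shows "y x = bracket y y1 g g1 x * f x - bracket y y1 f f1 x * g x"
    "y1 x = bracket y y1 g g1 x * f1 x - bracket y y1 f f1 x * g1 x"
proof -
  have "y x * bracket f f1 g g1 x = bracket y y1 g g1 x * f x - bracket y y1 f f1 x * g x"
    "y1 x * bracket f f1 g g1 x = bracket y y1 g g1 x * f1 x - bracket y y1 f f1 x * g1 x"
    by (auto simp: bracket_def algebra_simps)
  then show "y x = bracket y y1 g g1 x * f x - bracket y y1 f f1 x * g x"
    "y1 x = bracket y y1 g g1 x * f1 x - bracket y y1 f f1 x * g1 x"
    using wronskian[OF assms] by simp_all
qed

text \<open>The choice u' = w g h, v' = - w f h annihilates u' f + v' g and, by the Wronskian, makes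
  u' f1 + v' g1 equal to - w h; the combination therefore solves (M - zeta) y = h.\<close>

lemma variation_of_constants:
  assumes u: "prim (\<lambda>x. of_real (w x) * g x * h x) u" and v: "prim (\<lambda>x. - (of_real (w x) * f x * h x)) v"
  shows "system (\<lambda>x. u x * f x + v x * g x) (\<lambda>x. u x * f1 x + v x * g1 x)
    (\<lambda>x. h x + \<zeta> * (u x * f x + v x * g x))"
proof -
  have F: "prim (\<lambda>x. f1 x / p x) f" "prim (\<lambda>x. q x * f x - of_real (w x) * (\<zeta> * f x)) f1"
    "prim (\<lambda>x. g1 x / p x) g" "prim (\<lambda>x. q x * g x - of_real (w x) * (\<zeta> * g x)) g1"
    using f g by (auto simp: sl_system_def)
  show ?thesis unfolding sl_system_def
  proof
    have "prim (\<lambda>x. (of_real (w x) * g x * h x * f x + u x * (f1 x / p x)) +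
         (- (of_real (w x) * f x * h x) * g x + v x * (g1 x / p x))) (\<lambda>x. u x * f x + v x * g x)"
      by (intro primitive_on_add primitive_on_mult[OF J] u v F)
    then show "prim (\<lambda>x. (u x * f1 x + v x * g1 x) / p x) (\<lambda>x. u x * f x + v x * g x)"
      by (rule primitive_on_cong_ae[OF _ J negligible_empty]) (simp add: algebra_simps add_divide_distrib)
    have "prim (\<lambda>x. (of_real (w x) * g x * h x * f1 x + u x * (q x * f x - of_real (w x) * (\<zeta> * f x))) +
         (- (of_real (w x) * f x * h x) * g1 x + v x * (q x * g x - of_real (w x) * (\<zeta> * g x))))
        (\<lambda>x. u x * f1 x + v x * g1 x)"
      by (intro primitive_on_add primitive_on_mult[OF J] u v F)
    then show "prim (\<lambda>x. q x * (u x * f x + v x * g x) - of_real (w x) * (h x + \<zeta> * (u x * f x + v x * g x)))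
        (\<lambda>x. u x * f1 x + v x * g1 x)"
    proof (rule primitive_on_cong_ae[OF _ J negligible_empty])
      fix x assume "x \<in> J - {}"
      then have "f x * g1 x - f1 x * g x = 1" using wronskian[of x] by (simp add: bracket_def)
      then have "g x * f1 x = f x * g1 x - 1" by (simp add: algebra_simps)
      then have "(of_real (w x) * g x * h x * f1 x) + - (of_real (w x) * f x * h x) * g1 x = - (of_real (w x) * h x)"
        by (simp add: algebra_simps) (metis (no_types, opaque_lifting) diff_add_cancel distrib_left mult.commute mult.left_commute mult.right_neutral)
      then show "(of_real (w x) * g x * h x * f1 x + u x * (q x * f x - of_real (w x) * (\<zeta> * f x))) +
         (- (of_real (w x) * f x * h x) * g1 x + v x * (q x * g x - of_real (w x) * (\<zeta> * g x)))
        = q x * (u x * f x + v x * g x) - of_real (w x) * (h x + \<zeta> * (u x * f x + v x * g x))"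
        by (simp add: algebra_simps)
    qed
  qed
qed

section \<open>An integrable majorant for the perturbed system\<close>

text \<open>Dominates the coefficients w f^2, w f g and w g^2 of the system for (u, v) at once, so
  that one scalar function controls the dependence on the spectral parameter.\<close>

definition kernel :: "real \<Rightarrow> real" where
  "kernel x = w x * (cmod (f x) + cmod (g x))\<^sup>2"

lemma kernel_integrable: "x \<in> J \<Longrightarrow> (\<lambda>t. complex_of_real (kernel t)) absolutely_integrable_on {a..x}"
proof -
  assume x: "x \<in> J"
  have "(\<lambda>t. complex_of_real (w t) * (complex_of_real ((cmod (f t) + cmod (g t))\<^sup>2))) absolutely_integrable_on {a..x}"
    using system_continuous(1)[OF f x] system_continuous(1)[OF g x]
    by (intro continuous_weight_integrable x continuous_intros)
  then show ?thesis by (simp add: kernel_def)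
qed

lemma kernel_integrable_real: "x \<in> J \<Longrightarrow> kernel integrable_on {a..x}"
  using integrable_linear[OF set_lebesgue_integral_eq_integral(1)[OF kernel_integrable] bounded_linear_Re]
  by (simp add: o_def)

definition total :: "real \<Rightarrow> real" where
  "total x = integral {a..x} kernel"

lemma total_primitive: "prim (\<lambda>t. complex_of_real (kernel t)) (\<lambda>x. complex_of_real (total x))"
  unfolding primitive_on_def
proof (intro ballI conjI kernel_integrable)
  fix x assume x: "x \<in> J"
  show "complex_of_real (total x) = complex_of_real (total a) + integral {a..x} (\<lambda>t. complex_of_real (kernel t))"
    using integral_linear[OF kernel_integrable_real[OF x] bounded_linear_of_real[where 'a=complex]]
    by (simp add: o_def total_def)
qed

lemma total_a: "total a = 0" by (simp add: total_def)

lemma total_mono: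
  assumes "u \<in> J" "v \<in> J" "u \<le> v" shows "total u \<le> total v"
proof -
  obtain N0 where N0: "negligible N0" "\<And>x. x \<in> J - N0 \<Longrightarrow> w x > 0" "\<And>x. x \<in> J - N0 \<Longrightarrow> p x \<noteq> 0"
    using exceptional_set by blast
  have "Re (complex_of_real (total u)) \<le> Re (complex_of_real (total v))"
    by (rule primitive_on_Re_mono[OF J total_primitive assms N0(1)])
      (use N0(2) in \<open>auto simp: kernel_def less_imp_le\<close>)
  then show ?thesis by simp
qed

lemma total_nonneg: "x \<in> J \<Longrightarrow> 0 \<le> total x"
  using total_mono[OF a_in, of x] initial_interval_sub(2)[OF J, of x] by (simp add: total_a)

text \<open>Iterated integrals of the majorant, the source of the factorials in the bounds for the
  successive approximations.\<close>

lemma total_power_primitive: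
  "prim (\<lambda>x. complex_of_real (total x ^ k / fact k * kernel x)) (\<lambda>x. complex_of_real (total x ^ Suc k / fact (Suc k)))"
proof -
  have *: "prim (\<lambda>x. of_nat (Suc k) * (complex_of_real (total x) ^ k * complex_of_real (kernel x))) (\<lambda>x. complex_of_real (total x) ^ Suc k)"
    for k
  proof (induction k)
    case 0
    then show ?case using total_primitive by simp
  next
    case (Suc k)
    have "prim (\<lambda>x. complex_of_real (kernel x) * complex_of_real (total x) ^ Suc k +
        complex_of_real (total x) * (of_nat (Suc k) * (complex_of_real (total x) ^ k * complex_of_real (kernel x))))
        (\<lambda>x. complex_of_real (total x) * complex_of_real (total x) ^ Suc k)"
      by (rule primitive_on_mult[OF J total_primitive Suc])
    then show ?case by (simp add: algebra_simps)
  qed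
  have "prim (\<lambda>x. complex_of_real (1 / fact (Suc k)) * (of_nat (Suc k) * (complex_of_real (total x) ^ k * complex_of_real (kernel x))))
     (\<lambda>x. complex_of_real (1 / fact (Suc k)) * complex_of_real (total x) ^ Suc k)"
    by (rule primitive_on_cmult[OF *])
  moreover have "complex_of_real (1 / fact (Suc k)) * (of_nat (Suc k) * (complex_of_real t ^ k * complex_of_real s))
     = complex_of_real (t ^ k / fact k * s)" for t s
  proof -
    have "1 / fact (Suc k) * real (Suc k) * t ^ k * s = t ^ k / fact k * s"
      by (simp add: divide_simps del: of_nat_Suc)
    then have "complex_of_real (1 / fact (Suc k) * real (Suc k) * t ^ k * s) = complex_of_real (t ^ k / fact k * s)"
      by (rule arg_cong)
    then show ?thesis by (simp only: of_real_mult of_real_power of_real_of_nat_eq mult.assoc)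
  qed
  moreover have "complex_of_real (1 / fact (Suc k)) * complex_of_real t ^ Suc k = complex_of_real (t ^ Suc k / fact (Suc k))" for t
  proof -
    have "1 / fact (Suc k) * t ^ Suc k = t ^ Suc k / fact (Suc k)" by simp
    from arg_cong[OF this, of complex_of_real] show ?thesis by (simp only: of_real_mult of_real_power)
  qed
  ultimately show ?thesis by (simp only:)
qed

end

section \<open>Solutions as power series in the spectral parameter\<close>

context sl_basis
begin

text \<open>The coefficients of mu^k in the pair (u, v) for which u f + v g solves the equation at
  zeta + mu. Each pair arises by inserting the preceding combination y into u' = w g y, v' = - w f
  y.\<close>

primrec picard :: "complex \<Rightarrow> complex \<Rightarrow> nat \<Rightarrow> (real \<Rightarrow> complex) \<times> (real \<Rightarrow> complex)" where
  "picard u0 v0 0 = (\<lambda>x. u0, \<lambda>x. v0)"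
| "picard u0 v0 (Suc k) =
     (\<lambda>x. integral {a..x} (\<lambda>t. of_real (w t) * g t * (fst (picard u0 v0 k) t * f t + snd (picard u0 v0 k) t * g t)),
      \<lambda>x. - integral {a..x} (\<lambda>t. of_real (w t) * f t * (fst (picard u0 v0 k) t * f t + snd (picard u0 v0 k) t * g t)))"

abbreviation "picard_comb u0 v0 k t \<equiv> fst (picard u0 v0 k) t * f t + snd (picard u0 v0 k) t * g t"

abbreviation "partial_comb u0 v0 \<mu> n t \<equiv>
  (\<Sum>k<n. fst (picard u0 v0 k) t * \<mu> ^ k) * f t + (\<Sum>k<n. snd (picard u0 v0 k) t * \<mu> ^ k) * g t"

lemma combination_integrable:
  assumes x: "x \<in> J" and u: "continuous_on {a..x} u" and v: "continuous_on {a..x} v"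
  shows "(\<lambda>t. of_real (w t) * g t * (u t * f t + v t * g t)) absolutely_integrable_on {a..x}"
    "(\<lambda>t. of_real (w t) * f t * (u t * f t + v t * g t)) absolutely_integrable_on {a..x}"
  unfolding mult.assoc
  using system_continuous(1)[OF f x] system_continuous(1)[OF g x] u v
  by (intro continuous_weight_integrable x continuous_intros; simp)+

lemma picard_continuous:
  "x \<in> J \<Longrightarrow> continuous_on {a..x} (fst (picard u0 v0 k)) \<and> continuous_on {a..x} (snd (picard u0 v0 k))"
proof (induction k arbitrary: x)
  case (Suc k)
  have "(\<lambda>t. of_real (w t) * g t * picard_comb u0 v0 k t) integrable_on {a..x}"
    "(\<lambda>t. of_real (w t) * f t * picard_comb u0 v0 k t) integrable_on {a..x}"
    using combination_integrable[OF Suc.prems] Suc.IH[OF Suc.prems]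
    by (blast intro: set_lebesgue_integral_eq_integral(1))+
  then show ?case by (auto intro!: continuous_intros indefinite_integral_continuous_1)
qed auto

lemma picard_primitive:
  "prim (\<lambda>t. of_real (w t) * g t * picard_comb u0 v0 k t) (fst (picard u0 v0 (Suc k)))"
  "prim (\<lambda>t. - (of_real (w t) * f t * picard_comb u0 v0 k t)) (snd (picard u0 v0 (Suc k)))"
proof -
  have *: "prim (\<lambda>t. of_real (w t) * g t * picard_comb u0 v0 k t)
      (\<lambda>x. 0 + integral {a..x} (\<lambda>t. of_real (w t) * g t * picard_comb u0 v0 k t))"
    "prim (\<lambda>t. of_real (w t) * f t * picard_comb u0 v0 k t)
      (\<lambda>x. 0 + integral {a..x} (\<lambda>t. of_real (w t) * f t * picard_comb u0 v0 k t))"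
    using picard_continuous combination_integrable by (intro primitive_on_integral[OF J]; blast)+
  from *(1) show "prim (\<lambda>t. of_real (w t) * g t * picard_comb u0 v0 k t) (fst (picard u0 v0 (Suc k)))"
    by simp
  from primitive_on_cmult[OF *(2), of "-1"]
  show "prim (\<lambda>t. - (of_real (w t) * f t * picard_comb u0 v0 k t)) (snd (picard u0 v0 (Suc k)))"
    by simp
qed

lemma combination_bound:
  assumes "cmod u \<le> B" "cmod v \<le> B"
  shows "cmod (of_real (w t) * g t * (u * f t + v * g t)) \<le> B * (\<bar>w t\<bar> * (cmod (f t) + cmod (g t))\<^sup>2)"
    "cmod (of_real (w t) * f t * (u * f t + v * g t)) \<le> B * (\<bar>w t\<bar> * (cmod (f t) + cmod (g t))\<^sup>2)"
proof -
  have B: "0 \<le> B" using assms(1) norm_ge_zero order.trans by blast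
  have c: "cmod (u * f t + v * g t) \<le> B * (cmod (f t) + cmod (g t))"
  proof -
    have "cmod (u * f t + v * g t) \<le> cmod u * cmod (f t) + cmod v * cmod (g t)"
      by (metis norm_mult norm_triangle_ineq)
    also have "\<dots> \<le> B * cmod (f t) + B * cmod (g t)"
      using assms by (intro add_mono mult_right_mono) auto
    finally show ?thesis by (simp add: algebra_simps)
  qed
  have "cmod (of_real (w t) * h * (u * f t + v * g t)) \<le> B * (\<bar>w t\<bar> * (cmod (f t) + cmod (g t))\<^sup>2)"
    if "cmod h \<le> cmod (f t) + cmod (g t)" for h
  proof -
    have "cmod (of_real (w t) * h * (u * f t + v * g t)) = \<bar>w t\<bar> * cmod h * cmod (u * f t + v * g t)"
      by (simp add: norm_mult)
    also have "\<dots> \<le> \<bar>w t\<bar> * (cmod (f t) + cmod (g t)) * (B * (cmod (f t) + cmod (g t)))"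
      using that c B by (intro mult_mono) auto
    finally show ?thesis by (simp add: power2_eq_square mult_ac)
  qed
  then show "cmod (of_real (w t) * g t * (u * f t + v * g t)) \<le> B * (\<bar>w t\<bar> * (cmod (f t) + cmod (g t))\<^sup>2)"
    "cmod (of_real (w t) * f t * (u * f t + v * g t)) \<le> B * (\<bar>w t\<bar> * (cmod (f t) + cmod (g t))\<^sup>2)"
    by simp_all
qed

text \<open>The factorial makes the series in mu converge for every mu. The bound depends on
  \<open>x\<close> only through \<open>total x\<close>, which stays bounded up to the end once all
  solutions are square integrable.\<close>

lemma picard_bound:
  assumes C: "cmod u0 \<le> C" "cmod v0 \<le> C"
  shows "x \<in> J \<Longrightarrow> cmod (fst (picard u0 v0 k) x) \<le> C * (total x ^ k / fact k) \<and>
    cmod (snd (picard u0 v0 k) x) \<le> C * (total x ^ k / fact k)"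
proof (induction k arbitrary: x)
  case 0
  then show ?case using C by simp
next
  case (Suc k)
  obtain N0 where N0: "negligible N0" "\<And>x. x \<in> J - N0 \<Longrightarrow> w x > 0" "\<And>x. x \<in> J - N0 \<Longrightarrow> p x \<noteq> 0"
    using exceptional_set by blast
  have P: "prim (\<lambda>x. of_real C * complex_of_real (total x ^ k / fact k * kernel x))
      (\<lambda>x. of_real C * complex_of_real (total x ^ Suc k / fact (Suc k)))"
    by (rule primitive_on_cmult[OF total_power_primitive])
  have ax: "a \<le> x" using initial_interval_sub(2)[OF J Suc.prems] .
  have bd: "cmod (of_real (w t) * g t * picard_comb u0 v0 k t)
      \<le> Re (of_real C * complex_of_real (total t ^ k / fact k * kernel t))"
    "cmod (of_real (w t) * f t * picard_comb u0 v0 k t)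
      \<le> Re (of_real C * complex_of_real (total t ^ k / fact k * kernel t))" if t: "t \<in> J - N0" for t
  proof -
    have "Re (of_real C * complex_of_real (total t ^ k / fact k * kernel t))
        = C * (total t ^ k / fact k) * (\<bar>w t\<bar> * (cmod (f t) + cmod (g t))\<^sup>2)"
      using N0(2)[OF t] by (simp only: of_real_mult[symmetric] Re_complex_of_real) (simp add: kernel_def)
    then show "cmod (of_real (w t) * g t * picard_comb u0 v0 k t)
      \<le> Re (of_real C * complex_of_real (total t ^ k / fact k * kernel t))"
    "cmod (of_real (w t) * f t * picard_comb u0 v0 k t)
      \<le> Re (of_real C * complex_of_real (total t ^ k / fact k * kernel t))"
      using combination_bound[of "fst (picard u0 v0 k) t" "C * (total t ^ k / fact k)" "snd (picard u0 v0 k) t" t]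
        Suc.IH[of t] t by (simp_all only: Diff_iff simp_thms)
  qed
  have "cmod (fst (picard u0 v0 (Suc k)) x - fst (picard u0 v0 (Suc k)) a)
      \<le> Re (of_real C * complex_of_real (total x ^ Suc k / fact (Suc k)) - of_real C * complex_of_real (total a ^ Suc k / fact (Suc k)))"
    by (rule primitive_on_norm_le[OF J picard_primitive(1) P a_in Suc.prems ax N0(1)]) (rule bd)
  moreover have "cmod (snd (picard u0 v0 (Suc k)) x - snd (picard u0 v0 (Suc k)) a)
      \<le> Re (of_real C * complex_of_real (total x ^ Suc k / fact (Suc k)) - of_real C * complex_of_real (total a ^ Suc k / fact (Suc k)))"
    by (rule primitive_on_norm_le[OF J picard_primitive(2) P a_in Suc.prems ax N0(1)]) (use bd in auto)
  moreover have "Re (of_real C * complex_of_real (total x ^ Suc k / fact (Suc k)) - of_real C * complex_of_real (total a ^ Suc k / fact (Suc k)))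
     = C * (total x ^ Suc k / fact (Suc k))"
    by (simp only: total_a of_real_mult[symmetric] of_real_diff[symmetric] Re_complex_of_real) simp
  moreover have "fst (picard u0 v0 (Suc k)) a = 0" "snd (picard u0 v0 (Suc k)) a = 0" by simp_all
  ultimately show ?case by simp
qed

definition coef1 :: "complex \<Rightarrow> complex \<Rightarrow> complex \<Rightarrow> real \<Rightarrow> complex" where
  "coef1 u0 v0 \<mu> x = (\<Sum>k. fst (picard u0 v0 k) x * \<mu> ^ k)"

definition coef2 :: "complex \<Rightarrow> complex \<Rightarrow> complex \<Rightarrow> real \<Rightarrow> complex" where
  "coef2 u0 v0 \<mu> x = (\<Sum>k. snd (picard u0 v0 k) x * \<mu> ^ k)"

lemma exp_majorant_summable: "summable (\<lambda>k. C * ((r * T) ^ k / fact k))" for C r T :: real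
  using summable_mult[OF summable_exp[of "r * T"], of C] by (simp add: field_simps)

lemma exp_majorant_suminf: "(\<Sum>k. C * ((r * T) ^ k / fact k)) = C * exp (r * T)" for C r T :: real
proof -
  have "(\<lambda>k. (r * T) ^ k / fact k) sums exp (r * T)"
    using exp_converges[of "r * T"] by (simp add: scaleR_conv_of_real field_simps)
  from sums_mult[OF this, of C] show ?thesis by (simp add: sums_iff)
qed

lemma picard_term_bound:
  assumes "t \<in> J" "x \<in> J" "t \<le> x"
  shows "cmod (fst (picard u0 v0 k) t * \<mu> ^ k) \<le> (cmod u0 + cmod v0) * ((cmod \<mu> * total x) ^ k / fact k)"
    "cmod (snd (picard u0 v0 k) t * \<mu> ^ k) \<le> (cmod u0 + cmod v0) * ((cmod \<mu> * total x) ^ k / fact k)"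
proof -
  define B where "B = (cmod u0 + cmod v0) * (total t ^ k / fact k)"
  have *: "cmod (fst (picard u0 v0 k) t) \<le> B" "cmod (snd (picard u0 v0 k) t) \<le> B"
    unfolding B_def using picard_bound[of u0 "cmod u0 + cmod v0" v0 t k] assms by auto
  have "B * cmod \<mu> ^ k \<le> (cmod u0 + cmod v0) * (total x ^ k / fact k) * cmod \<mu> ^ k"
    unfolding B_def using assms total_nonneg total_mono
    by (intro mult_right_mono mult_left_mono divide_right_mono power_mono) auto
  then have le: "B * cmod \<mu> ^ k \<le> (cmod u0 + cmod v0) * ((cmod \<mu> * total x) ^ k / fact k)"
    by (simp add: power_mult_distrib mult_ac)
  have "cmod c * cmod \<mu> ^ k \<le> B * cmod \<mu> ^ k" if "cmod c \<le> B" for c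
    using that by (intro mult_right_mono) auto
  with * le show "cmod (fst (picard u0 v0 k) t * \<mu> ^ k) \<le> (cmod u0 + cmod v0) * ((cmod \<mu> * total x) ^ k / fact k)"
    "cmod (snd (picard u0 v0 k) t * \<mu> ^ k) \<le> (cmod u0 + cmod v0) * ((cmod \<mu> * total x) ^ k / fact k)"
    by (auto simp: norm_mult norm_power intro: order.trans)
qed

lemma coef_sums:
  assumes "x \<in> J"
  shows "(\<lambda>k. fst (picard u0 v0 k) x * \<mu> ^ k) sums coef1 u0 v0 \<mu> x"
    "(\<lambda>k. snd (picard u0 v0 k) x * \<mu> ^ k) sums coef2 u0 v0 \<mu> x"
proof -
  have "summable (\<lambda>k. fst (picard u0 v0 k) x * \<mu> ^ k)" "summable (\<lambda>k. snd (picard u0 v0 k) x * \<mu> ^ k)"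
    using picard_term_bound[OF assms assms order.refl, of u0 v0 _ \<mu>]
    by (intro summable_comparison_test'[OF exp_majorant_summable]; blast)+
  then show "(\<lambda>k. fst (picard u0 v0 k) x * \<mu> ^ k) sums coef1 u0 v0 \<mu> x"
    "(\<lambda>k. snd (picard u0 v0 k) x * \<mu> ^ k) sums coef2 u0 v0 \<mu> x"
    by (simp_all add: coef1_def coef2_def summable_sums)
qed

lemma partial_sum_bound:
  assumes "t \<in> J" "x \<in> J" "t \<le> x"
  shows "cmod (\<Sum>k<n. fst (picard u0 v0 k) t * \<mu> ^ k) \<le> (cmod u0 + cmod v0) * exp (cmod \<mu> * total x)"
    "cmod (\<Sum>k<n. snd (picard u0 v0 k) t * \<mu> ^ k) \<le> (cmod u0 + cmod v0) * exp (cmod \<mu> * total x)"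
proof -
  have "(\<Sum>k<n. (cmod u0 + cmod v0) * ((cmod \<mu> * total x) ^ k / fact k)) \<le> (\<Sum>k. (cmod u0 + cmod v0) * ((cmod \<mu> * total x) ^ k / fact k))"
    using total_nonneg[OF assms(2)] by (intro sum_le_suminf exp_majorant_summable) auto
  then have *: "(\<Sum>k<n. (cmod u0 + cmod v0) * ((cmod \<mu> * total x) ^ k / fact k)) \<le> (cmod u0 + cmod v0) * exp (cmod \<mu> * total x)"
    by (simp only: exp_majorant_suminf)
  show "cmod (\<Sum>k<n. fst (picard u0 v0 k) t * \<mu> ^ k) \<le> (cmod u0 + cmod v0) * exp (cmod \<mu> * total x)"
    "cmod (\<Sum>k<n. snd (picard u0 v0 k) t * \<mu> ^ k) \<le> (cmod u0 + cmod v0) * exp (cmod \<mu> * total x)"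
    by (rule order.trans[OF sum_norm_le *], rule picard_term_bound[OF assms])+
qed

lemma coef_bound:
  assumes "t \<in> J" "x \<in> J" "t \<le> x"
  shows "cmod (coef1 u0 v0 \<mu> t) \<le> (cmod u0 + cmod v0) * exp (cmod \<mu> * total x)"
    "cmod (coef2 u0 v0 \<mu> t) \<le> (cmod u0 + cmod v0) * exp (cmod \<mu> * total x)"
proof -
  show "cmod (coef1 u0 v0 \<mu> t) \<le> (cmod u0 + cmod v0) * exp (cmod \<mu> * total x)"
    by (rule LIMSEQ_le_const2[OF tendsto_norm[OF coef_sums(1)[OF assms(1), unfolded sums_def]]])
      (intro exI allI impI partial_sum_bound assms)
  show "cmod (coef2 u0 v0 \<mu> t) \<le> (cmod u0 + cmod v0) * exp (cmod \<mu> * total x)"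
    by (rule LIMSEQ_le_const2[OF tendsto_norm[OF coef_sums(2)[OF assms(1), unfolded sums_def]]])
      (intro exI allI impI partial_sum_bound assms)
qed

lemma coef_a: "coef1 u0 v0 \<mu> a = u0" "coef2 u0 v0 \<mu> a = v0"
proof -
  have "(\<lambda>k. fst (picard u0 v0 k) a * \<mu> ^ k) = (\<lambda>k. if k = 0 then u0 else 0)"
    "(\<lambda>k. snd (picard u0 v0 k) a * \<mu> ^ k) = (\<lambda>k. if k = 0 then v0 else 0)"
  proof -
    have "fst (picard u0 v0 k) a * \<mu> ^ k = (if k = 0 then u0 else 0)"
      "snd (picard u0 v0 k) a * \<mu> ^ k = (if k = 0 then v0 else 0)" for k
      by (cases k; simp)+
    then show "(\<lambda>k. fst (picard u0 v0 k) a * \<mu> ^ k) = (\<lambda>k. if k = 0 then u0 else 0)"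
      "(\<lambda>k. snd (picard u0 v0 k) a * \<mu> ^ k) = (\<lambda>k. if k = 0 then v0 else 0)" by blast+
  qed
  then show "coef1 u0 v0 \<mu> a = u0" "coef2 u0 v0 \<mu> a = v0"
    unfolding coef1_def coef2_def using sums_single[of 0 "\<lambda>_. u0"] sums_single[of 0 "\<lambda>_. v0"]
    by (simp_all add: sums_iff)
qed

lemma coef_holomorphic:
  assumes "x \<in> J"
  shows "(\<lambda>\<mu>. coef1 u0 v0 \<mu> x) holomorphic_on UNIV" "(\<lambda>\<mu>. coef2 u0 v0 \<mu> x) holomorphic_on UNIV"
proof -
  have "(\<lambda>\<mu>. coef1 u0 v0 \<mu> x) holomorphic_on ball 0 r" "(\<lambda>\<mu>. coef2 u0 v0 \<mu> x) holomorphic_on ball 0 r" for r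
    using coef_sums[OF assms, of u0 v0] by (auto intro!: power_series_holomorphic)
  then have *: "(\<lambda>\<mu>. coef1 u0 v0 \<mu> x) field_differentiable at \<mu>" "(\<lambda>\<mu>. coef2 u0 v0 \<mu> x) field_differentiable at \<mu>" for \<mu>
    by (meson centre_in_ball holomorphic_on_imp_differentiable_at open_ball mem_ball_0 less_add_one)+
  show "(\<lambda>\<mu>. coef1 u0 v0 \<mu> x) holomorphic_on UNIV" "(\<lambda>\<mu>. coef2 u0 v0 \<mu> x) holomorphic_on UNIV"
    using * by (auto simp: holomorphic_on_def field_differentiable_at_within)
qed

lemma coef_continuous:
  assumes x: "x \<in> J"
  shows "continuous_on {a..x} (coef1 u0 v0 \<mu>)" "continuous_on {a..x} (coef2 u0 v0 \<mu>)"
proof -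
  have t: "t \<in> J" "t \<le> x" if "t \<in> {a..x}" for t using that sub[OF x] by auto
  have ul: "uniform_limit {a..x} (\<lambda>n t. \<Sum>k<n. fst (picard u0 v0 k) t * \<mu> ^ k) (coef1 u0 v0 \<mu>) sequentially"
    "uniform_limit {a..x} (\<lambda>n t. \<Sum>k<n. snd (picard u0 v0 k) t * \<mu> ^ k) (coef2 u0 v0 \<mu>) sequentially"
    using t picard_term_bound[OF _ x, of _ u0 v0 _ \<mu>] unfolding coef1_def coef2_def
    by (intro Weierstrass_m_test[OF _ exp_majorant_summable]; blast)+
  have c: "continuous_on {a..x} (\<lambda>t. \<Sum>k<n. fst (picard u0 v0 k) t * \<mu> ^ k)"
    "continuous_on {a..x} (\<lambda>t. \<Sum>k<n. snd (picard u0 v0 k) t * \<mu> ^ k)" for n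
    using picard_continuous[OF x] by (intro continuous_intros; blast)+
  show "continuous_on {a..x} (coef1 u0 v0 \<mu>)"
    by (rule uniform_limit_theorem[OF _ ul(1)]) (simp_all add: c)
  show "continuous_on {a..x} (coef2 u0 v0 \<mu>)"
    by (rule uniform_limit_theorem[OF _ ul(2)]) (simp_all add: c)
qed

text \<open>Dominated convergence; the majorant is the exponential bound for the partial sums times
  |w| (|f| + |g|)^2, uniform in \<open>n\<close>.\<close>

lemma picard_limit:
  fixes h :: "real \<Rightarrow> complex"
  assumes x: "x \<in> J" and h: "h = f \<or> h = g"
  shows "(\<lambda>n. integral {a..x} (\<lambda>t. of_real (w t) * h t *
      partial_comb u0 v0 \<mu> n t))
    \<longlonglongrightarrow> integral {a..x} (\<lambda>t. of_real (w t) * h t * (coef1 u0 v0 \<mu> t * f t + coef2 u0 v0 \<mu> t * g t))"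
proof (rule dominated_convergence(2))
  have t: "t \<in> J" "t \<le> x" if "t \<in> {a..x}" for t using that sub[OF x] by auto
  define B where "B = (cmod u0 + cmod v0) * exp (cmod \<mu> * total x)"
  have c: "continuous_on {a..x} (\<lambda>t. \<Sum>k<n. fst (picard u0 v0 k) t * \<mu> ^ k)"
    "continuous_on {a..x} (\<lambda>t. \<Sum>k<n. snd (picard u0 v0 k) t * \<mu> ^ k)" for n
    using picard_continuous[OF x] by (intro continuous_intros; blast)+
  show "(\<lambda>t. of_real (w t) * h t *
      partial_comb u0 v0 \<mu> n t) integrable_on {a..x}" for n
    using combination_integrable[OF x c] h by (blast intro: set_lebesgue_integral_eq_integral(1))
  have "(\<lambda>t. complex_of_real (w t) * complex_of_real ((cmod (f t) + cmod (g t))\<^sup>2)) absolutely_integrable_on {a..x}"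
    using system_continuous(1)[OF f x] system_continuous(1)[OF g x]
    by (intro continuous_weight_integrable x continuous_intros)
  from absolutely_integrable_norm[OF this]
  have "(\<lambda>t. \<bar>w t\<bar> * (cmod (f t) + cmod (g t))\<^sup>2) absolutely_integrable_on {a..x}"
    by (simp add: o_def norm_mult norm_power abs_of_nonneg flip: of_real_add)
  then have "(\<lambda>t. \<bar>w t\<bar> * (cmod (f t) + cmod (g t))\<^sup>2) integrable_on {a..x}"
    by (rule set_lebesgue_integral_eq_integral(1))
  then show "(\<lambda>t. B * (\<bar>w t\<bar> * (cmod (f t) + cmod (g t))\<^sup>2)) integrable_on {a..x}"
    by (rule integrable_on_mult_right)
  show "norm (of_real (w t) * h t * partial_comb u0 v0 \<mu> n t)
      \<le> B * (\<bar>w t\<bar> * (cmod (f t) + cmod (g t))\<^sup>2)" if "t \<in> {a..x}" for n t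
    unfolding B_def using combination_bound partial_sum_bound[OF t(1)[OF that] x t(2)[OF that]] h by blast
  show "(\<lambda>n. of_real (w t) * h t * partial_comb u0 v0 \<mu> n t)
      \<longlonglongrightarrow> of_real (w t) * h t * (coef1 u0 v0 \<mu> t * f t + coef2 u0 v0 \<mu> t * g t)" if "t \<in> {a..x}" for t
    using coef_sums[OF t(1)[OF that], of u0 v0 \<mu>] unfolding sums_def by (intro tendsto_intros)
qed

text \<open>Partial sums are themselves successive approximations: \<open>Suc n\<close> terms on the
  left match \<open>n\<close> terms under the integral, because each coefficient integrates the
  preceding one.\<close>

lemma picard_partial_sum:
  assumes x: "x \<in> J"
  shows "(\<Sum>k<Suc n. fst (picard u0 v0 k) x * \<mu> ^ k) = u0 + \<mu> * integral {a..x} (\<lambda>t. of_real (w t) * g t *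
      partial_comb u0 v0 \<mu> n t)" (is ?A)
    "(\<Sum>k<Suc n. snd (picard u0 v0 k) x * \<mu> ^ k) = v0 - \<mu> * integral {a..x} (\<lambda>t. of_real (w t) * f t *
      partial_comb u0 v0 \<mu> n t)" (is ?B)
proof -
  have *: "integral {a..x} (\<lambda>t. of_real (w t) * h t *
      partial_comb u0 v0 \<mu> n t)
     = (\<Sum>k<n. integral {a..x} (\<lambda>t. of_real (w t) * h t * picard_comb u0 v0 k t) * \<mu> ^ k)"
    if h: "h = f \<or> h = g" for h
  proof -
    have i: "(\<lambda>t. of_real (w t) * h t * picard_comb u0 v0 k t) integrable_on {a..x}" for k
      using combination_integrable[OF x] picard_continuous[OF x] h by (blast intro: set_lebesgue_integral_eq_integral(1))
    have e1: "(\<lambda>t. of_real (w t) * h t *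
      partial_comb u0 v0 \<mu> n t)
     = (\<lambda>t. \<Sum>k<n. of_real (w t) * h t * picard_comb u0 v0 k t * \<mu> ^ k)"
      by (simp add: fun_eq_iff sum_distrib_left sum_distrib_right sum.distrib algebra_simps)
    have e2: "integral {a..x} (\<lambda>t. \<Sum>k<n. of_real (w t) * h t * picard_comb u0 v0 k t * \<mu> ^ k)
      = (\<Sum>k<n. integral {a..x} (\<lambda>t. of_real (w t) * h t * picard_comb u0 v0 k t * \<mu> ^ k))"
      using i by (intro integral_sum) (auto intro: integrable_on_mult_left)
    show ?thesis unfolding e1 e2 by (simp only: Henstock_Kurzweil_Integration.integral_mult_left)
  qed
  show ?A unfolding *[of g, OF disjI2[OF refl]] sum.lessThan_Suc_shift
    by (simp add: sum_distrib_left mult_ac)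
  show ?B unfolding *[of f, OF disjI1[OF refl]] sum.lessThan_Suc_shift
    by (simp add: sum_distrib_left mult_ac sum_negf)
qed

text \<open>In the limit the recursion for the partial sums becomes the integral equation of the
  perturbed system.\<close>

lemma coef_primitive:
  "prim (\<lambda>t. of_real (w t) * g t * (\<mu> * (coef1 u0 v0 \<mu> t * f t + coef2 u0 v0 \<mu> t * g t))) (coef1 u0 v0 \<mu>)"
  "prim (\<lambda>t. - (of_real (w t) * f t * (\<mu> * (coef1 u0 v0 \<mu> t * f t + coef2 u0 v0 \<mu> t * g t)))) (coef2 u0 v0 \<mu>)"
proof -
  let ?y = "\<lambda>t. coef1 u0 v0 \<mu> t * f t + coef2 u0 v0 \<mu> t * g t"
  have i: "(\<lambda>t. of_real (w t) * g t * ?y t) absolutely_integrable_on {a..x}"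
    "(\<lambda>t. of_real (w t) * f t * ?y t) absolutely_integrable_on {a..x}" if "x \<in> J" for x
    using combination_integrable[OF that coef_continuous[OF that]] by blast+
  have P: "prim (\<lambda>t. \<mu> * (of_real (w t) * g t * ?y t)) (\<lambda>x. \<mu> * (0 + integral {a..x} (\<lambda>t. of_real (w t) * g t * ?y t)))"
    "prim (\<lambda>t. - \<mu> * (of_real (w t) * f t * ?y t)) (\<lambda>x. - \<mu> * (0 + integral {a..x} (\<lambda>t. of_real (w t) * f t * ?y t)))"
    by (intro primitive_on_cmult primitive_on_integral[OF J] i; assumption)+
  have "coef1 u0 v0 \<mu> x = u0 + \<mu> * integral {a..x} (\<lambda>t. of_real (w t) * g t * ?y t)" if x: "x \<in> J" for x
  proof (rule LIMSEQ_unique)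
    show "(\<lambda>n. \<Sum>k<Suc n. fst (picard u0 v0 k) x * \<mu> ^ k) \<longlonglongrightarrow> coef1 u0 v0 \<mu> x"
      using LIMSEQ_Suc[OF coef_sums(1)[OF x, of u0 v0 \<mu>, unfolded sums_def]] .
    show "(\<lambda>n. \<Sum>k<Suc n. fst (picard u0 v0 k) x * \<mu> ^ k) \<longlonglongrightarrow> u0 + \<mu> * integral {a..x} (\<lambda>t. of_real (w t) * g t * ?y t)"
      unfolding picard_partial_sum[OF x] by (intro tendsto_intros picard_limit x) auto
  qed
  moreover have "coef2 u0 v0 \<mu> x = v0 - \<mu> * integral {a..x} (\<lambda>t. of_real (w t) * f t * ?y t)" if x: "x \<in> J" for x
  proof (rule LIMSEQ_unique)
    show "(\<lambda>n. \<Sum>k<Suc n. snd (picard u0 v0 k) x * \<mu> ^ k) \<longlonglongrightarrow> coef2 u0 v0 \<mu> x"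
      using LIMSEQ_Suc[OF coef_sums(2)[OF x, of u0 v0 \<mu>, unfolded sums_def]] .
    show "(\<lambda>n. \<Sum>k<Suc n. snd (picard u0 v0 k) x * \<mu> ^ k) \<longlonglongrightarrow> v0 - \<mu> * integral {a..x} (\<lambda>t. of_real (w t) * f t * ?y t)"
      unfolding picard_partial_sum[OF x] by (intro tendsto_intros picard_limit x) auto
  qed
  ultimately show "prim (\<lambda>t. of_real (w t) * g t * (\<mu> * ?y t)) (coef1 u0 v0 \<mu>)"
    "prim (\<lambda>t. - (of_real (w t) * f t * (\<mu> * ?y t))) (coef2 u0 v0 \<mu>)"
    using P unfolding primitive_on_def by (simp_all add: coef_a mult_ac)
qed

text \<open>The series is expanded at the base point zeta, hence the argument
  \<open>\<xi> - \<zeta>\<close>. \<open>u0\<close> and \<open>v0\<close> are the coefficients at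
  \<open>a\<close>, which makes the initial values independent of \<open>\<xi>\<close>.\<close>

definition sol :: "complex \<Rightarrow> complex \<Rightarrow> complex \<Rightarrow> real \<Rightarrow> complex" where
  "sol u0 v0 \<xi> x = coef1 u0 v0 (\<xi> - \<zeta>) x * f x + coef2 u0 v0 (\<xi> - \<zeta>) x * g x"

definition sol1 :: "complex \<Rightarrow> complex \<Rightarrow> complex \<Rightarrow> real \<Rightarrow> complex" where
  "sol1 u0 v0 \<xi> x = coef1 u0 v0 (\<xi> - \<zeta>) x * f1 x + coef2 u0 v0 (\<xi> - \<zeta>) x * g1 x"

lemma sol_system: "system (sol u0 v0 \<xi>) (sol1 u0 v0 \<xi>) (\<lambda>x. \<xi> * sol u0 v0 \<xi> x)"
proof -
  have "system (\<lambda>x. sol u0 v0 \<xi> x) (\<lambda>x. sol1 u0 v0 \<xi> x) (\<lambda>x. (\<xi> - \<zeta>) * sol u0 v0 \<xi> x + \<zeta> * sol u0 v0 \<xi> x)"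
    unfolding sol_def sol1_def
    by (rule variation_of_constants[OF coef_primitive[of "\<xi> - \<zeta>" u0 v0]])
  then show ?thesis by (simp add: algebra_simps)
qed

lemma sol_a: "sol u0 v0 \<xi> a = u0 * f a + v0 * g a" "sol1 u0 v0 \<xi> a = u0 * f1 a + v0 * g1 a"
  by (simp_all add: sol_def sol1_def coef_a)

text \<open>Brackets with the basis read off the coefficients. With psi in the place of
  \<open>g\<close>, the characteristic function is thus a coefficient of the construction, and its
  analytic properties are already known.\<close>

lemma bracket_sol:
  assumes "x \<in> J"
  shows "bracket (sol u0 v0 \<xi>) (sol1 u0 v0 \<xi>) g g1 x = coef1 u0 v0 (\<xi> - \<zeta>) x"
    "bracket (sol u0 v0 \<xi>) (sol1 u0 v0 \<xi>) f f1 x = - coef2 u0 v0 (\<xi> - \<zeta>) x"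
proof -
  have "bracket (sol u0 v0 \<xi>) (sol1 u0 v0 \<xi>) g g1 x = coef1 u0 v0 (\<xi> - \<zeta>) x * bracket f f1 g g1 x"
    "bracket (sol u0 v0 \<xi>) (sol1 u0 v0 \<xi>) f f1 x = - coef2 u0 v0 (\<xi> - \<zeta>) x * bracket f f1 g g1 x"
    by (simp_all add: bracket_def sol_def sol1_def algebra_simps)
  then show "bracket (sol u0 v0 \<xi>) (sol1 u0 v0 \<xi>) g g1 x = coef1 u0 v0 (\<xi> - \<zeta>) x"
    "bracket (sol u0 v0 \<xi>) (sol1 u0 v0 \<xi>) f f1 x = - coef2 u0 v0 (\<xi> - \<zeta>) x"
    using wronskian[OF assms] by simp_all
qed

text \<open>Initial values do not move with the parameter, so the Wronskian stays 1 and every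
  statement about bases becomes available at \<open>\<xi>\<close>.\<close>

lemma sl_basis_sol:
  "sl_basis a J w p q \<xi> (sol 1 0 \<xi>) (sol1 1 0 \<xi>) (sol 0 1 \<xi>) (sol1 0 1 \<xi>)"
proof (intro sl_basis.intro sl_coefficients_axioms sl_basis_axioms.intro sol_system)
  show "bracket (sol 1 0 \<xi>) (sol1 1 0 \<xi>) (sol 0 1 \<xi>) (sol1 0 1 \<xi>) a = 1"
    using wronskian_a by (simp add: bracket_def sol_a)
qed

lemma sol_holomorphic:
  assumes "x \<in> J"
  shows "(\<lambda>\<xi>. sol u0 v0 \<xi> x) holomorphic_on UNIV" "(\<lambda>\<xi>. sol1 u0 v0 \<xi> x) holomorphic_on UNIV"
proof -
  have "(\<lambda>\<xi>. coef1 u0 v0 (\<xi> - \<zeta>) x) holomorphic_on UNIV" "(\<lambda>\<xi>. coef2 u0 v0 (\<xi> - \<zeta>) x) holomorphic_on UNIV"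
    using holomorphic_on_compose_gen[of "\<lambda>\<xi>. \<xi> - \<zeta>" UNIV "\<lambda>\<mu>. coef1 u0 v0 \<mu> x" UNIV, unfolded o_def]
      holomorphic_on_compose_gen[of "\<lambda>\<xi>. \<xi> - \<zeta>" UNIV "\<lambda>\<mu>. coef2 u0 v0 \<mu> x" UNIV, unfolded o_def]
      coef_holomorphic[OF assms, of u0 v0] by (simp_all add: holomorphic_intros)
  then show "(\<lambda>\<xi>. sol u0 v0 \<xi> x) holomorphic_on UNIV" "(\<lambda>\<xi>. sol1 u0 v0 \<xi> x) holomorphic_on UNIV"
    unfolding sol_def sol1_def by (auto intro!: holomorphic_intros)
qed

end

section \<open>Square-integrable functions and the spectrum\<close>

text \<open>A greatest element of \<open>J\<close> serves as a constant sequence; otherwise the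
  running maxima of an enumeration of the rationals in \<open>J\<close> pass every point.\<close>

lemma initial_interval_exhaustion:
  assumes J: "initial_interval a J"
  obtains X :: "nat \<Rightarrow> real" where "\<And>n. X n \<in> J" "\<And>x. x \<in> J \<Longrightarrow> eventually (\<lambda>n. x \<le> X n) sequentially"
proof (cases "\<exists>M\<in>J. \<forall>x\<in>J. x \<le> M")
  case True
  then obtain M where "M \<in> J" "\<forall>x\<in>J. x \<le> M" by blast
  then show ?thesis using that[of "\<lambda>n. M"] by simp
next
  case False
  have r: "\<exists>r\<in>J \<inter> \<rat>. x < r" if x: "x \<in> J" for x
  proof -
    obtain y where y: "y \<in> J" "x < y" using False x by (meson not_le)
    obtain r where r: "r \<in> \<rat>" "x < r" "r < y" using Rats_dense_in_real y(2) by blast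
    moreover have "r \<in> J" using initial_interval_sub(1)[OF J y(1)] initial_interval_sub(2)[OF J x] r by auto
    ultimately show ?thesis by blast
  qed
  have ne: "J \<inter> \<rat> \<noteq> {}" using r[OF initial_interval_sub(3)[OF J]] J by (auto simp: initial_interval_def)
  have cnt: "countable (J \<inter> \<rat>)" using countable_rat by (rule countable_Int2)
  define e where "e = from_nat_into (J \<inter> \<rat>)"
  have e: "range e = J \<inter> \<rat>" unfolding e_def by (rule range_from_nat_into[OF ne cnt])
  define X where "X = (\<lambda>n. Max (e ` {..n}))"
  show ?thesis
  proof
    show "X n \<in> J" for n
    proof -
      have "X n \<in> e ` {..n}" unfolding X_def by (intro Max_in) auto
      then show ?thesis using e by auto
    qed
    fix x assume "x \<in> J"
    then obtain r where r: "r \<in> J \<inter> \<rat>" "x < r" using r by blast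
    then obtain k where k: "r = e k" using e by (metis imageE)
    have "x \<le> X n" if "k \<le> n" for n
    proof -
      have "e k \<le> X n" unfolding X_def using that by (intro Max_ge) auto
      then show ?thesis using r k by simp
    qed
    then show "eventually (\<lambda>n. x \<le> X n) sequentially" unfolding eventually_sequentially by blast
  qed
qed

lemma measurable_on_initial_interval:
  fixes f :: "real \<Rightarrow> 'b::euclidean_space"
  assumes J: "initial_interval a J" and f: "\<And>x. x \<in> J \<Longrightarrow> f \<in> borel_measurable (lebesgue_on {a..x})"
  shows "f \<in> borel_measurable (lebesgue_on J)"
proof -
  obtain X :: "nat \<Rightarrow> real" where X: "\<And>n. X n \<in> J" "\<And>x. x \<in> J \<Longrightarrow> eventually (\<lambda>n. x \<le> X n) sequentially"
    using initial_interval_exhaustion[OF J] by blast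
  show ?thesis
  proof (rule borel_measurable_LIMSEQ_metric)
    show "(\<lambda>t. indicator {a..X n} t *\<^sub>R f t) \<in> borel_measurable (lebesgue_on J)" for n
    proof -
      have "(\<lambda>t. indicator {a..X n} t *\<^sub>R f t) \<in> borel_measurable lebesgue"
        using f[OF X(1)[of n]] by (subst (asm) borel_measurable_restrict_space_iff) auto
      then show ?thesis by (rule measurable_restrict_space1)
    qed
    fix x assume "x \<in> space (lebesgue_on J)"
    then have x: "x \<in> J" by simp
    have ax: "a \<le> x" using initial_interval_sub(2)[OF J x] .
    have "eventually (\<lambda>n. indicator {a..X n} x *\<^sub>R f x = f x) sequentially"
      using X(2)[OF x] by (rule eventually_mono) (simp add: ax)
    then show "(\<lambda>n. indicator {a..X n} x *\<^sub>R f x) \<longlonglongrightarrow> f x" by (rule tendsto_eventually)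
  qed
qed

context sl_coefficients
begin

lemma measurableI:
  fixes f :: "real \<Rightarrow> complex"
  shows "(\<And>x. x \<in> J \<Longrightarrow> continuous_on {a..x} f) \<Longrightarrow> f \<in> borel_measurable (lebesgue_on J)"
  by (intro measurable_on_initial_interval[OF J] continuous_imp_measurable_on_sets_lebesgue) auto

lemma weight_measurable [measurable]: "w \<in> borel_measurable (lebesgue_on J)"
proof (rule measurable_on_initial_interval[OF J])
  fix x assume "x \<in> J"
  then have "w absolutely_integrable_on {a..x}" using w_int sub by (simp add: loc_integrable_on_def)
  then show "w \<in> borel_measurable (lebesgue_on {a..x})" by (rule absolutely_integrable_measurable[THEN iffD1, THEN conjunct1, rotated]) simp
qed

lemma weight_AE_nonneg: "AE x in lebesgue_on J. 0 \<le> w x"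
  using w_pos by eventually_elim simp

lemma L2w_measurable: "f \<in> L2w J w \<Longrightarrow> f \<in> borel_measurable (lebesgue_on J)"
  and L2w_integrable: "f \<in> L2w J w \<Longrightarrow> integrable (lebesgue_on J) (\<lambda>x. (cmod (f x))\<^sup>2 * w x)"
  by (auto simp: L2w_def)

section \<open>Estimates in the weighted space\<close>

definition sqnorm :: "(real \<Rightarrow> complex) \<Rightarrow> real" where
  "sqnorm f = integral\<^sup>L (lebesgue_on J) (\<lambda>x. (cmod (f x))\<^sup>2 * w x)"

lemma sqnorm_nonneg: "0 \<le> sqnorm f"
  unfolding sqnorm_def using weight_AE_nonneg by (intro integral_nonneg_AE) (auto elim: eventually_mono)

lemma L2w_norm_eq: "L2w_norm J w f = sqrt (sqnorm f)"
  by (simp add: L2w_norm_def sqnorm_def)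

text \<open>The factor 2 stems from (s + t)^2 \<le> 2 (s^2 + t^2). It serves for combinations u f +
  v g with bounded coefficients, both for membership and for the norm.\<close>

lemma L2w_dominated:
  assumes f: "f \<in> L2w J w" and g: "g \<in> L2w J w" and y: "y \<in> borel_measurable (lebesgue_on J)"
    and le: "AE x in lebesgue_on J. cmod (y x) \<le> B * (cmod (f x) + cmod (g x))"
  shows "y \<in> L2w J w" "sqnorm y \<le> 2 * B\<^sup>2 * (sqnorm f + sqnorm g)"
proof -
  have i: "integrable (lebesgue_on J) (\<lambda>x. 2 * B\<^sup>2 * ((cmod (f x))\<^sup>2 * w x + (cmod (g x))\<^sup>2 * w x))"
    using L2w_integrable[OF f] L2w_integrable[OF g] by simp
  have le': "AE x in lebesgue_on J. (cmod (y x))\<^sup>2 * w x \<le> 2 * B\<^sup>2 * ((cmod (f x))\<^sup>2 * w x + (cmod (g x))\<^sup>2 * w x)"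
    using le weight_AE_nonneg
  proof eventually_elim
    case (elim x)
    have "(cmod (y x))\<^sup>2 \<le> (B * (cmod (f x) + cmod (g x)))\<^sup>2"
      using elim(1) by (intro power_mono) auto
    also have "\<dots> \<le> 2 * B\<^sup>2 * ((cmod (f x))\<^sup>2 + (cmod (g x))\<^sup>2)"
    proof -
      have "(cmod (f x) + cmod (g x))\<^sup>2 \<le> 2 * ((cmod (f x))\<^sup>2 + (cmod (g x))\<^sup>2)"
        using sum_squares_bound[of "cmod (f x)" "cmod (g x)"] by (simp add: power2_sum)
      from mult_left_mono[OF this, of "B\<^sup>2"] show ?thesis by (simp only: power_mult_distrib mult_ac zero_le_power2 simp_thms)
    qed
    finally have "(cmod (y x))\<^sup>2 * w x \<le> 2 * B\<^sup>2 * ((cmod (f x))\<^sup>2 + (cmod (g x))\<^sup>2) * w x"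
      using elim(2) by (rule mult_right_mono)
    then show ?case by (simp add: algebra_simps)
  qed
  have iy: "integrable (lebesgue_on J) (\<lambda>x. (cmod (y x))\<^sup>2 * w x)"
  proof (rule Bochner_Integration.integrable_bound[OF i])
    show "(\<lambda>x. (cmod (y x))\<^sup>2 * w x) \<in> borel_measurable (lebesgue_on J)" using y by measurable
    show "AE x in lebesgue_on J. norm ((cmod (y x))\<^sup>2 * w x) \<le> norm (2 * B\<^sup>2 * ((cmod (f x))\<^sup>2 * w x + (cmod (g x))\<^sup>2 * w x))"
      using le' weight_AE_nonneg by eventually_elim auto
  qed
  then show "y \<in> L2w J w" using y by (simp add: L2w_def)
  have "sqnorm y \<le> integral\<^sup>L (lebesgue_on J) (\<lambda>x. 2 * B\<^sup>2 * ((cmod (f x))\<^sup>2 * w x + (cmod (g x))\<^sup>2 * w x))"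
    unfolding sqnorm_def by (rule integral_mono_AE[OF iy i le'])
  then show "sqnorm y \<le> 2 * B\<^sup>2 * (sqnorm f + sqnorm g)"
    using L2w_integrable[OF f] L2w_integrable[OF g] by (simp add: sqnorm_def)
qed

lemma L2w_lincomb:
  assumes f: "f \<in> L2w J w" and g: "g \<in> L2w J w"
  shows "(\<lambda>x. c * f x + d * g x) \<in> L2w J w"
proof (rule L2w_dominated(1)[OF f g])
  show "(\<lambda>x. c * f x + d * g x) \<in> borel_measurable (lebesgue_on J)"
    using L2w_measurable[OF f] L2w_measurable[OF g] by measurable
  have "cmod (c * f x + d * g x) \<le> (cmod c + cmod d) * (cmod (f x) + cmod (g x))" for x
  proof -
    have "cmod (c * f x + d * g x) \<le> cmod c * cmod (f x) + cmod d * cmod (g x)"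
      by (metis norm_mult norm_triangle_ineq)
    also have "\<dots> \<le> (cmod c + cmod d) * (cmod (f x) + cmod (g x))"
      by (simp add: algebra_simps)
    finally show ?thesis .
  qed
  then show "AE x in lebesgue_on J. cmod (c * f x + d * g x) \<le> (cmod c + cmod d) * (cmod (f x) + cmod (g x))"
    by simp
qed

lemma L2w_product:
  assumes f: "f \<in> L2w J w" and g: "g \<in> L2w J w"
  shows "integrable (lebesgue_on J) (\<lambda>x. complex_of_real (w x) * f x * g x)"
proof (rule Bochner_Integration.integrable_bound)
  show "integrable (lebesgue_on J) (\<lambda>x. (cmod (f x))\<^sup>2 * w x + (cmod (g x))\<^sup>2 * w x)"
    using L2w_integrable[OF f] L2w_integrable[OF g] by simp
  show "(\<lambda>x. complex_of_real (w x) * f x * g x) \<in> borel_measurable (lebesgue_on J)"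
    using L2w_measurable[OF f] L2w_measurable[OF g] by measurable
  show "AE x in lebesgue_on J. norm (complex_of_real (w x) * f x * g x) \<le> norm ((cmod (f x))\<^sup>2 * w x + (cmod (g x))\<^sup>2 * w x)"
    using weight_AE_nonneg
  proof eventually_elim
    case (elim x)
    have "0 \<le> cmod (f x) * cmod (g x)" by simp
    then have "cmod (f x) * cmod (g x) \<le> (cmod (f x))\<^sup>2 + (cmod (g x))\<^sup>2"
      using sum_squares_bound[of "cmod (f x)" "cmod (g x)"] by linarith
    then have "w x * (cmod (f x) * cmod (g x)) \<le> w x * ((cmod (f x))\<^sup>2 + (cmod (g x))\<^sup>2)"
      using elim by (intro mult_left_mono) auto
    then show ?case using elim by (simp add: norm_mult algebra_simps)
  qed
qed

lemma integrable_on_initial: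
  fixes h :: "real \<Rightarrow> complex"
  assumes "integrable (lebesgue_on J) h" "x \<in> J"
  shows "h absolutely_integrable_on {a..x}"
proof -
  have "set_integrable lebesgue J h"
    using assms(1) J_lebesgue by (simp add: integrable_restrict_space set_integrable_def)
  then show ?thesis by (rule set_integrable_subset) (use sub[OF assms(2)] in auto)
qed

text \<open>From |z| \<le> 1 + |z|^2: local integrability of \<open>w\<close> turns square
  integrability of \<open>z\<close> into the integrability of \<open>w z\<close> that the
  first-order system demands.\<close>

lemma L2w_weight_integrable:
  assumes z: "z \<in> L2w J w" and x: "x \<in> J"
  shows "(\<lambda>t. complex_of_real (w t) * z t) absolutely_integrable_on {a..x}"
proof -
  have w: "w absolutely_integrable_on {a..x}" using w_int sub[OF x] by (simp add: loc_integrable_on_def)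
  have "set_integrable lebesgue J (\<lambda>x. (cmod (z x))\<^sup>2 * w x)"
    using L2w_integrable[OF z] J_lebesgue by (simp add: integrable_restrict_space set_integrable_def)
  then have z2: "(\<lambda>x. (cmod (z x))\<^sup>2 * w x) absolutely_integrable_on {a..x}"
    by (rule set_integrable_subset) (use sub[OF x] in auto)
  have i: "integrable (lebesgue_on {a..x}) (\<lambda>t. w t + (cmod (z t))\<^sup>2 * w t)"
    using w z2 by (simp add: integrable_restrict_space set_integrable_def)
  have sets: "{a..x} \<in> sets (lebesgue_on J)"
    using sub[OF x] J_lebesgue by (auto simp: sets_restrict_space_iff)
  have rr: "restrict_space (lebesgue_on J) {a..x} = lebesgue_on {a..x}"
    using sub[OF x] by (simp add: restrict_restrict_space Int_absorb1 J_lebesgue)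
  have "(\<lambda>t. complex_of_real (w t) * z t) \<in> borel_measurable (lebesgue_on J)"
    using L2w_measurable[OF z] by measurable
  then have m: "(\<lambda>t. complex_of_real (w t) * z t) \<in> borel_measurable (lebesgue_on {a..x})"
    using measurable_restrict_space1 rr by metis
  have "AE t in lebesgue_on {a..x}. 0 \<le> w t"
  proof -
    obtain N where "negligible N" "\<forall>t\<in>J - N. 0 \<le> w t"
      using weight_AE_nonneg unfolding AE_lebesgue_on_iff_negligible[OF J_lebesgue] by blast
    then show ?thesis using sub[OF x] by (subst AE_lebesgue_on_iff_negligible) auto
  qed
  then have "AE t in lebesgue_on {a..x}. norm (complex_of_real (w t) * z t) \<le> norm (w t + (cmod (z t))\<^sup>2 * w t)"
  proof eventually_elim
    case (elim t)
    have "cmod (z t) \<le> 1 + (cmod (z t))\<^sup>2"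
      using sum_squares_bound[of 1 "cmod (z t)"] norm_ge_zero[of "z t"] unfolding power2_eq_square by linarith
    then have "w t * cmod (z t) \<le> w t * (1 + (cmod (z t))\<^sup>2)" using elim by (rule mult_left_mono)
    then show ?case using elim by (simp add: norm_mult algebra_simps)
  qed
  from Bochner_Integration.integrable_bound[OF i m this]
  show ?thesis by (simp add: integrable_restrict_space set_integrable_def)
qed

lemma increment_norm_bound:
  assumes y: "prim h y" and h: "integrable (lebesgue_on J) h" and x: "x \<in> J"
    and le: "integral\<^sup>L (lebesgue_on J) (\<lambda>t. cmod (h t)) \<le> B"
  shows "cmod (y x - y a) \<le> B"
proof -
  have hi: "set_integrable lebesgue J h"
    using h J_lebesgue by (simp add: integrable_restrict_space set_integrable_def)
  have hn: "integrable (lebesgue_on J) (\<lambda>t. cmod (h t))" using h by simp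
  then have hni: "set_integrable lebesgue J (\<lambda>t. cmod (h t))"
    using J_lebesgue by (simp add: integrable_restrict_space set_integrable_def)
  have hx: "h absolutely_integrable_on {a..x}" by (rule integrable_on_initial[OF h x])
  have "y x - y a = integral {a..x} h" using primitive_on_value[OF y x] by simp
  also have "cmod \<dots> \<le> integral {a..x} (\<lambda>t. cmod (h t))"
    using absolutely_integrable_norm[OF hx] hx
    by (intro integral_norm_bound_integral) (auto simp: o_def intro: set_lebesgue_integral_eq_integral(1))
  also have "\<dots> \<le> integral J (\<lambda>t. cmod (h t))"
    using sub[OF x] hni absolutely_integrable_norm[OF hx]
    by (intro integral_subset_le) (auto simp: o_def intro: set_lebesgue_integral_eq_integral(1))
  also have "\<dots> = integral\<^sup>L (lebesgue_on J) (\<lambda>t. cmod (h t))"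
    using hni J_lebesgue by (simp add: lebesgue_integral_eq_integral[OF hn J_lebesgue])
  finally show ?thesis using le by linarith
qed

text \<open>A substitute for the Cauchy-Schwarz inequality, from |f| |h| \<le> s |f|^2 + |h|^2 / s.
  It is linear in \<open>s\<close>, which is enough for a bounded inverse; a strictly positive
  \<open>s\<close> accommodates \<open>h = 0\<close>.\<close>

lemma pairing_bound:
  assumes f: "f \<in> L2w J w" and h: "h \<in> L2w J w" and s: "0 < s" "sqnorm h \<le> s\<^sup>2"
  shows "integral\<^sup>L (lebesgue_on J) (\<lambda>t. cmod (complex_of_real (w t) * f t * h t)) \<le> s * (sqnorm f + 1)"
proof -
  have i: "integrable (lebesgue_on J) (\<lambda>t. s * ((cmod (f t))\<^sup>2 * w t) + (1 / s) * ((cmod (h t))\<^sup>2 * w t))"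
    using L2w_integrable[OF f] L2w_integrable[OF h] by simp
  have "integral\<^sup>L (lebesgue_on J) (\<lambda>t. cmod (complex_of_real (w t) * f t * h t))
      \<le> integral\<^sup>L (lebesgue_on J) (\<lambda>t. s * ((cmod (f t))\<^sup>2 * w t) + (1 / s) * ((cmod (h t))\<^sup>2 * w t))"
  proof (rule integral_mono_AE[OF integrable_norm[OF L2w_product[OF f h]] i])
    show "AE t in lebesgue_on J. cmod (complex_of_real (w t) * f t * h t) \<le> s * ((cmod (f t))\<^sup>2 * w t) + (1 / s) * ((cmod (h t))\<^sup>2 * w t)"
      using weight_AE_nonneg
    proof eventually_elim
      case (elim t)
      have "2 * (s * cmod (f t)) * cmod (h t) \<le> (s * cmod (f t))\<^sup>2 + (cmod (h t))\<^sup>2"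
        by (rule sum_squares_bound)
      moreover have "0 \<le> s * cmod (f t) * cmod (h t)" using s by simp
      ultimately have "s * cmod (f t) * cmod (h t) \<le> (s * cmod (f t))\<^sup>2 + (cmod (h t))\<^sup>2" by linarith
      then have "cmod (f t) * cmod (h t) \<le> s * (cmod (f t))\<^sup>2 + (1 / s) * (cmod (h t))\<^sup>2"
        using s(1) by (simp add: field_simps power2_eq_square)
      from mult_left_mono[OF this elim] show ?case
        using elim by (simp add: norm_mult algebra_simps)
    qed
  qed
  also have "\<dots> = s * sqnorm f + (1 / s) * sqnorm h"
    using L2w_integrable[OF f] L2w_integrable[OF h] by (simp add: sqnorm_def)
  also have "(1 / s) * sqnorm h \<le> s" using s by (simp add: field_simps power2_eq_square)
  finally show ?thesis by (simp add: algebra_simps)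
qed

lemma restrict:
  assumes c: "c \<in> J"
  shows "sl_coefficients a {a..c} w p q"
proof
  show "initial_interval a {a..c}" using initial_interval_sub(2)[OF J c] by (rule initial_interval_Icc)
  have AE: "AE x in lebesgue_on {a..c}. P x" if "AE x in lebesgue_on J. P x" for P
    using that sub[OF c] unfolding AE_lebesgue_on_iff_negligible[OF J_lebesgue]
    by (subst AE_lebesgue_on_iff_negligible) auto
  show "AE x in lebesgue_on {a..c}. w x > 0" "AE x in lebesgue_on {a..c}. p x \<noteq> 0"
    using AE w_pos p_nz by blast+
  show "loc_integrable_on {a..c} w" "loc_integrable_on {a..c} (\<lambda>x. 1 / p x)" "loc_integrable_on {a..c} q"
    using w_int p_int q_int sub[OF c] unfolding loc_integrable_on_def by blast+
qed

section \<open>Solutions that vanish almost everywhere\<close>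

text \<open>Continuity spreads the vanishing to every point; a point \<open>c\<close> beyond
  \<open>a\<close> rules out the one-point interval, which is itself a null set.\<close>

lemma vanishes_on_initial:
  assumes y: "prim h y" and N: "negligible N" and z: "\<And>x. x \<in> J - N \<Longrightarrow> y x = 0"
    and c: "c \<in> J" "a < c" and x: "x \<in> J"
  shows "y x = 0"
proof (rule ccontr)
  assume nz: "y x \<noteq> 0"
  define d where "d = max c x"
  have d: "d \<in> J" "a < d" "x \<in> {a..d}" using c x initial_interval_sub(2)[OF J x] by (auto simp: d_def max_def)
  have "continuous_on {a..d} y" by (rule primitive_on_continuous[OF J y sub[OF d(1)]])
  then obtain e where e: "e > 0" "\<And>t. t \<in> {a..d} \<Longrightarrow> dist t x < e \<Longrightarrow> dist (y t) (y x) < cmod (y x)"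
    using d(3) nz unfolding continuous_on_iff by (metis zero_less_norm_iff)
  have yn: "y t \<noteq> 0" if "t \<in> {a..d}" "dist t x < e" for t using e(2)[OF that] by auto
  define u where "u = max a (x - e / 2)"
  define v where "v = min d (x + e / 2)"
  have uv: "u < v" "u \<le> x" "x \<le> v" using d e(1) by (auto simp: u_def v_def)
  have "{u..v} \<subseteq> N"
  proof
    fix t assume t: "t \<in> {u..v}"
    then have "t \<in> {a..d}" "dist t x < e" using e(1) by (auto simp: u_def v_def dist_real_def)
    then have "y t \<noteq> 0" "t \<in> J" using yn sub[OF d(1)] by auto
    then show "t \<in> N" using z by blast
  qed
  then have "negligible {u..v}" using N negligible_subset by blast
  then show False using uv(1) negligible_interval(1)[of u v] by simp
qed

text \<open>If \<open>y\<close> vanishes, then so does y1 = p y' almost everywhere, and continuity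
  carries this to \<open>a\<close>, against the nonzero initial data.\<close>

lemma solution_not_AE_zero:
  assumes y: "system y y1 z" and nz: "y a \<noteq> 0 \<or> y1 a \<noteq> 0" and c: "c \<in> J" "a < c"
  shows "\<not> (AE x in lebesgue_on J. y x = 0)"
proof
  assume "AE x in lebesgue_on J. y x = 0"
  then obtain N where N: "negligible N" "\<And>x. x \<in> J - N \<Longrightarrow> y x = 0"
    unfolding AE_lebesgue_on_iff_negligible[OF J_lebesgue] by blast
  have P: "prim (\<lambda>x. y1 x / p x) y" "prim (\<lambda>x. q x * y x - of_real (w x) * z x) y1"
    using y by (auto simp: sl_system_def)
  have y0: "y x = 0" if "x \<in> J" for x using vanishes_on_initial[OF P(1) N c that] .
  obtain N1 where N1: "negligible N1" "\<And>x. x \<in> J - N1 \<Longrightarrow> (y has_vector_derivative y1 x / p x) (at x)"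
    using primitive_on_derivative[OF J P(1)] by blast
  obtain N0 where N0: "negligible N0" "\<And>x. x \<in> J - N0 \<Longrightarrow> w x > 0" "\<And>x. x \<in> J - N0 \<Longrightarrow> p x \<noteq> 0"
    using exceptional_set by blast
  have Jc: "initial_interval a {a..c}" using c by (intro initial_interval_Icc) auto
  have "y1 x = 0" if x: "x \<in> {a..c} - (N1 \<union> N0 \<union> {a, c})" for x
  proof -
    have xJ: "x \<in> J - N1" "x \<in> J - N0" "x \<in> {a<..<c}" using x sub[OF c(1)] by auto
    have "((\<lambda>x. 0) has_vector_derivative y1 x / p x) (at x)"
    proof (rule has_vector_derivative_transform_within_open[OF N1(2)[OF xJ(1)]])
      show "open {a<..<c}" by simp
      show "x \<in> {a<..<c}" by fact
      show "y t = 0" if "t \<in> {a<..<c}" for t 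
        by (rule y0) (use that sub[OF c(1)] in \<open>auto simp: subset_iff\<close>)
    qed
    then have "y1 x / p x = 0" using vector_derivative_unique_at has_vector_derivative_const by blast
    then show ?thesis using N0(3)[OF xJ(2)] by simp
  qed
  moreover have "negligible (N1 \<union> N0 \<union> {a, c})" using N1(1) N0(1) by simp
  ultimately have "sl_coefficients a {a..c} w p q \<Longrightarrow> y1 a = 0"
    using sl_coefficients.vanishes_on_initial[of a "{a..c}" w p q "\<lambda>x. q x * y x - of_real (w x) * z x" y1 "N1 \<union> N0 \<union> {a, c}" c a]
      primitive_on_subset[OF P(2) sub[OF c(1)]] c by simp
  moreover have "sl_coefficients a {a..c} w p q"
    by (rule restrict[OF c(1)])
  ultimately show False using nz y0[OF a_in] by simp
qed

end

section \<open>The resolvent for a regular or singular right endpoint\<close>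

text \<open>The right endpoint of \<open>J\<close>, regular or singular, is represented by a filter \<open>F\<close>.\<close>

locale sl_spectral = sl_basis +
  fixes F :: "real filter" and \<alpha> \<zeta>' :: complex and \<psi> \<psi>1 :: "real \<Rightarrow> complex"
  assumes F_nonbot: "F \<noteq> bot" and F_J: "eventually (\<lambda>x. x \<in> J) F"
    and F_lim: "\<And>h y. primitive_on J a h y \<Longrightarrow> integrable (lebesgue_on J) h \<Longrightarrow>
      (y \<longlongrightarrow> y a + integral\<^sup>L (lebesgue_on J) h) F"
    and f_L2: "f \<in> L2w J w" and g_L2: "g \<in> L2w J w" and psi_L2: "\<psi> \<in> L2w J w"
    and f_a: "f a = sin \<alpha>" "f1 a = - cos \<alpha>"
    and psi: "sl_system J a w p q \<psi> \<psi>1 (\<lambda>x. \<zeta>' * \<psi> x)"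
    and nondegenerate: "\<exists>c\<in>J. a < c"
begin

definition G :: "((real \<Rightarrow> complex) \<times> (real \<Rightarrow> complex)) set" where
  "G = sl_operator J a w p q \<alpha> (\<lambda>y y1. (bracket y y1 \<psi> \<psi>1 \<longlongrightarrow> 0) F)"

text \<open>By Lagrange's identity the derivative of the bracket is a multiple of \<open>w\<close>
  times a product of two square-integrable functions, hence integrable up to the end.\<close>

lemma bracket_psi_limit:
  assumes "h \<in> L2w J w" "system h h1 (\<lambda>x. \<zeta> * h x)"
  obtains D where "(bracket h h1 \<psi> \<psi>1 \<longlongrightarrow> D) F"
proof -
  have "prim (\<lambda>x. of_real (w x) * (\<zeta> * h x * \<psi> x - h x * (\<zeta>' * \<psi> x))) (bracket h h1 \<psi> \<psi>1)"
    by (rule bracket_primitive[OF assms(2) psi])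
  moreover have "(\<lambda>x. of_real (w x) * (\<zeta> * h x * \<psi> x - h x * (\<zeta>' * \<psi> x))) = (\<lambda>x. (\<zeta> - \<zeta>') * (of_real (w x) * h x * \<psi> x))"
    by (simp add: fun_eq_iff algebra_simps)
  moreover have "integrable (lebesgue_on J) (\<lambda>x. (\<zeta> - \<zeta>') * (of_real (w x) * h x * \<psi> x))"
    using L2w_product[OF assms(1) psi_L2] by (rule integrable_mult_right)
  ultimately show ?thesis using F_lim that by metis
qed

text \<open>The boundary value of [f, psi] at the right end, that is, the characteristic function at
  the parameter \<open>\<zeta>\<close>.\<close>

definition D1 where "D1 = Lim F (bracket f f1 \<psi> \<psi>1)"
definition D2 where "D2 = Lim F (bracket g g1 \<psi> \<psi>1)"

lemma D1_lim: "(bracket f f1 \<psi> \<psi>1 \<longlongrightarrow> D1) F"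
  using bracket_psi_limit[OF f_L2 f] tendsto_Lim[OF F_nonbot] unfolding D1_def by metis

lemma D2_lim: "(bracket g g1 \<psi> \<psi>1 \<longlongrightarrow> D2) F"
  using bracket_psi_limit[OF g_L2 g] tendsto_Lim[OF F_nonbot] unfolding D2_def by metis

text \<open>A Pluecker relation among brackets, obtained by expanding \<open>y\<close> in the
  basis.\<close>

lemma bracket_combination:
  assumes "x \<in> J"
  shows "bracket y y1 \<psi> \<psi>1 x = bracket y y1 g g1 x * bracket f f1 \<psi> \<psi>1 x - bracket y y1 f f1 x * bracket g g1 \<psi> \<psi>1 x"
proof -
  have "bracket y y1 \<psi> \<psi>1 x = y x * \<psi>1 x - y1 x * \<psi> x" by (simp add: bracket_def)
  also have "\<dots> = (bracket y y1 g g1 x * f x - bracket y y1 f f1 x * g x) * \<psi>1 x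
     - (bracket y y1 g g1 x * f1 x - bracket y y1 f f1 x * g1 x) * \<psi> x"
    using decompose(1)[OF assms, of y y1] decompose(2)[OF assms, of y1 y] by metis
  finally have "bracket y y1 \<psi> \<psi>1 x = (bracket y y1 g g1 x * f x - bracket y y1 f f1 x * g x) * \<psi>1 x
     - (bracket y y1 g g1 x * f1 x - bracket y y1 f f1 x * g1 x) * \<psi> x" .
  then show ?thesis by (simp add: bracket_def algebra_simps)
qed

text \<open>The limit condition becomes one linear equation for the end values of the coefficients;
  if \<open>D1\<close> is not 0, it determines \<open>ub\<close> from \<open>vb\<close>.\<close>

lemma boundary_condition_iff:
  assumes u: "(bracket y y1 g g1 \<longlongrightarrow> ub) F" and v: "(bracket y y1 f f1 \<longlongrightarrow> vb) F"
  shows "(bracket y y1 \<psi> \<psi>1 \<longlongrightarrow> 0) F \<longleftrightarrow> ub * D1 = vb * D2"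
proof -
  have "((\<lambda>x. bracket y y1 g g1 x * bracket f f1 \<psi> \<psi>1 x - bracket y y1 f f1 x * bracket g g1 \<psi> \<psi>1 x) \<longlongrightarrow> ub * D1 - vb * D2) F"
    by (intro tendsto_intros u v D1_lim D2_lim)
  moreover have "eventually (\<lambda>x. bracket y y1 g g1 x * bracket f f1 \<psi> \<psi>1 x - bracket y y1 f f1 x * bracket g g1 \<psi> \<psi>1 x
      = bracket y y1 \<psi> \<psi>1 x) F"
    using F_J by (rule eventually_mono) (rule bracket_combination[symmetric])
  ultimately have lim: "(bracket y y1 \<psi> \<psi>1 \<longlongrightarrow> ub * D1 - vb * D2) F"
    by (rule Lim_transform_eventually)
  show ?thesis
  proof
    assume "(bracket y y1 \<psi> \<psi>1 \<longlongrightarrow> 0) F"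
    from tendsto_unique[OF F_nonbot this lim] show "ub * D1 = vb * D2" by simp
  qed (use lim in simp)
qed

lemma operator_element:
  assumes "(y, z) \<in> G"
  obtains y1 where "system y y1 z" "y \<in> L2w J w" "z \<in> L2w J w" "bracket y y1 f f1 a = 0"
    "(bracket y y1 \<psi> \<psi>1 \<longlongrightarrow> 0) F"
proof -
  obtain y1 where y1: "quasi_derivative J p y y1" "AE x in lebesgue_on J. z x = sl_expr w q y y1 x"
     "cos \<alpha> * y a + sin \<alpha> * y1 a = 0" "(bracket y y1 \<psi> \<psi>1 \<longlongrightarrow> 0) F" "y \<in> L2w J w" "z \<in> L2w J w"
    using assms unfolding G_def sl_operator_def by blast
  have "system y y1 z"
    by (rule system_of_quasi_derivative[OF y1(1,2)]) (rule L2w_weight_integrable[OF y1(6)])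
  moreover have "bracket y y1 f f1 a = 0"
    using y1(3) by (simp add: bracket_def f_a algebra_simps add_eq_0_iff)
  ultimately show ?thesis using that y1 by blast
qed

lemma brackets_of_residual:
  assumes "system y y1 z"
  shows "prim (\<lambda>x. of_real (w x) * g x * (z x - \<zeta> * y x)) (bracket y y1 g g1)"
    "prim (\<lambda>x. of_real (w x) * f x * (z x - \<zeta> * y x)) (bracket y y1 f f1)"
  using bracket_primitive[OF assms g] bracket_primitive[OF assms f]
  by (simp_all add: algebra_simps)

text \<open>\<open>f\<close> meets the condition at \<open>a\<close> by its initial values and the
  one at the other end because \<open>D1 = 0\<close>; this eigenfunction destroys
  injectivity.\<close>

lemma eigenvalue: "D1 = 0 \<Longrightarrow> \<zeta> \<notin> L2w_resolvent_set J w G"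
proof
  assume D1: "D1 = 0" and r: "\<zeta> \<in> L2w_resolvent_set J w G"
  have "(f, \<lambda>x. \<zeta> * f x) \<in> G"
    unfolding G_def sl_operator_def
  proof (clarify, intro conjI exI[of _ f1])
    show "f \<in> L2w J w" by (rule f_L2)
    show "(\<lambda>x. \<zeta> * f x) \<in> L2w J w" using L2w_lincomb[OF f_L2 f_L2, of \<zeta> 0] by simp
    show "quasi_derivative J p f f1" by (rule quasi_derivative_of_system(1)[OF f])
    show "AE x in lebesgue_on J. \<zeta> * f x = sl_expr w q f f1 x"
      using quasi_derivative_of_system(2)[OF f] by (simp add: eq_commute)
    show "cos \<alpha> * f a + sin \<alpha> * f1 a = 0" by (simp add: f_a)
    show "(bracket f f1 \<psi> \<psi>1 \<longlongrightarrow> 0) F" using D1_lim D1 by simp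
  qed
  then have "AE x in lebesgue_on J. f x = 0"
    using r unfolding L2w_resolvent_set_def by fastforce
  moreover have "f a \<noteq> 0 \<or> f1 a \<noteq> 0" using wronskian_a by (auto simp: bracket_def)
  ultimately show False using solution_not_AE_zero[OF f] nondegenerate by blast
qed

text \<open>With y = u f - v g the coefficients are bounded in turn: v because v a = 0, then the end
  value of u through the boundary condition, then u everywhere. \<open>s\<close> is any positive
  bound for the norm of the residual.\<close>

lemma resolvent_estimate:
  assumes D1: "D1 \<noteq> 0"
  obtains C where "0 \<le> C" "\<And>y z s. (y, z) \<in> G \<Longrightarrow> 0 < s \<Longrightarrow> sqnorm (\<lambda>x. z x - \<zeta> * y x) \<le> s\<^sup>2 \<Longrightarrow> L2w_norm J w y \<le> C * s"
proof -
  \<comment> \<open>The first summand bounds \<open>v\<close>. The others bound \<open>u\<close>: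
    the second its end value, the third one variation of \<open>u\<close> between the end and
    \<open>a\<close> and another between \<open>a\<close> and \<open>x\<close>, hence the factor
    2.\<close>
  define A where "A = (sqnorm f + 1) + (sqnorm f + 1) * cmod (D2 / D1) + 2 * (sqnorm g + 1)"
  define C where "C = A * sqrt (2 * (sqnorm f + sqnorm g))"
  have A0: "0 \<le> A" using sqnorm_nonneg[of f] sqnorm_nonneg[of g] by (simp add: A_def)
  have "L2w_norm J w y \<le> C * s" if yz: "(y, z) \<in> G" and s: "0 < s" "sqnorm (\<lambda>x. z x - \<zeta> * y x) \<le> s\<^sup>2" for y z s
  proof -
    obtain y1 where y1: "system y y1 z" "y \<in> L2w J w" "z \<in> L2w J w" "bracket y y1 f f1 a = 0"
      "(bracket y y1 \<psi> \<psi>1 \<longlongrightarrow> 0) F" using operator_element[OF yz] by blast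
    have h: "(\<lambda>x. z x - \<zeta> * y x) \<in> L2w J w"
      using L2w_lincomb[OF y1(3,2), of 1 "- \<zeta>"] by simp
    note i = L2w_product[OF f_L2 h] L2w_product[OF g_L2 h]
    note P = brackets_of_residual[OF y1(1)]
    obtain ub vb where lim: "(bracket y y1 g g1 \<longlongrightarrow> ub) F" "(bracket y y1 f f1 \<longlongrightarrow> vb) F"
      using F_lim[OF P(1) i(2)] F_lim[OF P(2) i(1)] by blast
    have v: "cmod (bracket y y1 f f1 x) \<le> s * (sqnorm f + 1)" if "x \<in> J" for x
      using increment_norm_bound[OF P(2) i(1) that pairing_bound[OF f_L2 h s]] y1(4) by simp
    have u: "cmod (bracket y y1 g g1 x - bracket y y1 g g1 a) \<le> s * (sqnorm g + 1)" if "x \<in> J" for x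
      by (rule increment_norm_bound[OF P(1) i(2) that pairing_bound[OF g_L2 h s]])
    have "cmod vb \<le> s * (sqnorm f + 1)"
      by (rule tendsto_upperbound[OF tendsto_norm[OF lim(2)] _ F_nonbot]) (use F_J v in \<open>auto elim: eventually_mono\<close>)
    moreover have "ub = vb * (D2 / D1)"
      using y1(5) boundary_condition_iff[OF lim] D1 by (simp add: field_simps)
    ultimately have ub: "cmod ub \<le> s * (sqnorm f + 1) * cmod (D2 / D1)"
      by (simp only: norm_mult) (intro mult_right_mono norm_ge_zero)
    have ua: "cmod (ub - bracket y y1 g g1 a) \<le> s * (sqnorm g + 1)"
      by (rule tendsto_upperbound[OF tendsto_norm[OF tendsto_diff[OF lim(1) tendsto_const]] _ F_nonbot])
        (use F_J u in \<open>auto elim: eventually_mono\<close>)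
    have ux: "cmod (bracket y y1 g g1 x) \<le> s * A" if x: "x \<in> J" for x
    proof -
      have "cmod (bracket y y1 g g1 x) \<le> cmod (bracket y y1 g g1 x - bracket y y1 g g1 a)
         + cmod (ub - bracket y y1 g g1 a) + cmod ub"
        by (smt (verit) norm_minus_commute norm_triangle_ineq2 norm_triangle_sub)
      also have "\<dots> \<le> s * (sqnorm g + 1) + s * (sqnorm g + 1) + s * (sqnorm f + 1) * cmod (D2 / D1)"
        using u[OF x] ua ub by linarith
      also have "\<dots> \<le> s * A"
        using s(1) sqnorm_nonneg[of f] by (simp add: A_def algebra_simps)
      finally show ?thesis .
    qed
    have vx: "cmod (bracket y y1 f f1 x) \<le> s * A" if x: "x \<in> J" for x
    proof -
      have "sqnorm f + 1 \<le> A"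
        using sqnorm_nonneg[of f] sqnorm_nonneg[of g] by (simp add: A_def)
      then show ?thesis using v[OF x] s(1) mult_left_mono[of "sqnorm f + 1" A s] by linarith
    qed
    have "cmod (y x) \<le> (s * A) * (cmod (f x) + cmod (g x))" if x: "x \<in> J" for x
    proof -
      have "cmod (y x) \<le> cmod (bracket y y1 g g1 x) * cmod (f x) + cmod (bracket y y1 f f1 x) * cmod (g x)"
        using decompose(1)[OF x, of y y1] by (metis norm_mult norm_triangle_ineq4)
      also have "\<dots> \<le> (s * A) * cmod (f x) + (s * A) * cmod (g x)"
        using ux[OF x] vx[OF x] by (intro add_mono mult_right_mono) auto
      finally show ?thesis by (simp add: algebra_simps)
    qed
    then have "AE x in lebesgue_on J. cmod (y x) \<le> (s * A) * (cmod (f x) + cmod (g x))"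
      by (intro AE_I2) simp
    from L2w_dominated(2)[OF f_L2 g_L2 L2w_measurable[OF y1(2)] this]
    have "sqnorm y \<le> 2 * (s * A)\<^sup>2 * (sqnorm f + sqnorm g)" .
    then have "sqrt (sqnorm y) \<le> sqrt ((s * A)\<^sup>2 * (2 * (sqnorm f + sqnorm g)))"
      by (simp add: algebra_simps)
    also have "\<dots> = C * s" using s(1) A0 by (simp add: C_def real_sqrt_mult)
    finally show ?thesis by (simp add: L2w_norm_eq)
  qed
  moreover have "0 \<le> C" using A0 sqnorm_nonneg[of f] sqnorm_nonneg[of g] by (simp add: C_def)
  ultimately show ?thesis using that by blast
qed

text \<open>Variation of constants with v a = 0 meets the condition at \<open>a\<close>; the free
  constant in \<open>u\<close> is left to meet the condition at the other end.\<close>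

lemma resolvent_surjective:
  assumes D1: "D1 \<noteq> 0" and h: "h \<in> L2w J w"
  shows "\<exists>(y, z)\<in>G. AE x in lebesgue_on J. z x - \<zeta> * y x = h x"
proof -
  define Hf where "Hf = (\<lambda>x. complex_of_real (w x) * f x * h x)"
  define Hg where "Hg = (\<lambda>x. complex_of_real (w x) * g x * h x)"
  have i: "integrable (lebesgue_on J) Hf" "integrable (lebesgue_on J) Hg"
    using L2w_product[OF f_L2 h] L2w_product[OF g_L2 h] by (simp_all add: Hf_def Hg_def)
  \<comment> \<open>Solves (c + int Hg) D1 = (int Hf) D2, which is the boundary condition in terms
    of the end values of the two brackets.\<close>
  define c where "c = (integral\<^sup>L (lebesgue_on J) Hf) * D2 / D1 - integral\<^sup>L (lebesgue_on J) Hg"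
  define u where "u = (\<lambda>x. c + integral {a..x} Hg)"
  define v where "v = (\<lambda>x. - (0 + integral {a..x} Hf))"
  have pu: "prim Hg u" unfolding u_def by (rule primitive_on_integral[OF J integrable_on_initial[OF i(2)]])
  have pf: "prim Hf (\<lambda>x. 0 + integral {a..x} Hf)" by (rule primitive_on_integral[OF J integrable_on_initial[OF i(1)]])
  then have pv: "prim (\<lambda>x. - Hf x) v" unfolding v_def using primitive_on_cmult[of J a Hf _ "-1"] by fastforce
  define y where "y = (\<lambda>x. u x * f x + v x * g x)"
  define y1 where "y1 = (\<lambda>x. u x * f1 x + v x * g1 x)"
  define z where "z = (\<lambda>x. h x + \<zeta> * y x)"
  have sys: "system y y1 z"
    unfolding y_def y1_def z_def using pu pv unfolding Hf_def Hg_def by (rule variation_of_constants)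
  have va: "v a = 0" and ua: "u a = c" by (simp_all add: v_def u_def)
  have bu: "bracket y y1 g g1 x = u x" and bv: "bracket y y1 f f1 x = - v x" if "x \<in> J" for x
  proof -
    have "bracket y y1 g g1 x = u x * bracket f f1 g g1 x" "bracket y y1 f f1 x = - v x * bracket f f1 g g1 x"
      by (simp_all add: bracket_def y_def y1_def algebra_simps)
    then show "bracket y y1 g g1 x = u x" "bracket y y1 f f1 x = - v x" using wronskian[OF that] by simp_all
  qed
  define B where "B = integral\<^sup>L (lebesgue_on J) (\<lambda>t. cmod (Hf t)) + (integral\<^sup>L (lebesgue_on J) (\<lambda>t. cmod (Hg t)) + cmod c)"
  have B: "cmod (u x) \<le> B" "cmod (v x) \<le> B" if "x \<in> J" for x
  proof -
    have n: "0 \<le> integral\<^sup>L (lebesgue_on J) (\<lambda>t. cmod (Hf t))" "0 \<le> integral\<^sup>L (lebesgue_on J) (\<lambda>t. cmod (Hg t))"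
      by simp_all
    have "cmod (u x - c) \<le> integral\<^sup>L (lebesgue_on J) (\<lambda>t. cmod (Hg t))"
      using increment_norm_bound[OF pu i(2) that order.refl] ua by simp
    then show "cmod (u x) \<le> B" using n norm_triangle_sub[of "u x" c] unfolding B_def by linarith
    have "cmod (v x) \<le> integral\<^sup>L (lebesgue_on J) (\<lambda>t. cmod (Hf t))"
      using increment_norm_bound[OF pf i(1) that order.refl] by (simp add: v_def)
    then show "cmod (v x) \<le> B" using n norm_ge_zero[of c] unfolding B_def by linarith
  qed
  have yL2: "y \<in> L2w J w"
  proof (rule L2w_dominated(1)[OF f_L2 g_L2])
    show "y \<in> borel_measurable (lebesgue_on J)" by (rule measurableI[OF system_continuous(1)[OF sys]])
    have "cmod (y x) \<le> B * (cmod (f x) + cmod (g x))" if "x \<in> J" for x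
    proof -
      have "cmod (y x) \<le> cmod (u x) * cmod (f x) + cmod (v x) * cmod (g x)"
        unfolding y_def by (metis norm_mult norm_triangle_ineq)
      also have "\<dots> \<le> B * cmod (f x) + B * cmod (g x)"
        using B[OF that] by (intro add_mono mult_right_mono) auto
      finally show ?thesis by (simp add: algebra_simps)
    qed
    then show "AE x in lebesgue_on J. cmod (y x) \<le> B * (cmod (f x) + cmod (g x))"
      by (intro AE_I2) simp
  qed
  have zL2: "z \<in> L2w J w" using L2w_lincomb[OF h yL2, of 1 \<zeta>] by (simp add: z_def)
  have "(y, z) \<in> G" unfolding G_def sl_operator_def
  proof (clarify, intro conjI exI[of _ y1])
    show "y \<in> L2w J w" "z \<in> L2w J w" by (fact yL2 zL2)+
    show "quasi_derivative J p y y1" by (rule quasi_derivative_of_system(1)[OF sys])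
    show "AE x in lebesgue_on J. z x = sl_expr w q y y1 x"
      using quasi_derivative_of_system(2)[OF sys] by (simp add: eq_commute)
    show "cos \<alpha> * y a + sin \<alpha> * y1 a = 0"
      unfolding y_def y1_def va by (simp add: f_a)
    have "(u \<longlongrightarrow> u a + integral\<^sup>L (lebesgue_on J) Hg) F" by (rule F_lim[OF pu i(2)])
    moreover have "eventually (\<lambda>x. u x = bracket y y1 g g1 x) F"
      using F_J by (rule eventually_mono) (simp add: bu)
    ultimately have lu: "(bracket y y1 g g1 \<longlongrightarrow> u a + integral\<^sup>L (lebesgue_on J) Hg) F"
      by (rule Lim_transform_eventually)
    have "((\<lambda>x. 0 + integral {a..x} Hf) \<longlongrightarrow> 0 + integral {a..a} Hf + integral\<^sup>L (lebesgue_on J) Hf) F"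
      by (rule F_lim[OF pf i(1)])
    moreover have "eventually (\<lambda>x. 0 + integral {a..x} Hf = bracket y y1 f f1 x) F"
      using F_J by (rule eventually_mono) (simp add: bv v_def)
    ultimately have lv: "(bracket y y1 f f1 \<longlongrightarrow> 0 + integral {a..a} Hf + integral\<^sup>L (lebesgue_on J) Hf) F"
      by (rule Lim_transform_eventually)
    show "(bracket y y1 \<psi> \<psi>1 \<longlongrightarrow> 0) F"
      using boundary_condition_iff[OF lu lv] D1 by (simp add: ua c_def)
  qed
  moreover have "z x - \<zeta> * y x = h x" for x by (simp add: z_def)
  ultimately show ?thesis by (intro bexI[of _ "(y, z)"]) auto
qed

text \<open>An alternative: either \<open>D1 = 0\<close> and there is an eigenfunction, or the
  inverse is everywhere defined and bounded. The spectrum thus consists of eigenvalues.\<close>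

lemma spectrum_iff: "\<zeta> \<in> L2w_spectrum J w G \<longleftrightarrow> (bracket f f1 \<psi> \<psi>1 \<longlongrightarrow> 0) F"
proof -
  have "\<zeta> \<in> L2w_resolvent_set J w G" if D1: "D1 \<noteq> 0"
  proof -
    obtain C where C: "0 \<le> C" "\<And>y z s. (y, z) \<in> G \<Longrightarrow> 0 < s \<Longrightarrow> sqnorm (\<lambda>x. z x - \<zeta> * y x) \<le> s\<^sup>2 \<Longrightarrow> L2w_norm J w y \<le> C * s"
      using resolvent_estimate[OF D1] by blast
    have est: "L2w_norm J w y \<le> C * L2w_norm J w (\<lambda>x. z x - \<zeta> * y x)" if yz: "(y, z) \<in> G" for y z
    proof (rule field_le_epsilon)
      fix e :: real assume e: "e > 0"
      define n where "n = L2w_norm J w (\<lambda>x. z x - \<zeta> * y x)"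
      \<comment> \<open>The estimate asks for a strictly positive bound, so the norm is enlarged a
        little; the excess \<open>C * e / (C + 1)\<close> is absorbed in \<open>e\<close>.\<close>
      define s where "s = n + e / (C + 1)"
      have n: "0 \<le> n" "sqnorm (\<lambda>x. z x - \<zeta> * y x) = n\<^sup>2"
        by (simp_all add: n_def L2w_norm_eq sqnorm_nonneg)
      have s: "n \<le> s" "0 < s" using e C(1) n by (auto simp: s_def intro!: add_nonneg_pos divide_pos_pos)
      have "n\<^sup>2 \<le> s\<^sup>2" using s n by (intro power_mono) auto
      then have "L2w_norm J w y \<le> C * s" using C(2)[OF yz s(2)] n(2) by simp
      also have "\<dots> \<le> C * n + e" using e C(1) by (simp add: s_def field_simps)
      finally show "L2w_norm J w y \<le> C * L2w_norm J w (\<lambda>x. z x - \<zeta> * y x) + e" by (simp add: n_def)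
    qed
    have inj: "AE x in lebesgue_on J. y x = 0" if yz: "(y, z) \<in> G" and 0: "AE x in lebesgue_on J. z x - \<zeta> * y x = 0" for y z
    proof -
      have "L2w_norm J w (\<lambda>x. z x - \<zeta> * y x) = 0"
      proof -
        have "AE x in lebesgue_on J. (cmod (z x - \<zeta> * y x))\<^sup>2 * w x = 0"
          using 0 by eventually_elim simp
        then have "integral\<^sup>L (lebesgue_on J) (\<lambda>x. (cmod (z x - \<zeta> * y x))\<^sup>2 * w x) = 0"
          by (rule integral_eq_zero_AE)
        then show ?thesis by (simp add: L2w_norm_def)
      qed
      then have "sqnorm y \<le> 0" using est[OF yz] by (simp add: L2w_norm_eq)
      then have "sqnorm y = 0" using sqnorm_nonneg[of y] by simp
      moreover have yL2: "y \<in> L2w J w" using operator_element[OF yz] by blast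
      moreover have "AE x in lebesgue_on J. 0 \<le> (cmod (y x))\<^sup>2 * w x"
        using weight_AE_nonneg by eventually_elim simp
      ultimately have "AE x in lebesgue_on J. (cmod (y x))\<^sup>2 * w x = 0"
        using integral_nonneg_eq_0_iff_AE[OF L2w_integrable[OF yL2]] unfolding sqnorm_def by blast
      then show ?thesis using w_pos by eventually_elim simp
    qed
    show ?thesis unfolding L2w_resolvent_set_def
      using est inj resolvent_surjective[OF D1] by blast
  qed
  then have "\<zeta> \<in> L2w_spectrum J w G \<longleftrightarrow> D1 = 0"
    using eigenvalue unfolding L2w_spectrum_def by blast
  also have "\<dots> \<longleftrightarrow> (bracket f f1 \<psi> \<psi>1 \<longlongrightarrow> 0) F"
  proof
    show "(bracket f f1 \<psi> \<psi>1 \<longlongrightarrow> 0) F" if "D1 = 0" using D1_lim that by simp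
    show "D1 = 0" if "(bracket f f1 \<psi> \<psi>1 \<longlongrightarrow> 0) F" by (rule tendsto_unique[OF F_nonbot D1_lim that])
  qed
  finally show ?thesis .
qed

end

section \<open>Entire functions of order at most one half\<close>

text \<open>Borel-Caratheodory turns the one-sided bound on the real part into growth of order sqrt
  |z| for |g|, and Cauchy's inequality on large circles then kills the derivative.\<close>

lemma entire_real_part_sublinear_constant:
  fixes g :: "complex \<Rightarrow> complex"
  assumes g: "g holomorphic_on UNIV" and AB: "0 \<le> A" "0 \<le> B"
    and le: "\<And>z. Re (g z) \<le> A + B * sqrt (cmod z)"
  shows "g z = g 0"
proof -
  have growth: "cmod (g x - g 0) \<le> 2 * (A + B * sqrt R + cmod (g 0) + 1)" if R: "R > 0" "cmod x \<le> R / 2" for R x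
  proof -
    define M where "M = A + B * sqrt R + cmod (g 0) + 1"
    have M: "M > 0" using AB R by (auto simp: M_def intro!: add_nonneg_pos add_nonneg_nonneg)
    define h where "h = (\<lambda>z. g (of_real R * z) - g 0)"
    \<comment> \<open>The Moebius map z / (2 M - z) takes the half-plane Re z < M into the unit disc
      and fixes 0, so that Schwarz' lemma applies.\<close>
    define k where "k = (\<lambda>z. h z / (of_real (2 * M) - h z))"
    have h: "Re (h z) < M" if "cmod z < 1" for z
    proof -
      have "Re (h z) \<le> A + B * sqrt (cmod (of_real R * z)) + cmod (g 0)"
        using le[of "of_real R * z"] complex_Re_le_cmod[of "- g 0"] by (simp add: h_def)
      also have "sqrt (cmod (of_real R * z)) \<le> sqrt R"
        using R that by (simp add: norm_mult mult_left_le)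
      finally show ?thesis using AB by (simp add: M_def mult_left_mono)
    qed
    have lt: "cmod (h z) < cmod (of_real (2 * M) - h z)" if "cmod z < 1" for z
    proof -
      have "(cmod (of_real (2 * M) - h z))\<^sup>2 - (cmod (h z))\<^sup>2 = 4 * M * (M - Re (h z))"
        by (simp only: cmod_power2) (simp add: power2_eq_square algebra_simps)
      also have "\<dots> > 0" using h[OF that] M by simp
      finally show ?thesis by (simp add: power2_less_imp_less)
    qed
    have hh: "h holomorphic_on ball 0 1" unfolding h_def
      using holomorphic_on_compose_gen[of "\<lambda>z. of_real R * z" "ball 0 1" g UNIV, unfolded o_def] g
      by (auto intro!: holomorphic_intros)
    have nz: "of_real (2 * M) - h z \<noteq> 0" if "cmod z < 1" for z
      using lt[OF that] by auto
    have "k holomorphic_on ball 0 1" unfolding k_def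
      using nz by (intro holomorphic_intros hh) auto
    moreover have "k 0 = 0" by (simp add: k_def h_def)
    moreover have "cmod (k z) < 1" if "cmod z < 1" for z
    proof -
      have "0 < cmod (of_real (2 * M) - h z)" using nz[OF that] by simp
      with lt[OF that] show ?thesis by (simp only: k_def norm_divide divide_less_eq_1_pos)
    qed
    ultimately have S: "cmod (k z) \<le> cmod z" if "cmod z < 1" for z
      using Schwarz_Lemma'[of k] that by blast
    define z where "z = x / of_real R"
    \<comment> \<open>At half the radius |k| \<le> 1/2, which unwinds to |h| \<le> 2 M.\<close>
    have z: "cmod z \<le> 1 / 2" using R by (simp add: z_def norm_divide field_simps)
    have "cmod (h z) / cmod (of_real (2 * M) - h z) \<le> 1 / 2"
      using S[of z] z unfolding k_def norm_divide by linarith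
    moreover have "cmod (of_real (2 * M) - h z) > 0" using nz[of z] z by simp
    ultimately have "2 * cmod (h z) \<le> cmod (of_real (2 * M) - h z)" by (simp add: field_simps)
    also have "\<dots> \<le> 2 * M + cmod (h z)" using norm_triangle_ineq4[of "of_real (2 * M)" "h z"] M by simp
    finally have "cmod (h z) \<le> 2 * M" by simp
    moreover have "h z = g x - g 0" using R by (simp add: h_def z_def)
    ultimately show ?thesis by (simp add: M_def)
  qed
  have "deriv g \<xi> = 0" for \<xi>
  proof (rule ccontr)
    assume "deriv g \<xi> \<noteq> 0"
    then have d: "cmod (deriv g \<xi>) > 0" by simp
    define L where "L = 3 * cmod (g 0) + 2 * A + 2 * B * sqrt (2 * cmod \<xi>) + 4 * B + 2"
    have L: "L > 0" using AB by (auto simp: L_def intro!: add_nonneg_pos add_nonneg_nonneg)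
    \<comment> \<open>On circles of radius t^2 the square-root growth becomes the linear bound
      \<open>L * t\<close>, so Cauchy's inequality yields \<open>L / t\<close>.\<close>
    have bd: "cmod (deriv g \<xi>) \<le> L / t" if t: "t \<ge> 1" for t :: real
    proof -
      have t0: "t > 0" using t by simp
      have bound: "cmod (g x) \<le> L * t" if x: "cmod (\<xi> - x) = t\<^sup>2" for x
      proof -
        define R where "R = 2 * (cmod \<xi> + t\<^sup>2)"
        have R: "R > 0" using t0 by (simp add: R_def add_nonneg_pos)
        have "cmod x \<le> cmod \<xi> + t\<^sup>2" using x norm_triangle_ineq2[of x \<xi>] by (simp add: norm_minus_commute)
        then have "cmod (g x - g 0) \<le> 2 * (A + B * sqrt R + cmod (g 0) + 1)"
          by (intro growth R) (simp add: R_def)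
        moreover have "sqrt R \<le> sqrt (2 * cmod \<xi>) + 2 * t"
        proof -
          have "sqrt R \<le> sqrt (2 * cmod \<xi>) + sqrt (2 * t\<^sup>2)"
            unfolding R_def distrib_left by (rule sqrt_add_le_add_sqrt) auto
          also have "sqrt (2 * t\<^sup>2) \<le> 2 * t"
            using t0 by (intro real_le_lsqrt) (auto simp: power_mult_distrib)
          finally show ?thesis by simp
        qed
        then have "B * sqrt R \<le> B * (sqrt (2 * cmod \<xi>) + 2 * t)" using AB by (intro mult_left_mono) auto
        moreover have "cmod (g x) \<le> cmod (g 0) + cmod (g x - g 0)" by (rule norm_triangle_sub)
        ultimately have "cmod (g x) \<le> (3 * cmod (g 0) + 2 * A + 2 * B * sqrt (2 * cmod \<xi>) + 2) + 4 * B * t"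
          by (simp add: algebra_simps)
        moreover have "(3 * cmod (g 0) + 2 * A + 2 * B * sqrt (2 * cmod \<xi>) + 2) * 1 \<le> (3 * cmod (g 0) + 2 * A + 2 * B * sqrt (2 * cmod \<xi>) + 2) * t"
          using t AB by (intro mult_left_mono) (auto intro!: add_nonneg_nonneg)
        ultimately show ?thesis by (simp add: L_def algebra_simps)
      qed
      have "norm ((deriv ^^ 1) g \<xi>) \<le> fact 1 * (L * t) / (t\<^sup>2) ^ 1"
        using t0 bound by (intro Cauchy_inequality holomorphic_on_subset[OF g] holomorphic_on_imp_continuous_on) auto
      then show ?thesis using t0 by (simp add: power2_eq_square field_simps)
    qed
    define t where "t = max 1 (2 * L / cmod (deriv g \<xi>))"
    have "L / t \<le> cmod (deriv g \<xi>) / 2"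
      using d L by (simp add: t_def field_simps max_def)
    moreover have "t \<ge> 1" by (simp add: t_def)
    ultimately show False using bd[of t] d by linarith
  qed
  then have "(g has_field_derivative 0) (at x)" for x
    using holomorphic_derivI[OF g open_UNIV, of x] by simp
  then obtain c where "\<And>x. g x = c"
    using has_field_derivative_zero_constant[of UNIV g] by auto
  then show ?thesis by simp
qed

text \<open>A zero-free entire function is an exponential exp g, and a growth bound for it is a
  bound from above for Re g. This is the zero-free case of Hadamard's factorization at order at most
  1/2.\<close>

lemma nonvanishing_order_half_constant:
  fixes D :: "complex \<Rightarrow> complex"
  assumes D: "D holomorphic_on UNIV" and nz: "\<And>z. D z \<noteq> 0" and AB: "0 \<le> A" "0 \<le> B"
    and le: "\<And>z. cmod (D z) \<le> exp (A + B * sqrt (cmod z))"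
  shows "D z = D 0"
proof -
  obtain g where g: "g holomorphic_on UNIV" "\<And>z. D z = exp (g z)"
    using contractible_imp_holomorphic_log[OF D contractible_UNIV] nz by auto
  have "Re (g z) \<le> A + B * sqrt (cmod z)" for z
    using le[of z] by (simp add: g(2) norm_exp_eq_Re)
  then have "g z = g 0" by (rule entire_real_part_sublinear_constant[OF g(1) AB])
  then show ?thesis by (simp add: g(2))
qed

section \<open>A Phragmen-Lindelof theorem\<close>

text \<open>The condition on \<open>Re z\<close> says |arg z| \<le> 2 pi / 3. The power 3/5 shrinks
  this to 2 pi / 5 < pi / 2, so the real part is comparable to |z|^(3/5).\<close>

lemma Re_Ln_power_ge:
  fixes z :: complex
  assumes z: "z \<noteq> 0" "Re z \<ge> - cmod z / 2"
  shows "Re (exp (3/5 * Ln z)) \<ge> cos (2 * pi / 5) * exp (3/5 * ln (cmod z))"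
proof -
  have "Re z = cmod z * cos (Im (Ln z))"
    using z(1) exp_Ln[OF z(1)] Re_exp[of "Ln z"] by (simp add: norm_exp_eq_Re[symmetric])
  then have "cmod z * (- 1 / 2) \<le> cmod z * cos (Im (Ln z))" using z(2) by simp
  then have c: "cos (Im (Ln z)) \<ge> - 1 / 2"
    by (rule mult_left_le_imp_le) (use z(1) in simp)
  have im: "\<bar>Im (Ln z)\<bar> \<le> pi" using mpi_less_Im_Ln[OF z(1)] Im_Ln_le_pi[OF z(1)] by simp
  have a: "\<bar>Im (Ln z)\<bar> \<le> 2 * pi / 3"
  proof (rule ccontr)
    assume "\<not> ?thesis"
    then have "cos \<bar>Im (Ln z)\<bar> < cos (2 * pi / 3)"
      using im by (intro cos_monotone_0_pi) auto
    also have "cos (2 * pi / 3) = - 1 / 2"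
      using cos_120 by simp
    finally show False using c by simp
  qed
  have "cos (2 * pi / 5) \<le> cos \<bar>3/5 * Im (Ln z)\<bar>"
    using a by (intro cos_monotone_0_pi_le) auto
  then have "cos (2 * pi / 5) \<le> cos (3/5 * Im (Ln z))" by (simp only: cos_abs_real)
  moreover have "Re (exp (3/5 * Ln z)) = exp (3/5 * ln (cmod z)) * cos (3/5 * Im (Ln z))"
    using z(1) by (simp add: Re_exp)
  ultimately show ?thesis by (simp add: mult.commute)
qed

text \<open>A Phragmen-Lindelof argument in the sector \<open>Re z > - |z| / 2\<close> of opening \<open>4 \<pi> / 3\<close>, with
  the damping factor \<open>exp (- \<epsilon> z^(3/5))\<close>: the exponent lies between the order \<open>1/2\<close> of \<open>F\<close> and
  the critical exponent \<open>3/4\<close> of the sector.\<close>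

lemma order_half_bounded_in_sector_constant:
  fixes F :: "complex \<Rightarrow> complex"
  assumes F: "F holomorphic_on UNIV" and AB: "0 \<le> A" "0 \<le> B"
    and le: "\<And>z. cmod (F z) \<le> exp (A + B * sqrt (cmod z))"
    and sector: "\<And>z. Re z \<le> - cmod z / 2 \<Longrightarrow> cmod (F z) \<le> M"
  shows "F z = F 0"
proof -
  \<comment> \<open>Covers the pieces of the boundary: the rays by \<open>M\<close>, the far arc by
    1, the unit circle by \<open>exp (A + B)\<close>.\<close>
  define M' where "M' = max (max M 1) (exp (A + B))"
  have M': "M' \<ge> M" "M' \<ge> 1" "M' \<ge> exp (A + B)" by (auto simp: M'_def)
  define c where "c = cos (2 * pi / 5)"
  have c: "c > 0" unfolding c_def by (intro cos_gt_zero) auto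
  have bounded: "cmod (F z0) \<le> M'" for z0
  proof (cases "cmod z0 \<le> 1 \<or> Re z0 \<le> - cmod z0 / 2")
    case True
    then show ?thesis
    proof
      assume "cmod z0 \<le> 1"
      then have "A + B * sqrt (cmod z0) \<le> A + B" using AB by (simp add: mult_left_le)
      then have "exp (A + B * sqrt (cmod z0)) \<le> exp (A + B)" by simp
      then show ?thesis using le[of z0] M'(3) by linarith
    qed (use sector[of z0] M'(1) in linarith)
  next
    case False
    have damped: "cmod (F z0 * exp (- (of_real e * exp (3/5 * Ln z0)))) \<le> M'" if e: "e > 0" for e :: real
    proof -
      \<comment> \<open>The outer radius is exp (10 s): there |z|^(1/2) = exp (5 s) and |z|^(3/5) =
        exp (6 s), and the surplus factor exp s beats (A + B) / (e c).\<close>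
      obtain s where s: "s \<ge> 0" "exp s \<ge> (A + B) / (e * c)" "exp (10 * s) > cmod z0"
      proof -
        define s where "s = max 0 (max ((A + B) / (e * c)) (cmod z0))"
        have "(A + B) / (e * c) \<le> s" "cmod z0 \<le> s" "0 \<le> s" by (auto simp: s_def)
        moreover have "1 + s \<le> exp s" "1 + 10 * s \<le> exp (10 * s)" by (rule exp_ge_add_one_self)+
        ultimately show ?thesis by (intro that[of s]) linarith+
      qed
      define R where "R = exp (10 * s)"
      \<comment> \<open>The unit disc is cut out to keep the branch point of the logarithm away from
        the closure; points in that disc are covered by the growth bound.\<close>
      define S where "S = {z. 1 < cmod z \<and> cmod z < R \<and> Re z > - cmod z / 2}"
      define H where "H = (\<lambda>z. F z * exp (- (of_real e * exp (3/5 * Ln z))))"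
      have "S = {z. 1 < cmod z} \<inter> {z. cmod z < R} \<inter> {z. - cmod z / 2 < Re z}" by (auto simp: S_def)
      also have "open \<dots>" by (intro open_Int open_Collect_less continuous_intros) simp_all
      finally have opS: "open S" .
      have "closed ({z. 1 \<le> cmod z} \<inter> {z. cmod z \<le> R} \<inter> {z. - cmod z / 2 \<le> Re z})"
        by (intro closed_Int closed_Collect_le continuous_intros) simp_all
      moreover have "S \<subseteq> {z. 1 \<le> cmod z} \<inter> {z. cmod z \<le> R} \<inter> {z. - cmod z / 2 \<le> Re z}"
        by (auto simp: S_def)
      ultimately have cl: "closure S \<subseteq> {z. 1 \<le> cmod z} \<inter> {z. cmod z \<le> R} \<inter> {z. - cmod z / 2 \<le> Re z}"
        by (rule closure_minimal[rotated])
      have nonpos: "z \<notin> \<real>\<^sub>\<le>\<^sub>0" if "1 \<le> cmod z" "- cmod z / 2 \<le> Re z" for z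
        using that by (auto simp: complex_nonpos_Reals_iff cmod_def)
      have Hh: "H holomorphic_on closure S" unfolding H_def
        using cl nonpos by (intro holomorphic_intros holomorphic_on_subset[OF F]) auto
      have Hle: "cmod (H z) \<le> cmod (F z) * exp (- (e * (c * exp (3/5 * ln (cmod z)))))"
        if "1 \<le> cmod z" "- cmod z / 2 \<le> Re z" for z
      proof -
        have "c * exp (3/5 * ln (cmod z)) \<le> Re (exp (3/5 * Ln z))"
          unfolding c_def using that by (intro Re_Ln_power_ge) auto
        then have "e * (c * exp (3/5 * ln (cmod z))) \<le> e * Re (exp (3/5 * Ln z))"
          using e by (intro mult_left_mono) auto
        then have "exp (- (e * Re (exp (3/5 * Ln z)))) \<le> exp (- (e * (c * exp (3/5 * ln (cmod z)))))" by simp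
        moreover have "cmod (H z) = cmod (F z) * exp (- (e * Re (exp (3/5 * Ln z))))"
          by (simp add: H_def norm_mult norm_exp_eq_Re)
        ultimately show ?thesis by (simp add: mult_left_mono)
      qed
      have Hle1: "cmod (H z) \<le> cmod (F z)" if "1 \<le> cmod z" "- cmod z / 2 \<le> Re z" for z
      proof -
        have "exp (- (e * (c * exp (3/5 * ln (cmod z))))) \<le> 1" using e c by simp
        then have "cmod (F z) * exp (- (e * (c * exp (3/5 * ln (cmod z))))) \<le> cmod (F z) * 1"
          by (intro mult_left_mono) auto
        with Hle[OF that] show ?thesis by simp
      qed
      have "cmod (H z0) \<le> M'"
      proof (rule maximum_modulus_frontier[of H S])
        show "H holomorphic_on interior S"
          using Hh by (rule holomorphic_on_subset) (meson closure_subset interior_subset order.trans)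
        show "continuous_on (closure S) H" using Hh by (rule holomorphic_on_imp_continuous_on)
        show "bounded S" by (rule bounded_subset[OF bounded_ball[of 0 R]]) (auto simp: S_def)
        show "z0 \<in> S" using False s(3) by (auto simp: S_def R_def)
        fix z assume "z \<in> frontier S"
        then have "z \<in> closure S" "z \<notin> S" using opS by (auto simp: frontier_def interior_open)
        then have z: "1 \<le> cmod z" "cmod z \<le> R" "- cmod z / 2 \<le> Re z"
            "cmod z = 1 \<or> cmod z = R \<or> Re z = - cmod z / 2"
          using cl by (auto simp: S_def)
        from z(4) show "cmod (H z) \<le> M'"
        proof (elim disjE)
          assume "cmod z = 1"
          then have "cmod (F z) \<le> exp (A + B)" using le[of z] by simp
          then show ?thesis using Hle1[OF z(1,3)] M'(3) by linarith
        next
          assume "Re z = - cmod z / 2"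
          then show ?thesis using sector[of z] Hle1[OF z(1,3)] M'(1) by linarith
        next
          assume zR: "cmod z = R"
          have r: "sqrt (cmod z) = exp (5 * s)" "exp (3/5 * ln (cmod z)) = exp (5 * s) * exp s"
          proof -
            have "R = (exp (5 * s))\<^sup>2" by (simp add: R_def power2_eq_square flip: exp_add)
            then show "sqrt (cmod z) = exp (5 * s)" by (simp add: zR)
            show "exp (3/5 * ln (cmod z)) = exp (5 * s) * exp s" by (simp add: zR R_def flip: exp_add)
          qed
          have "A + B * exp (5 * s) \<le> (A + B) * exp (5 * s)"
            using AB s(1) mult_left_mono[of 1 "exp (5 * s)" A] by (simp add: algebra_simps)
          also have "\<dots> \<le> (e * c * exp s) * exp (5 * s)"
            using s(2) e c by (intro mult_right_mono) (auto simp: field_simps)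
          finally have small: "A + B * sqrt (cmod z) \<le> e * (c * exp (3/5 * ln (cmod z)))"
            unfolding r by (simp only: mult_ac)
          have "cmod (H z) \<le> exp (A + B * sqrt (cmod z)) * exp (- (e * (c * exp (3/5 * ln (cmod z)))))"
            using Hle[OF z(1,3)] mult_right_mono[OF le[of z]] by (meson exp_ge_zero order.trans)
          also have "\<dots> = exp (A + B * sqrt (cmod z) - e * (c * exp (3/5 * ln (cmod z))))"
            by (simp flip: exp_add)
          also have "\<dots> \<le> 1" using small by simp
          finally show ?thesis using M'(2) by linarith
        qed
      qed
      then show ?thesis by (simp add: H_def)
    qed
    \<comment> \<open>The bound \<open>M'\<close> does not depend on the damping parameter, which
      now tends to 0.\<close>
    have "((\<lambda>e. cmod (F z0 * exp (- (of_real e * exp (3/5 * Ln z0))))) \<longlongrightarrow> cmod (F z0 * exp (- (of_real 0 * exp (3/5 * Ln z0))))) (at_right (0::real))"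
      by (intro tendsto_intros)
    then have lim: "((\<lambda>e. cmod (F z0 * exp (- (of_real e * exp (3/5 * Ln z0))))) \<longlongrightarrow> cmod (F z0)) (at_right (0::real))"
      by simp
    show ?thesis
    proof (rule tendsto_upperbound[OF lim])
      show "eventually (\<lambda>e. cmod (F z0 * exp (- (of_real e * exp (3/5 * Ln z0)))) \<le> M') (at_right (0::real))"
        unfolding eventually_at_right_field by (intro exI[of _ 1] conjI allI impI zero_less_one damped)
    qed simp
  qed
  have "bounded (range F)" using bounded unfolding bounded_iff by auto
  then have "F constant_on UNIV" by (rule Liouville_theorem[OF F])
  then show ?thesis unfolding constant_on_def by (metis UNIV_I)
qed

section \<open>The energy inequality and zeros of the characteristic function\<close>

lemma primitive_on_of_real:
  fixes k :: "real \<Rightarrow> real"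
  assumes "\<And>x. x \<in> J \<Longrightarrow> (\<lambda>t. complex_of_real (k t)) absolutely_integrable_on {a..x}"
  shows "primitive_on J a (\<lambda>t. complex_of_real (k t)) (\<lambda>x. complex_of_real (integral {a..x} k))"
  unfolding primitive_on_def
proof (intro ballI conjI assms)
  fix x assume x: "x \<in> J"
  have "(\<lambda>t. Re (complex_of_real (k t))) integrable_on {a..x}"
    using integrable_linear[OF set_lebesgue_integral_eq_integral(1)[OF assms[OF x]] bounded_linear_Re] by (simp add: o_def)
  then have "k integrable_on {a..x}" by simp
  from integral_linear[OF this bounded_linear_of_real[where 'a=complex]]
  show "complex_of_real (integral {a..x} k) = complex_of_real (integral {a..a} k) + integral {a..x} (\<lambda>t. complex_of_real (k t))"
    by (simp add: o_def)
qed

lemma primitive_on_norm: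
  assumes "\<And>x. x \<in> J \<Longrightarrow> h absolutely_integrable_on {a..x}"
  shows "primitive_on J a (\<lambda>t. complex_of_real (cmod (h t))) (\<lambda>x. complex_of_real (integral {a..x} (\<lambda>t. cmod (h t))))"
proof (rule primitive_on_of_real)
  fix x assume "x \<in> J"
  from absolutely_integrable_linear[OF absolutely_integrable_norm[OF assms[OF this]] bounded_linear_of_real]
  show "(\<lambda>t. complex_of_real (cmod (h t))) absolutely_integrable_on {a..x}" by (simp add: o_def)
qed

text \<open>A nondecreasing function that does not grow from \<open>u\<close> to \<open>c\<close> is
  constant there, so its derivative vanishes almost everywhere. This turns equality in an integral
  inequality into pointwise information.\<close>

lemma primitive_on_Re_flat:
  assumes J: "initial_interval a J" and y: "primitive_on J a h y" and uc: "u \<in> J" "c \<in> J" "u \<le> c" and N: "negligible N"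
    and h: "\<And>t. t \<in> J - N \<Longrightarrow> t \<in> {u..c} \<Longrightarrow> 0 \<le> Re (h t)" and eq: "Re (y c) \<le> Re (y u)"
  obtains N' where "negligible N'" "\<And>t. t \<in> {u..c} - N' \<Longrightarrow> Re (h t) = 0"
proof -
  obtain M where M: "negligible M" "\<And>t. t \<in> J - M \<Longrightarrow> (y has_vector_derivative h t) (at t)"
    using primitive_on_derivative[OF J y] by blast
  have sub: "{u..c} \<subseteq> J" using initial_interval_sub[OF J uc(1)] initial_interval_sub(1)[OF J uc(2)] by auto
  have const: "Re (y t) = Re (y u)" if t: "t \<in> {u..c}" for t
  proof -
    have tJ: "t \<in> J" using t sub by blast
    have "Re (y u) \<le> Re (y t)"
      by (rule primitive_on_Re_mono[OF J y uc(1) tJ _ N]) (use t h in auto)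
    moreover have "Re (y t) \<le> Re (y c)"
      by (rule primitive_on_Re_mono[OF J y tJ uc(2) _ N]) (use t h in auto)
    ultimately show ?thesis using eq by linarith
  qed
  have "Re (h t) = 0" if t: "t \<in> {u..c} - (M \<union> {u, c})" for t
  proof -
    have t': "t \<in> J - M" "t \<in> {u<..<c}" using t sub by auto
    have "((\<lambda>x. Re (y x)) has_vector_derivative Re (h t)) (at t)"
      using bounded_linear.has_vector_derivative[OF bounded_linear_Re M(2)[OF t'(1)]] .
    then have "((\<lambda>x. Re (y u)) has_vector_derivative Re (h t)) (at t)"
    proof (rule has_vector_derivative_transform_within_open)
      show "open {u<..<c}" "t \<in> {u<..<c}" using t'(2) by simp_all
      show "Re (y x) = Re (y u)" if "x \<in> {u<..<c}" for x using const[of x] that by simp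
    qed
    then show ?thesis using vector_derivative_unique_at has_vector_derivative_const by blast
  qed
  then show ?thesis using that[of "M \<union> {u, c}"] M(1) by simp
qed

text \<open>The half-plane condition on r p + q / w - K, separated into conditions on
  \<open>p\<close> and on \<open>q - K w\<close>. \<open>f_sector\<close> is the matching sign
  condition at \<open>a\<close>, supplied by the admissibility of alpha.\<close>

locale sl_sector = sl_basis +
  fixes \<eta> :: real and K :: complex
  assumes p_sector: "AE x in lebesgue_on J. 0 \<le> Re (cis \<eta> * p x)"
    and q_sector: "AE x in lebesgue_on J. 0 \<le> Re (cis \<eta> * (q x - K * of_real (w x)))"
    and f_sector: "0 \<le> Re (cis \<eta> * (f1 a * cnj (f a)))"
begin

abbreviation "admissible x \<equiv> w x > 0 \<and> p x \<noteq> 0 \<and> 0 \<le> Re (cis \<eta> * p x) \<and> 0 \<le> Re (cis \<eta> * (q x - K * of_real (w x)))"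

lemma sector_exceptional_set:
  obtains N where "negligible N"
    "\<And>x. x \<in> J - N \<Longrightarrow> admissible x"
proof -
  have "AE x in lebesgue_on J. admissible x"
    using w_pos p_nz p_sector q_sector by eventually_elim simp
  then show ?thesis using that unfolding AE_lebesgue_on_iff_negligible[OF J_lebesgue] by blast
qed

text \<open>The boundary term that integration by parts produces from the rotated quadratic form of
  the differential expression.\<close>

definition energy :: "(real \<Rightarrow> complex) \<Rightarrow> (real \<Rightarrow> complex) \<Rightarrow> real \<Rightarrow> real" where
  "energy y y1 x = Re (cis \<eta> * (y1 x * cnj (y x)))"

definition mass :: "(real \<Rightarrow> complex) \<Rightarrow> real \<Rightarrow> real" where
  "mass y x = integral {a..x} (\<lambda>t. w t * (cmod (y t))\<^sup>2)"

lemma mass_primitive: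
  assumes "system y y1 z"
  shows "prim (\<lambda>t. of_real (w t * (cmod (y t))\<^sup>2)) (\<lambda>x. of_real (mass y x))"
  unfolding mass_def
proof (rule primitive_on_of_real)
  fix x assume x: "x \<in> J"
  have "(\<lambda>t. complex_of_real (w t) * complex_of_real ((cmod (y t))\<^sup>2)) absolutely_integrable_on {a..x}"
    using system_continuous(1)[OF assms x] by (intro continuous_weight_integrable x continuous_intros)
  then show "(\<lambda>t. complex_of_real (w t * (cmod (y t))\<^sup>2)) absolutely_integrable_on {a..x}" by simp
qed

lemma mass_a: "mass y a = 0"
  by (simp add: mass_def)

lemma mass_mono:
  assumes y: "system y y1 z" and uv: "u \<in> J" "v \<in> J" "u \<le> v"
  shows "mass y u \<le> mass y v"
proof -
  obtain N where N: "negligible N"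
    "\<And>x. x \<in> J - N \<Longrightarrow> admissible x"
    using sector_exceptional_set by blast
  have "Re (of_real (mass y u)) \<le> Re (of_real (mass y v))"
    by (rule primitive_on_Re_mono[OF J mass_primitive[OF y] uv N(1)]) (use N(2) in \<open>auto simp: less_imp_le\<close>)
  then show ?thesis by simp
qed

lemma mass_pos:
  assumes y: "system y y1 z" and nz: "y a \<noteq> 0 \<or> y1 a \<noteq> 0" and c: "c \<in> J" "a < c"
  shows "0 < mass y c"
proof (rule ccontr)
  assume "\<not> 0 < mass y c"
  then have le: "Re (complex_of_real (mass y c)) \<le> Re (complex_of_real (mass y a))" by (simp add: mass_a)
  obtain N where N: "negligible N"
    "\<And>x. x \<in> J - N \<Longrightarrow> admissible x"
    using sector_exceptional_set by blast
  obtain N' where N': "negligible N'" "\<And>t. t \<in> {a..c} - N' \<Longrightarrow> Re (complex_of_real (w t * (cmod (y t))\<^sup>2)) = 0"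
    by (rule primitive_on_Re_flat[OF J mass_primitive[OF y] a_in c(1) _ N(1) _ le]) (use N(2) c in \<open>auto simp: less_imp_le\<close>)
  have "y t = 0" if "t \<in> {a..c} - (N \<union> N')" for t
    using N'(2)[of t] N(2)[of t] that sub[OF c(1)] by auto
  then have "AE x in lebesgue_on {a..c}. y x = 0"
    using N(1) N'(1) AE_lebesgue_on_iff_negligible[of "{a..c}" "\<lambda>x. y x = 0"]
    by (metis lmeasurable_cbox box_real(2) fmeasurableD negligible_Un)
  then show False
    using sl_coefficients.solution_not_AE_zero[OF restrict[OF c(1)] sl_system_subset[OF y sub[OF c(1)]] nz, of c] c
    by simp
qed

text \<open>The derivative of the energy is the real part of e^(i eta) ((q - K w) |y|^2 + p |y'|^2)
  minus w |y|^2 Re ((xi - K) e^(i eta)). The sector conditions make the former nonnegative, and the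
  choice of \<open>s\<close> makes the latter contribute at least s w |y|^2.\<close>

lemma energy_mono:
  assumes y: "system y y1 (\<lambda>x. \<xi> * y x)" and s: "s \<le> - Re ((\<xi> - K) * cis \<eta>)" and uv: "u \<in> J" "v \<in> J" "u \<le> v"
  shows "energy y y1 u - s * mass y u \<le> energy y y1 v - s * mass y v"
proof -
  define e where "e = (\<lambda>t. cis \<eta> * ((q t * y t - of_real (w t) * (\<xi> * y t)) * cnj (y t) + y1 t * cnj (y1 t / p t)))"
  have P: "prim (\<lambda>x. y1 x / p x) y" "prim (\<lambda>x. q x * y x - of_real (w x) * (\<xi> * y x)) y1"
    using y by (auto simp: sl_system_def)
  have "prim e (\<lambda>x. cis \<eta> * (y1 x * cnj (y x)))"
    unfolding e_def by (intro primitive_on_cmult primitive_on_mult[OF J] primitive_on_cnj P)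
  then have D: "prim (\<lambda>t. e t - of_real s * of_real (w t * (cmod (y t))\<^sup>2)) (\<lambda>x. cis \<eta> * (y1 x * cnj (y x)) - of_real s * of_real (mass y x))"
    by (rule primitive_on_diff) (rule primitive_on_cmult[OF mass_primitive[OF y]])
  obtain N where N: "negligible N"
    "\<And>x. x \<in> J - N \<Longrightarrow> admissible x"
    using sector_exceptional_set by blast
  have "Re (cis \<eta> * (y1 u * cnj (y u)) - of_real s * of_real (mass y u)) \<le> Re (cis \<eta> * (y1 v * cnj (y v)) - of_real s * of_real (mass y v))"
  proof (rule primitive_on_Re_mono[OF J D uv N(1)])
    fix t assume "t \<in> J - N"
    note t = N(2)[OF this]
    have e1: "cis \<eta> * ((q t * y t - of_real (w t) * (\<xi> * y t)) * cnj (y t))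
        = of_real ((cmod (y t))\<^sup>2) * (cis \<eta> * (q t - K * of_real (w t)) - of_real (w t) * ((\<xi> - K) * cis \<eta>))"
      unfolding complex_norm_square by (simp add: algebra_simps)
    \<comment> \<open>The conjugate of 1 / p is p / |p|^2, a positive multiple of \<open>p\<close>,
      so the half-plane condition on \<open>p\<close> applies.\<close>
    have "y1 t * cnj (y1 t / p t) = of_real ((cmod (y1 t))\<^sup>2 / (cmod (p t))\<^sup>2) * p t"
      using t unfolding of_real_divide complex_norm_square by (simp add: field_simps)
    then have e2: "cis \<eta> * (y1 t * cnj (y1 t / p t)) = of_real ((cmod (y1 t))\<^sup>2 / (cmod (p t))\<^sup>2) * (cis \<eta> * p t)"
      by (simp only: mult_ac)
    have Ree: "Re (e t) = (cmod (y t))\<^sup>2 * (Re (cis \<eta> * (q t - K * of_real (w t))) - w t * Re ((\<xi> - K) * cis \<eta>))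
        + (cmod (y1 t))\<^sup>2 / (cmod (p t))\<^sup>2 * Re (cis \<eta> * p t)"
    proof -
      have "Re (of_real r1 * (z1 - of_real r2 * z2) + of_real r3 * z3) = r1 * (Re z1 - r2 * Re z2) + r3 * Re z3" for r1 r2 r3 z1 z2 z3
        by simp
      then show ?thesis unfolding e_def distrib_left[of "cis \<eta>"] e1 e2 .
    qed
    have "(cmod (y t))\<^sup>2 * (w t * s) \<le> (cmod (y t))\<^sup>2 * (Re (cis \<eta> * (q t - K * of_real (w t))) - w t * Re ((\<xi> - K) * cis \<eta>))"
    proof (rule mult_left_mono)
      have "w t * s \<le> w t * (- Re ((\<xi> - K) * cis \<eta>))" using s t by (intro mult_left_mono) auto
      then show "w t * s \<le> Re (cis \<eta> * (q t - K * of_real (w t))) - w t * Re ((\<xi> - K) * cis \<eta>)"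
        using t by linarith
    qed simp
    moreover have "0 \<le> (cmod (y1 t))\<^sup>2 / (cmod (p t))\<^sup>2 * Re (cis \<eta> * p t)" using t by simp
    ultimately have "s * (w t * (cmod (y t))\<^sup>2) \<le> Re (e t)"
      unfolding Ree by (simp only: mult_ac)
    then show "0 \<le> Re (e t - of_real s * of_real (w t * (cmod (y t))\<^sup>2))" by (simp flip: of_real_mult)
  qed
  then show ?thesis by (simp add: energy_def flip: of_real_mult)
qed

abbreviation "Y \<equiv> sol 1 0"
abbreviation "Y1 \<equiv> sol1 1 0"

lemma Y_a: "Y \<xi> a = f a" "Y1 \<xi> a = f1 a" by (simp_all add: sol_a)

lemma Y_nontrivial: "Y \<xi> a \<noteq> 0 \<or> Y1 \<xi> a \<noteq> 0"
  using wronskian_a by (auto simp: Y_a bracket_def)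

text \<open>At \<open>a\<close> the energy is nonnegative by the boundary condition, and the mass
  starts from 0.\<close>

lemma energy_Y_ge:
  assumes "s \<le> - Re ((\<xi> - K) * cis \<eta>)" "x \<in> J"
  shows "s * mass (Y \<xi>) x \<le> energy (Y \<xi>) (Y1 \<xi>) x"
proof -
  have "energy (Y \<xi>) (Y1 \<xi>) a - s * mass (Y \<xi>) a \<le> energy (Y \<xi>) (Y1 \<xi>) x - s * mass (Y \<xi>) x"
    using energy_mono[OF sol_system assms(1) a_in assms(2)] initial_interval_sub(2)[OF J assms(2)] by blast
  moreover have "0 \<le> energy (Y \<xi>) (Y1 \<xi>) a" using f_sector by (simp add: energy_def Y_a)
  ultimately show ?thesis by (simp add: mass_a)
qed

section \<open>Growth of order one half in the spectral parameter\<close>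

definition coeff_norm :: "real \<Rightarrow> real" where
  "coeff_norm t = cmod (1 / p t) + cmod (q t - K * of_real (w t)) + cmod (complex_of_real (w t))"

lemma coefficient_integrable:
  assumes "x \<in> J"
  shows "(\<lambda>t. 1 / p t) absolutely_integrable_on {a..x}"
    "(\<lambda>t. q t - K * of_real (w t)) absolutely_integrable_on {a..x}"
proof -
  show "(\<lambda>t. 1 / p t) absolutely_integrable_on {a..x}"
    using p_int sub[OF assms] by (simp add: loc_integrable_on_def)
  have "q absolutely_integrable_on {a..x}"
    using q_int sub[OF assms] by (simp add: loc_integrable_on_def)
  then show "(\<lambda>t. q t - K * of_real (w t)) absolutely_integrable_on {a..x}"
    by (intro set_integral_diff(1) set_integrable_mult_right weight_integrable assms)
qed

lemma coeff_norm_integrable: "x \<in> J \<Longrightarrow> coeff_norm absolutely_integrable_on {a..x}"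
  unfolding coeff_norm_def
  by (intro set_integral_add(1) absolutely_integrable_norm[unfolded o_def] coefficient_integrable weight_integrable)

text \<open>The factor \<open>r\<close> balances the system: r y' = r y1 / p, and the part (xi - K)
  w y of y1' is at most r |w| times r |y|. Both derivatives are thus at most
  \<open>r * coeff_norm\<close> times r |y| + |y1|, and Gronwall's inequality gives an exponential
  of order \<open>r\<close>.\<close>

lemma Y_growth:
  assumes c: "c \<in> J"
  obtains A B where "0 \<le> A" "0 \<le> B" "\<And>\<xi>. cmod (Y \<xi> c) \<le> exp (A + B * sqrt (cmod (\<xi> - K)))"
    "\<And>\<xi>. cmod (Y1 \<xi> c) \<le> exp (A + B * sqrt (cmod (\<xi> - K)))"
proof -
  define L where "L = integral {a..c} coeff_norm"
  define n0 where "n0 = cmod (f a) + cmod (f1 a)"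
  have cni: "coeff_norm integrable_on {a..x}" if "x \<in> J" for x
    using coeff_norm_integrable[OF that] by (simp add: set_lebesgue_integral_eq_integral(1))
  have ac: "a \<le> c" using initial_interval_sub(2)[OF J c] .
  have L0: "0 \<le> L" unfolding L_def by (intro integral_nonneg cni c) (simp add: coeff_norm_def)
  have main: "cmod (Y \<xi> c) + cmod (Y1 \<xi> c) \<le> exp ((n0 + 1 + L) + (1 + L) * sqrt (cmod (\<xi> - K)))" for \<xi>
  proof -
    \<comment> \<open>r^2 dominates |xi - K|, and r \<ge> 1 lets the terms without spectral
      parameter be absorbed as well.\<close>
    define r where "r = 1 + sqrt (cmod (\<xi> - K))"
    have r: "1 \<le> r" "cmod (\<xi> - K) \<le> r\<^sup>2"
    proof -
      show "1 \<le> r" by (simp add: r_def)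
      have "cmod (\<xi> - K) = (sqrt (cmod (\<xi> - K)))\<^sup>2" by simp
      also have "\<dots> \<le> r\<^sup>2" unfolding r_def by (intro power_mono) auto
      finally show "cmod (\<xi> - K) \<le> r\<^sup>2" .
    qed
    define n where "n = (\<lambda>x. r * cmod (Y \<xi> x) + cmod (Y1 \<xi> x))"
    define k where "k = (\<lambda>x. r * coeff_norm x)"
    have nc: "continuous_on {a..x} n" if "x \<in> J" for x
      unfolding n_def using system_continuous[OF sol_system that] by (intro continuous_intros)
    have ka: "k absolutely_integrable_on {a..x}" if "x \<in> J" for x
      unfolding k_def using coeff_norm_integrable[OF that] by simp
    have kn: "(\<lambda>t. k t * n t) integrable_on {a..x}" if x: "x \<in> J" for x
    proof -
      have "(\<lambda>t. complex_of_real (k t) * complex_of_real (n t)) absolutely_integrable_on {a..x}"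
        using absolutely_integrable_linear[OF ka[OF x] bounded_linear_of_real[where 'a=complex]] nc[OF x]
        by (intro absolutely_integrable_mult_continuous(2)) (auto simp: o_def intro: continuous_intros)
      from integrable_linear[OF set_lebesgue_integral_eq_integral(1)[OF this] bounded_linear_Re]
      show ?thesis by (simp add: o_def)
    qed
    have P: "prim (\<lambda>x. Y1 \<xi> x / p x) (Y \<xi>)" "prim (\<lambda>x. q x * Y \<xi> x - of_real (w x) * (\<xi> * Y \<xi> x)) (Y1 \<xi>)"
      using sol_system[of 1 0 \<xi>] by (auto simp: sl_system_def)
    have "n c \<le> n a * exp (integral {a..c} k)"
    proof (rule gronwall_L1[OF ka[OF c] _ nc[OF c]])
      show "0 \<le> k x" for x using r by (simp add: k_def coeff_norm_def)
      show "0 \<le> n a" using r by (simp add: n_def)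
      show "c \<in> {a..c}" using ac by simp
      fix x assume "x \<in> {a..c}"
      then have x: "x \<in> J" using sub[OF c] by blast
      define h where "h = (\<lambda>t. r * cmod (Y1 \<xi> t / p t) + cmod (q t * Y \<xi> t - of_real (w t) * (\<xi> * Y \<xi> t)))"
      have nn: "(\<lambda>t. cmod (Y1 \<xi> t / p t)) integrable_on {a..x}"
        "(\<lambda>t. cmod (q t * Y \<xi> t - of_real (w t) * (\<xi> * Y \<xi> t))) integrable_on {a..x}"
        using absolutely_integrable_norm[OF primitive_on_integrable(1)[OF P(1) x]]
          absolutely_integrable_norm[OF primitive_on_integrable(1)[OF P(2) x]]
        by (simp_all add: o_def set_lebesgue_integral_eq_integral(1))
      have b: "cmod (Y \<xi> x) \<le> cmod (Y \<xi> a) + integral {a..x} (\<lambda>t. cmod (Y1 \<xi> t / p t))"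
        "cmod (Y1 \<xi> x) \<le> cmod (Y1 \<xi> a) + integral {a..x} (\<lambda>t. cmod (q t * Y \<xi> t - of_real (w t) * (\<xi> * Y \<xi> t)))"
      proof -
        have "cmod (y x) \<le> cmod (y a) + integral {a..x} (\<lambda>t. cmod (h t))"
          if "prim h y" "(\<lambda>t. cmod (h t)) integrable_on {a..x}" for y h
        proof -
          have "cmod (integral {a..x} h) \<le> integral {a..x} (\<lambda>t. cmod (h t))"
            using primitive_on_integrable(2)[OF that(1) x] that(2) by (intro integral_norm_bound_integral) auto
          then show ?thesis using primitive_on_value[OF that(1) x] norm_triangle_ineq[of "y a" "integral {a..x} h"] by simp
        qed
        from this[OF P(1) nn(1)] this[OF P(2) nn(2)]
        show "cmod (Y \<xi> x) \<le> cmod (Y \<xi> a) + integral {a..x} (\<lambda>t. cmod (Y1 \<xi> t / p t))"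
        "cmod (Y1 \<xi> x) \<le> cmod (Y1 \<xi> a) + integral {a..x} (\<lambda>t. cmod (q t * Y \<xi> t - of_real (w t) * (\<xi> * Y \<xi> t)))" .
      qed
      have "n x \<le> r * (cmod (Y \<xi> a) + integral {a..x} (\<lambda>t. cmod (Y1 \<xi> t / p t))) +
          (cmod (Y1 \<xi> a) + integral {a..x} (\<lambda>t. cmod (q t * Y \<xi> t - of_real (w t) * (\<xi> * Y \<xi> t))))"
        unfolding n_def using b r by (intro add_mono mult_left_mono) auto
      also have "\<dots> = n a + integral {a..x} h"
        unfolding h_def n_def
        by (subst Henstock_Kurzweil_Integration.integral_add) (use nn in \<open>auto simp: algebra_simps intro: integrable_on_mult_right\<close>)
      also have "integral {a..x} h \<le> integral {a..x} (\<lambda>t. k t * n t)"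
      proof (rule integral_le[OF _ kn[OF x]])
        show "h integrable_on {a..x}" unfolding h_def
          by (intro integrable_add integrable_on_mult_right nn)
        fix t
        have "cmod (Y1 \<xi> t / p t) \<le> cmod (1 / p t) * n t"
          using r by (simp add: norm_divide n_def divide_right_mono)
        then have 1: "r * cmod (Y1 \<xi> t / p t) \<le> r * (cmod (1 / p t) * n t)" using r by (intro mult_left_mono) auto
        have rn: "r * cmod (Y \<xi> t) \<le> n t" by (simp add: n_def)
        have "q t * Y \<xi> t - of_real (w t) * (\<xi> * Y \<xi> t) = (q t - K * of_real (w t)) * Y \<xi> t - (of_real (w t) * (\<xi> - K)) * Y \<xi> t"
          by (simp add: algebra_simps)
        then have "cmod (q t * Y \<xi> t - of_real (w t) * (\<xi> * Y \<xi> t)) \<le> cmod (q t - K * of_real (w t)) * cmod (Y \<xi> t)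
           + cmod (complex_of_real (w t)) * cmod (\<xi> - K) * cmod (Y \<xi> t)"
          by (metis norm_mult norm_triangle_ineq4)
        also have "\<dots> \<le> cmod (q t - K * of_real (w t)) * (r * n t) + cmod (complex_of_real (w t)) * (r * n t)"
        proof (rule add_mono)
          have "1 * cmod (Y \<xi> t) \<le> r * cmod (Y \<xi> t)" using r by (intro mult_right_mono) auto
          moreover have "1 * n t \<le> r * n t" using r by (intro mult_right_mono) (auto simp: n_def)
          ultimately have "cmod (Y \<xi> t) \<le> r * n t" using rn by linarith
          then show "cmod (q t - K * of_real (w t)) * cmod (Y \<xi> t) \<le> cmod (q t - K * of_real (w t)) * (r * n t)"
            by (intro mult_left_mono) auto
          have "cmod (\<xi> - K) * cmod (Y \<xi> t) \<le> r\<^sup>2 * cmod (Y \<xi> t)" using r(2) by (intro mult_right_mono) auto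
          also have "\<dots> = r * (r * cmod (Y \<xi> t))" by (simp add: power2_eq_square)
          also have "\<dots> \<le> r * n t" using r rn by (intro mult_left_mono) auto
          finally have "cmod (complex_of_real (w t)) * (cmod (\<xi> - K) * cmod (Y \<xi> t)) \<le> cmod (complex_of_real (w t)) * (r * n t)"
            by (rule mult_left_mono) simp
          then show "cmod (complex_of_real (w t)) * cmod (\<xi> - K) * cmod (Y \<xi> t) \<le> cmod (complex_of_real (w t)) * (r * n t)"
            by (simp only: mult.assoc)
        qed
        finally show "h t \<le> k t * n t" using 1 unfolding h_def k_def coeff_norm_def by (simp add: algebra_simps)
      qed
      finally show "n x \<le> n a + integral {a..x} (\<lambda>t. k t * n t)" by simp
    qed
    also have "integral {a..c} k = r * L" by (simp add: k_def L_def)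
    also have "n a * exp (r * L) \<le> (r * n0) * exp (r * L)"
    proof -
      have "cmod (f1 a) \<le> r * cmod (f1 a)" using mult_right_mono[of 1 r "cmod (f1 a)"] r by simp
      then have "n a \<le> r * n0" by (simp add: n_def n0_def Y_a algebra_simps)
      then show ?thesis by (intro mult_right_mono) auto
    qed
    \<comment> \<open>The factor \<open>r * n0\<close> is moved into the exponent to reach the pure
      exponential form that the growth theorems expect.\<close>
    also have "\<dots> \<le> (exp r * exp n0) * exp (r * L)"
    proof -
      have "1 + r \<le> exp r" "1 + n0 \<le> exp n0" by (rule exp_ge_add_one_self)+
      then have "r \<le> exp r" "n0 \<le> exp n0" by linarith+
      then have "r * n0 \<le> exp r * exp n0" by (intro mult_mono) (auto simp: n0_def)
      then show ?thesis by (intro mult_right_mono) auto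
    qed
    also have "\<dots> = exp ((n0 + 1 + L) + (1 + L) * sqrt (cmod (\<xi> - K)))"
      by (simp add: r_def algebra_simps flip: exp_add)
    finally have "n c \<le> exp ((n0 + 1 + L) + (1 + L) * sqrt (cmod (\<xi> - K)))" .
    moreover have "cmod (Y \<xi> c) \<le> r * cmod (Y \<xi> c)" using mult_right_mono[of 1 r "cmod (Y \<xi> c)"] r by simp
    ultimately show ?thesis by (simp add: n_def)
  qed
  show ?thesis
  proof (rule that[of "n0 + 1 + L" "1 + L"])
    show "0 \<le> n0 + 1 + L" "0 \<le> 1 + L" using L0 by (auto simp: n0_def)
    show "cmod (Y \<xi> c) \<le> exp (n0 + 1 + L + (1 + L) * sqrt (cmod (\<xi> - K)))" for \<xi>
      using main[of \<xi>] norm_ge_zero[of "Y1 \<xi> c"] by linarith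
    show "cmod (Y1 \<xi> c) \<le> exp (n0 + 1 + L + (1 + L) * sqrt (cmod (\<xi> - K)))" for \<xi>
      using main[of \<xi>] norm_ge_zero[of "Y \<xi> c"] by linarith
  qed
qed

end

context sl_sector
begin

section \<open>Existence of zeros of the characteristic function\<close>

text \<open>At the base point the perturbation parameter is 0, so the coefficient of
  \<open>f\<close> keeps its initial value 1.\<close>

lemma characteristic_at_base:
  assumes "c \<in> J"
  shows "bracket (Y \<zeta>) (Y1 \<zeta>) g g1 c = 1"
proof -
  have "prim (\<lambda>t. of_real (w t) * g t * (0 * (coef1 1 0 0 t * f t + coef2 1 0 0 t * g t))) (coef1 1 0 0)"
    by (rule coef_primitive)
  then have "coef1 1 0 0 c = coef1 1 0 0 a"
    by (rule primitive_on_constant[OF J _ negligible_empty _ assms]) simp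
  then show ?thesis using bracket_sol(1)[OF assms, of 1 0 \<zeta>] by (simp add: coef_a)
qed

text \<open>Growth of order at most 1/2 without zeros leaves only a constant, which is evaluated at
  the base point. The variable is centred at \<open>K\<close>, from where the growth is
  measured.\<close>

lemma zero_free_characteristic:
  assumes c: "c \<in> J" and nz: "\<And>\<xi>. bracket (Y \<xi>) (Y1 \<xi>) g g1 c \<noteq> 0"
  shows "Y \<xi> c * g1 c - Y1 \<xi> c * g c = 1"
proof -
  define D where "D = (\<lambda>z. bracket (Y (K + z)) (Y1 (K + z)) g g1 c)"
  obtain A B where AB: "0 \<le> A" "0 \<le> B" "\<And>\<xi>. cmod (Y \<xi> c) \<le> exp (A + B * sqrt (cmod (\<xi> - K)))"
    "\<And>\<xi>. cmod (Y1 \<xi> c) \<le> exp (A + B * sqrt (cmod (\<xi> - K)))" using Y_growth[OF c] by blast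
  define n where "n = cmod (g c) + cmod (g1 c)"
  have hol: "(\<lambda>z. Y (K + z) c) holomorphic_on UNIV" "(\<lambda>z. Y1 (K + z) c) holomorphic_on UNIV"
    using holomorphic_on_compose_gen[of "\<lambda>z. K + z" UNIV "\<lambda>\<xi>. Y \<xi> c" UNIV, unfolded o_def]
      holomorphic_on_compose_gen[of "\<lambda>z. K + z" UNIV "\<lambda>\<xi>. Y1 \<xi> c" UNIV, unfolded o_def]
      sol_holomorphic[OF c, of 1 0] by (simp_all add: holomorphic_intros)
  have "D z = D 0" for z
  proof (rule nonvanishing_order_half_constant)
    show "D holomorphic_on UNIV" unfolding D_def bracket_def using hol by (auto intro!: holomorphic_intros)
    show "D z \<noteq> 0" for z using nz by (simp add: D_def)
    show "0 \<le> n + A" "0 \<le> B" using AB by (simp_all add: n_def)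
    show "cmod (D z) \<le> exp (n + A + B * sqrt (cmod z))" for z
    proof -
      define e where "e = exp (A + B * sqrt (cmod z))"
      have "cmod (D z) \<le> cmod (Y (K + z) c) * cmod (g1 c) + cmod (Y1 (K + z) c) * cmod (g c)"
        unfolding D_def bracket_def by (metis norm_mult norm_triangle_ineq4)
      also have "\<dots> \<le> e * cmod (g1 c) + e * cmod (g c)"
        using AB(3,4)[of "K + z"] by (intro add_mono mult_right_mono) (auto simp: e_def)
      also have "\<dots> = n * e" by (simp add: n_def algebra_simps)
      also have "\<dots> \<le> exp n * e"
      proof (rule mult_right_mono)
        have "1 + n \<le> exp n" by (rule exp_ge_add_one_self)
        then show "n \<le> exp n" by linarith
      qed (simp add: e_def)
      finally show ?thesis by (simp add: e_def add.assoc flip: exp_add)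
    qed
  qed
  then have "D (\<xi> - K) = D (\<zeta> - K)" by metis
  then show ?thesis using characteristic_at_base[OF c] by (simp add: D_def bracket_def)
qed

lemma energy_cmult:
  "energy (\<lambda>x. k * y x) (\<lambda>x. k * y1 x) x = (cmod k)\<^sup>2 * energy y y1 x"
proof -
  have "cis \<eta> * ((k * y1 x) * cnj (k * y x)) = of_real ((cmod k)\<^sup>2) * (cis \<eta> * (y1 x * cnj (y x)))"
    unfolding complex_norm_square by simp
  then show ?thesis unfolding energy_def by (simp only: Re_complex_of_real times_complex.sel) simp
qed

text \<open>Close to \<open>c\<close> the integrals of |1 / p| and |q - K w| are small by
  continuity, while the weight, positive almost everywhere, still has positive mass. This is the
  room in which the decay argument takes place.\<close>

lemma coefficient_tails:
  assumes c: "c \<in> J" "a < c" and e: "e > 0"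
  obtains x0 where "x0 \<in> J" "x0 < c"
    "integral {a..c} (\<lambda>t. cmod (1 / p t)) - integral {a..x0} (\<lambda>t. cmod (1 / p t)) \<le> e"
    "integral {a..c} (\<lambda>t. cmod (q t - K * of_real (w t))) - integral {a..x0} (\<lambda>t. cmod (q t - K * of_real (w t))) \<le> e"
    "integral {a..c} (\<lambda>t. cmod (of_real (w t) :: complex)) - integral {a..x0} (\<lambda>t. cmod (of_real (w t) :: complex)) > 0"
proof -
  define Ap where "Ap = (\<lambda>x. integral {a..x} (\<lambda>t. cmod (1 / p t)))"
  define Aq where "Aq = (\<lambda>x. integral {a..x} (\<lambda>t. cmod (q t - K * of_real (w t))))"
  define Aw where "Aw = (\<lambda>x. integral {a..x} (\<lambda>t. cmod (of_real (w t) :: complex)))"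
  have P: "prim (\<lambda>t. of_real (cmod (1 / p t))) (\<lambda>x. of_real (Ap x))"
    "prim (\<lambda>t. of_real (cmod (q t - K * of_real (w t)))) (\<lambda>x. of_real (Aq x))"
    "prim (\<lambda>t. of_real (cmod (of_real (w t)))) (\<lambda>x. of_real (Aw x))"
    unfolding Ap_def Aq_def Aw_def
    by (intro primitive_on_norm coefficient_integrable weight_integrable; assumption)+
  have "continuous_on {a..c} (\<lambda>x. complex_of_real (Ap x))" "continuous_on {a..c} (\<lambda>x. complex_of_real (Aq x))"
    using primitive_on_continuous[OF J _ sub[OF c(1)]] P by blast+
  then have cont: "continuous_on {a..c} Ap" "continuous_on {a..c} Aq"
    by (simp_all only: continuous_on_of_real_o_iff[unfolded o_def])
  have cin: "c \<in> {a..c}" using c by simp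
  obtain d1 where d1: "d1 > 0" "\<And>x. x \<in> {a..c} \<Longrightarrow> dist x c < d1 \<Longrightarrow> dist (Ap x) (Ap c) < e"
    using cont(1)[unfolded continuous_on_iff, rule_format, OF cin e] by blast
  obtain d2 where d2: "d2 > 0" "\<And>x. x \<in> {a..c} \<Longrightarrow> dist x c < d2 \<Longrightarrow> dist (Aq x) (Aq c) < e"
    using cont(2)[unfolded continuous_on_iff, rule_format, OF cin e] by blast
  define x0 where "x0 = max a (c - min d1 d2 / 2)"
  have x0: "x0 \<in> {a..c}" "x0 < c" "dist x0 c < d1" "dist x0 c < d2"
    using c d1(1) d2(1) by (auto simp: x0_def dist_real_def)
  have xJ: "x0 \<in> J" using x0 sub[OF c(1)] by blast
  have "Aw c - Aw x0 > 0"
  proof (rule ccontr)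
    assume "\<not> Aw c - Aw x0 > 0"
    then have le: "Re (complex_of_real (Aw c)) \<le> Re (complex_of_real (Aw x0))" by simp
    obtain N' where N': "negligible N'" "\<And>t. t \<in> {x0..c} - N' \<Longrightarrow> Re (complex_of_real (cmod (complex_of_real (w t)))) = 0"
      by (rule primitive_on_Re_flat[OF J P(3) xJ c(1) _ negligible_empty _ le]) (use x0 in auto)
    obtain N where N: "negligible N"
      "\<And>x. x \<in> J - N \<Longrightarrow> admissible x"
      using sector_exceptional_set by blast
    have "{x0..c} \<subseteq> N \<union> N'"
    proof
      fix t assume t: "t \<in> {x0..c}"
      then have "t \<in> J" using x0 sub[OF c(1)] by auto
      then show "t \<in> N \<union> N'" using N(2)[of t] N'(2)[of t] t by fastforce
    qed
    then have "negligible {x0..c}" using N(1) N'(1) negligible_subset negligible_Un by blast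
    then show False using x0(2) negligible_interval(1)[of x0 c] by simp
  qed
  then show ?thesis
    using that[OF xJ x0(2)] d1(2)[OF x0(1,3)] d2(2)[OF x0(1,4)] unfolding Ap_def Aq_def Aw_def dist_real_def by linarith
qed

text \<open>A bound on \<open>p y' / y\<close> at \<open>c\<close> cannot persist for large \<open>|\<xi>|\<close> in the sector: continued to
  the left over the distance at which the weight has mass of order \<open>1 / |\<xi> - K|\<close>, \<open>y\<close> stays
  almost constant while the energy drops below zero.\<close>

lemma decay_in_sector:
  assumes c: "c \<in> J" "a < c" and one: "\<And>\<xi>. Y \<xi> c * g1 c - Y1 \<xi> c * g c = 1" and gc: "g c \<noteq> 0" and \<delta>: "\<delta> > 0"
  obtains R where "0 < R" "\<And>\<xi>. R \<le> cmod (\<xi> - K) \<Longrightarrow> Re ((\<xi> - K) * cis \<eta>) \<le> - cmod (\<xi> - K) / 2 \<Longrightarrow> cmod (Y \<xi> c) < \<delta>"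
proof -
  \<comment> \<open>Bounds |y1 c| for the solution normalised to y c = 1 when |Y c| \<ge> delta: the
    constant bracket gives y1 = (g1 - 1 / Y) / g at \<open>c\<close>.\<close>
  define M where "M = (1 / \<delta> + cmod (g1 c)) / cmod (g c)"
  \<comment> \<open>The solution is followed to the left until |xi - K| times the weight covered
    equals M'. The energy then falls by at least M' / 4 = 2 M + 2, more than the M available at
    \<open>c\<close>.\<close>
  define M' where "M' = 8 * (M + 1)"
  \<comment> \<open>Small enough that the maximal deviation \<open>m\<close> of \<open>y\<close>
    from 1 satisfies m \<le> 1/10 + m/20, and hence m \<le> 1/5.\<close>
  define e where "e = 1 / (20 * (1 + M + M'))"
  have M0: "0 \<le> M" using \<delta> by (simp add: M_def)
  have M'0: "0 < M'" using M0 by (simp add: M'_def)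
  have e0: "0 < e" "e \<le> 1" using M0 M'0 by (auto simp: e_def field_simps)
  have eM: "e * M \<le> 1 / 20" "e * (e + M') \<le> 1 / 20"
  proof -
    have "e * (1 + M + M') = 1 / 20" using M0 M'0 by (simp add: e_def)
    moreover have "e * M \<le> e * (1 + M + M')" "e * (e + M') \<le> e * (1 + M + M')"
      using e0 M0 M'0 by (intro mult_left_mono; simp)+
    ultimately show "e * M \<le> 1 / 20" "e * (e + M') \<le> 1 / 20" by linarith+
  qed
  define Ap where "Ap = (\<lambda>x. integral {a..x} (\<lambda>t. cmod (1 / p t)))"
  define Aq where "Aq = (\<lambda>x. integral {a..x} (\<lambda>t. cmod (q t - K * of_real (w t))))"
  define Aw where "Aw = (\<lambda>x. integral {a..x} (\<lambda>t. cmod (of_real (w t) :: complex)))"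
  have P: "prim (\<lambda>t. of_real (cmod (1 / p t))) (\<lambda>x. of_real (Ap x))"
    "prim (\<lambda>t. of_real (cmod (q t - K * of_real (w t)))) (\<lambda>x. of_real (Aq x))"
    "prim (\<lambda>t. of_real (cmod (of_real (w t)))) (\<lambda>x. of_real (Aw x))"
    unfolding Ap_def Aq_def Aw_def
    by (intro primitive_on_norm coefficient_integrable weight_integrable; assumption)+
  have mono: "Ap u \<le> Ap v" "Aq u \<le> Aq v" "Aw u \<le> Aw v" if "u \<in> J" "v \<in> J" "u \<le> v" for u v
  proof -
    have "Re (of_real (A u)) \<le> Re (of_real (A v))" if "prim (\<lambda>t. of_real (cmod (h t))) (\<lambda>x. of_real (A x))" for A h
      by (rule primitive_on_Re_mono[OF J that \<open>u \<in> J\<close> \<open>v \<in> J\<close> \<open>u \<le> v\<close> negligible_empty]) simp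
    from this[OF P(1)] this[OF P(2)] this[OF P(3)] show "Ap u \<le> Ap v" "Aq u \<le> Aq v" "Aw u \<le> Aw v" by simp_all
  qed
  obtain x0 where x0: "x0 \<in> J" "x0 < c" "Ap c - Ap x0 \<le> e" "Aq c - Aq x0 \<le> e" "Aw c - Aw x0 > 0"
    using coefficient_tails[OF c e0(1)] unfolding Ap_def Aq_def Aw_def by blast
  \<comment> \<open>For |xi - K| \<ge> R the interval from \<open>x0\<close> to \<open>c\<close>
    carries enough weight for the left end point \<open>x\<close> chosen below to exist.\<close>
  define R where "R = M' / (Aw c - Aw x0)"
  have R0: "0 < R" using M'0 x0(5) by (simp add: R_def)
  have "cmod (Y \<xi> c) < \<delta>" if big: "R \<le> cmod (\<xi> - K)" and sec: "Re ((\<xi> - K) * cis \<eta>) \<le> - cmod (\<xi> - K) / 2" for \<xi>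
  proof (rule ccontr)
    assume "\<not> cmod (Y \<xi> c) < \<delta>"
    then have Yc: "cmod (Y \<xi> c) \<ge> \<delta>" by simp
    then have Ync: "Y \<xi> c \<noteq> 0" using \<delta> by auto
    define r where "r = cmod (\<xi> - K)"
    have r0: "0 < r" using R0 big unfolding r_def by linarith
    have rW: "M' \<le> r * (Aw c - Aw x0)"
      using big x0(5) by (simp add: r_def R_def field_simps)
    have "continuous_on {a..c} (\<lambda>x. complex_of_real (Aw x))"
      using primitive_on_continuous[OF J P(3) sub[OF c(1)]] .
    then have "continuous_on {a..c} Aw" by (simp only: continuous_on_of_real_o_iff[unfolded o_def])
    moreover have "{x0..c} \<subseteq> {a..c}" using initial_interval_sub(2)[OF J x0(1)] by auto
    ultimately have contW: "continuous_on {x0..c} Aw" by (rule continuous_on_subset)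
    have "\<exists>x\<ge>x0. x \<le> c \<and> Aw x = Aw c - M' / r"
      using rW r0 M'0 x0(2) by (intro IVT' contW) (auto simp: field_simps)
    then obtain x where x: "x0 \<le> x" "x \<le> c" "Aw x = Aw c - M' / r" by blast
    have xc: "{x..c} \<subseteq> {a..c}" using x initial_interval_sub(2)[OF J x0(1)] by auto
    then have inJ: "t \<in> J" if "t \<in> {x..c}" for t using sub[OF c(1)] that by blast
    have xJ: "x \<in> J" using inJ x by simp
    define k where "k = inverse (Y \<xi> c)"
    define y where "y = (\<lambda>t. k * Y \<xi> t)"
    define y1 where "y1 = (\<lambda>t. k * Y1 \<xi> t)"
    have sys: "system y y1 (\<lambda>t. \<xi> * y t)"
      using sl_system_cmult[OF sol_system[of 1 0 \<xi>], of k] by (simp add: y_def y1_def mult_ac)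
    have yc: "y c = 1" using Ync by (simp add: y_def k_def)
    have y1c: "cmod (y1 c) \<le> M"
    proof -
      have "y1 c * g c = g1 c - k"
        using one[of \<xi>] Ync by (simp add: y1_def k_def field_simps)
      then have "cmod (y1 c) * cmod (g c) \<le> cmod (g1 c) + cmod k"
        by (metis norm_mult norm_triangle_ineq4)
      also have "cmod k \<le> 1 / \<delta>" using Yc \<delta> unfolding k_def norm_inverse by (simp add: inverse_eq_divide frac_le)
      finally show ?thesis using gc by (simp add: M_def field_simps)
    qed
    have cont: "continuous_on {x..c} (\<lambda>t. cmod (y t - 1))"
      by (rule continuous_on_subset[OF _ xc]) (intro continuous_intros system_continuous[OF sys c(1)])
    \<comment> \<open>The largest deviation of \<open>y\<close> from 1 is estimated through itself:
      it bounds \<open>y1\<close>, and the bound on \<open>y1\<close> together with the small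
      integral of |1 / p| bounds the deviation.\<close>
    obtain t0 where t0: "t0 \<in> {x..c}" "\<And>t. t \<in> {x..c} \<Longrightarrow> cmod (y t - 1) \<le> cmod (y t0 - 1)"
      using continuous_attains_sup[OF _ _ cont] x(2) by auto
    define m where "m = cmod (y t0 - 1)"
    have m: "cmod (y t) \<le> 1 + m" if "t \<in> {x..c}" for t
      using t0(2)[OF that] norm_triangle_sub[of "y t" 1] by (simp add: m_def)
    have m0: "0 \<le> m" by (simp add: m_def)
    note S = sys[unfolded sl_system_def, THEN conjunct1] sys[unfolded sl_system_def, THEN conjunct2]
    have y1b: "cmod (y1 t) \<le> M + (1 + m) * (e + M')" if t: "t \<in> {x..c}" for t
    proof -
      have H: "prim (\<lambda>s. of_real (1 + m) * (of_real (cmod (q s - K * of_real (w s))) + of_real r * of_real (cmod (of_real (w s)))))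
         (\<lambda>s. of_real (1 + m) * (of_real (Aq s) + of_real r * of_real (Aw s)))"
        by (intro primitive_on_cmult primitive_on_add P)
      have "cmod (y1 c - y1 t) \<le> Re (of_real (1 + m) * (of_real (Aq c) + of_real r * of_real (Aw c)) - of_real (1 + m) * (of_real (Aq t) + of_real r * of_real (Aw t)))"
      proof (rule primitive_on_norm_le[OF J S(2) H inJ[OF t] c(1) _ negligible_empty])
        show "t \<le> c" using t by simp
        fix s assume "s \<in> {t..c}"
        then have s: "s \<in> {x..c}" using t by auto
        have "q s * y s - of_real (w s) * (\<xi> * y s) = ((q s - K * of_real (w s)) - of_real (w s) * (\<xi> - K)) * y s"
          by (simp add: algebra_simps)
        then have "cmod (q s * y s - of_real (w s) * (\<xi> * y s)) = cmod ((q s - K * of_real (w s)) - of_real (w s) * (\<xi> - K)) * cmod (y s)"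
          by (simp only: norm_mult)
        also have "\<dots> \<le> (cmod (q s - K * of_real (w s)) + cmod (of_real (w s) :: complex) * r) * (1 + m)"
          using m[OF s] norm_triangle_ineq4[of "q s - K * of_real (w s)" "of_real (w s) * (\<xi> - K)"]
          by (intro mult_mono) (auto simp: norm_mult r_def)
        finally show "cmod (q s * y s - of_real (w s) * (\<xi> * y s))
            \<le> Re (of_real (1 + m) * (of_real (cmod (q s - K * of_real (w s))) + of_real r * of_real (cmod (of_real (w s) :: complex))))"
          by (simp only: of_real_mult[symmetric] of_real_add[symmetric] Re_complex_of_real mult_ac)
      qed
      also have "\<dots> = (1 + m) * ((Aq c - Aq t) + r * (Aw c - Aw t))"
        by (simp only: of_real_mult[symmetric] of_real_add[symmetric] of_real_diff[symmetric] Re_complex_of_real) (simp add: algebra_simps)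
      also have "\<dots> \<le> (1 + m) * (e + M')"
      proof (rule mult_left_mono)
        have "Aq c - Aq t \<le> e" using mono(2)[OF x0(1) inJ[OF t]] t x x0(4) by simp
        moreover have "r * (Aw c - Aw t) \<le> r * (M' / r)"
          using mono(3)[OF xJ inJ[OF t]] t x(3) r0 by (intro mult_left_mono) auto
        moreover have "r * (M' / r) = M'" using r0 by simp
        ultimately show "(Aq c - Aq t) + r * (Aw c - Aw t) \<le> e + M'" by linarith
      qed (use m0 in simp)
      finally have "cmod (y1 c - y1 t) \<le> (1 + m) * (e + M')" .
      then show ?thesis using y1c norm_triangle_sub[of "y1 t" "y1 c"] by (simp add: norm_minus_commute)
    qed
    define B1 where "B1 = M + (1 + m) * (e + M')"
    have B1: "0 \<le> B1" using M0 M'0 m0 e0 by (simp add: B1_def)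
    have "cmod (y c - y t0) \<le> Re (of_real B1 * of_real (Ap c) - of_real B1 * of_real (Ap t0))"
    proof (rule primitive_on_norm_le[OF J S(1) primitive_on_cmult[OF P(1)] inJ[OF t0(1)] c(1) _ negligible_empty])
      show "t0 \<le> c" using t0 by simp
      fix s assume "s \<in> {t0..c}"
      then have s: "s \<in> {x..c}" using t0 by auto
      have "cmod (y1 s / p s) = cmod (y1 s) * cmod (1 / p s)" by (simp add: norm_divide)
      also have "\<dots> \<le> B1 * cmod (1 / p s)" using y1b[OF s] by (intro mult_right_mono) (auto simp: B1_def)
      finally show "cmod (y1 s / p s) \<le> Re (of_real B1 * of_real (cmod (1 / p s)))"
        by (simp only: of_real_mult[symmetric] Re_complex_of_real)
    qed
    also have "\<dots> = B1 * (Ap c - Ap t0)"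
      by (simp only: of_real_mult[symmetric] of_real_diff[symmetric] Re_complex_of_real) (simp add: algebra_simps)
    also have "\<dots> \<le> B1 * e"
      using mono(1)[OF x0(1) inJ[OF t0(1)]] t0 x x0(3) B1 by (intro mult_left_mono) auto
    finally have "m \<le> B1 * e" by (simp add: m_def yc norm_minus_commute)
    also have "B1 * e = e * M + e * (e + M') + m * (e * (e + M'))" by (simp add: B1_def algebra_simps)
    also have "\<dots> \<le> 1 / 20 + 1 / 20 + m * (1 / 20)" using eM m0 by (intro add_mono mult_left_mono) auto
    finally have m1: "m \<le> 1 / 5" by simp
    have ysq: "(cmod (y t))\<^sup>2 \<ge> 1 / 2" if "t \<in> {x..c}" for t
    proof -
      have "cmod (y t) \<ge> 4 / 5"
        using t0(2)[OF that] m1 norm_triangle_ineq2[of 1 "y t"] by (simp add: m_def norm_minus_commute)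
      then have "(4 / 5)\<^sup>2 \<le> (cmod (y t))\<^sup>2" by (intro power_mono) auto
      then show ?thesis by (simp add: power2_eq_square)
    qed
    obtain N where N: "negligible N"
      "\<And>x. x \<in> J - N \<Longrightarrow> admissible x"
      using sector_exceptional_set by blast
    have "Re (of_real (mass y x) - of_real (1 / 2) * of_real (Aw x)) \<le> Re (of_real (mass y c) - of_real (1 / 2) * of_real (Aw c))"
    proof (rule primitive_on_Re_mono[OF J primitive_on_diff[OF mass_primitive[OF sys] primitive_on_cmult[OF P(3)]] xJ c(1) x(2) N(1)])
      fix t assume t: "t \<in> J - N" "t \<in> {x..c}"
      have "w t * (1 / 2) \<le> w t * (cmod (y t))\<^sup>2" using ysq[OF t(2)] N(2)[OF t(1)] by (intro mult_left_mono) auto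
      then show "0 \<le> Re (of_real (w t * (cmod (y t))\<^sup>2) - of_real (1 / 2) * of_real (cmod (of_real (w t) :: complex)))"
        using N(2)[OF t(1)] by (simp only: of_real_mult[symmetric] of_real_diff[symmetric] Re_complex_of_real) simp
    qed
    then have "mass y x - Aw x / 2 \<le> mass y c - Aw c / 2" by simp
    then have "(Aw c - Aw x) / 2 \<le> mass y c - mass y x" by (simp add: field_simps)
    moreover have "Aw c - Aw x = M' / r" using x(3) by simp
    ultimately have mass: "mass y c - mass y x \<ge> (M' / r) / 2" by (simp only:)
    \<comment> \<open>From \<open>c\<close> back to \<open>x\<close> the energy loses at least r / 2
      times the mass gathered on \<open>{x..c}\<close>, and |y|^2 \<ge> 1/2 makes this loss at least
      M' / 4.\<close>
    have "energy y y1 x - (r / 2) * mass y x \<le> energy y y1 c - (r / 2) * mass y c"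
      by (rule energy_mono[OF sys _ xJ c(1) x(2)]) (use sec in \<open>simp add: r_def\<close>)
    moreover have "energy y y1 c \<le> M"
    proof -
      have "energy y y1 c \<le> cmod (cis \<eta> * (y1 c * cnj (y c)))" unfolding energy_def by (rule complex_Re_le_cmod)
      also have "\<dots> = cmod (y1 c)" by (simp add: norm_mult yc)
      finally show ?thesis using y1c by simp
    qed
    moreover have "(r / 2) * (mass y c - mass y x) \<ge> (r / 2) * ((M' / r) / 2)"
      using mass r0 by (intro mult_left_mono) auto
    moreover have "(r / 2) * ((M' / r) / 2) = M' / 4" using r0 by simp
    ultimately have "energy y y1 x \<le> M - M' / 4" by (simp add: algebra_simps)
    moreover have "M' / 4 = 2 * M + 2" by (simp add: M'_def field_simps)
    ultimately have "energy y y1 x \<le> M - (2 * M + 2)" by (simp only:)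
    then have "energy y y1 x < 0" using M0 by simp
    \<comment> \<open>The condition at \<open>a\<close> keeps the energy of \<open>Y\<close>
      nonnegative, and normalisation multiplies it by a positive factor.\<close>
    moreover have "energy y y1 x \<ge> 0"
    proof -
      have "(r / 2) * mass (Y \<xi>) x \<le> energy (Y \<xi>) (Y1 \<xi>) x"
        by (rule energy_Y_ge[OF _ xJ]) (use sec in \<open>simp add: r_def\<close>)
      moreover have "0 \<le> mass (Y \<xi>) x"
        using mass_mono[OF sol_system a_in xJ] initial_interval_sub(2)[OF J xJ] mass_a by metis
      ultimately have "0 \<le> energy (Y \<xi>) (Y1 \<xi>) x"
        using r0 by (meson divide_nonneg_nonneg less_imp_le mult_nonneg_nonneg order.trans zero_le_numeral)
      then show ?thesis unfolding y_def y1_def energy_cmult by simp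
    qed
    ultimately show False by simp
  qed
  with R0 that show ?thesis by blast
qed

text \<open>Bounded in a sector and of order at most 1/2, \<open>Y \<xi> c\<close> is constant in
  \<open>\<xi>\<close>, and decay makes the constant 0; at a parameter inside the half-plane no
  energy is then left at \<open>c\<close> to dominate a positive mass.\<close>

lemma zero_exists_non_dirichlet:
  assumes c: "c \<in> J" "a < c" and gc: "g c \<noteq> 0"
  shows "\<exists>\<xi>. bracket (Y \<xi>) (Y1 \<xi>) g g1 c = 0"
proof (rule ccontr)
  assume "\<not> ?thesis"
  then have one: "\<And>\<xi>. Y \<xi> c * g1 c - Y1 \<xi> c * g c = 1" using zero_free_characteristic[OF c(1)] by blast
  \<comment> \<open>The rotation moves the half-plane of the energy estimates to Re z < 0, the
    position required by the sector theorem.\<close>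
  define F where "F = (\<lambda>z. Y (K + cis (- \<eta>) * z) c)"
  have rot: "cmod (cis (- \<eta>) * z) = cmod z" "(cis (- \<eta>) * z) * cis \<eta> = z" for z
  proof -
    show "cmod (cis (- \<eta>) * z) = cmod z" by (simp add: norm_mult)
    have "cis (- \<eta>) * cis \<eta> = 1" by (simp add: cis_mult)
    then show "(cis (- \<eta>) * z) * cis \<eta> = z" by (metis mult.commute mult.left_commute mult.right_neutral)
  qed
  obtain A B where AB: "0 \<le> A" "0 \<le> B" "\<And>\<xi>. cmod (Y \<xi> c) \<le> exp (A + B * sqrt (cmod (\<xi> - K)))"
    using Y_growth[OF c(1)] by metis
  have growth: "cmod (F z) \<le> exp (A + B * sqrt (cmod z))" for z
    using AB(3)[of "K + cis (- \<eta>) * z"] by (simp add: F_def rot)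
  have decay: "\<exists>R>0. \<forall>z. R \<le> cmod z \<and> Re z \<le> - cmod z / 2 \<longrightarrow> cmod (F z) < \<delta>" if "\<delta> > 0" for \<delta>
  proof -
    obtain R where R: "0 < R" "\<And>\<xi>. R \<le> cmod (\<xi> - K) \<Longrightarrow> Re ((\<xi> - K) * cis \<eta>) \<le> - cmod (\<xi> - K) / 2 \<Longrightarrow> cmod (Y \<xi> c) < \<delta>"
      using decay_in_sector[OF c one gc \<open>\<delta> > 0\<close>] by blast
    have "cmod (F z) < \<delta>" if "R \<le> cmod z" "Re z \<le> - cmod z / 2" for z
      using R(2)[of "K + cis (- \<eta>) * z"] that unfolding F_def add_diff_cancel_left' rot by blast
    with R(1) show ?thesis by blast
  qed
  obtain R1 where R1: "R1 > 0" "\<And>z. R1 \<le> cmod z \<Longrightarrow> Re z \<le> - cmod z / 2 \<Longrightarrow> cmod (F z) < 1"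
    using decay[of 1] by auto
  have const: "F z = F 0" for z
  proof (rule order_half_bounded_in_sector_constant[OF _ AB(1,2) growth])
    show "F holomorphic_on UNIV" unfolding F_def
      using holomorphic_on_compose_gen[of "\<lambda>z. K + cis (- \<eta>) * z" UNIV "\<lambda>\<xi>. Y \<xi> c" UNIV, unfolded o_def]
        sol_holomorphic(1)[OF c(1), of 1 0] by (simp add: holomorphic_intros)
    \<comment> \<open>Decay gives a bound far out only; the remaining bounded part of the sector is
      covered by the growth estimate.\<close>
    show "cmod (F z) \<le> max 1 (exp (A + B * sqrt R1))" if "Re z \<le> - cmod z / 2" for z
    proof (cases "R1 \<le> cmod z")
      case True
      then show ?thesis using R1(2)[OF _ that] by fastforce
    next
      case False
      then have "A + B * sqrt (cmod z) \<le> A + B * sqrt R1" using AB(2) by (simp add: mult_left_mono)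
      then have "exp (A + B * sqrt (cmod z)) \<le> exp (A + B * sqrt R1)" by simp
      then show ?thesis using growth[of z] by linarith
    qed
  qed
  have F0: "F 0 = 0"
  proof (rule ccontr)
    assume "F 0 \<noteq> 0"
    then obtain R where R: "R > 0" "\<forall>z. R \<le> cmod z \<and> Re z \<le> - cmod z / 2 \<longrightarrow> cmod (F z) < cmod (F 0)"
      using decay[of "cmod (F 0)"] by auto
    then have "cmod (F (of_real (- R))) < cmod (F 0)" by auto
    then show False using const[of "of_real (- R)"] by simp
  qed
  \<comment> \<open>A point at distance 1 inside the half-plane, where the energy dominates the mass
    with factor 1.\<close>
  define \<xi> where "\<xi> = K + cis (- \<eta>) * (-1)"
  have "Y \<xi> c = 0" using const[of "-1"] F0 by (simp add: F_def \<xi>_def)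
  then have "energy (Y \<xi>) (Y1 \<xi>) c = 0" by (simp add: energy_def)
  moreover have "1 \<le> - Re ((\<xi> - K) * cis \<eta>)"
    unfolding \<xi>_def add_diff_cancel_left' rot by simp
  then have "1 * mass (Y \<xi>) c \<le> energy (Y \<xi>) (Y1 \<xi>) c" by (rule energy_Y_ge[OF _ c(1)])
  moreover have "0 < mass (Y \<xi>) c" by (rule mass_pos[OF sol_system Y_nontrivial c])
  ultimately show False by simp
qed

text \<open>With the Dirichlet condition at \<open>c\<close>, a zero-free characteristic function would make the trace
  \<open>\<integral> w y \<omega>\<close> of the resolvent vanish, where \<open>\<omega>\<close> is the solution with \<open>\<omega> c = 0\<close>; but the energies
  of \<open>y\<close> and \<open>\<omega>\<close> force the integrand into a half-plane.\<close>

lemma zero_exists_dirichlet: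
  assumes c: "c \<in> J" "a < c" and gc: "g c = 0"
  shows "\<exists>\<xi>. bracket (Y \<xi>) (Y1 \<xi>) g g1 c = 0"
proof (rule ccontr)
  assume "\<not> ?thesis"
  then have one: "Y \<xi> c * g1 c = 1" for \<xi> using zero_free_characteristic[OF c(1), of \<xi>] gc by simp
  \<comment> \<open>As \<open>g c = 0\<close>, the characteristic function is
    \<open>Y \<xi> c * g1 c\<close>; its constancy freezes the value \<open>Y \<xi> c\<close> for
    all parameters.\<close>
  define k where "k = inverse (g1 c)"
  have k: "k \<noteq> 0" and Yk: "Y \<xi> c = k" for \<xi>
    using one[of \<xi>] inverse_unique[of "g1 c" "Y \<xi> c"] by (auto simp: k_def mult.commute)
  define \<xi>0 where "\<xi>0 = K - cis (- \<eta>)"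
  have half: "1 \<le> - Re ((\<xi>0 - K) * cis \<eta>)" by (simp add: \<xi>0_def cis_mult)
  define T where "T = sol 0 1 \<xi>0"
  define T1 where "T1 = sol1 0 1 \<xi>0"
  \<comment> \<open>A solution vanishing at \<open>c\<close>, scaled so that its Wronskian with
    \<open>Y \<xi>0\<close> is \<open>k\<close>.\<close>
  define \<omega> where "\<omega> = (\<lambda>x. k * T x + (- T c) * Y \<xi>0 x)"
  define \<omega>1 where "\<omega>1 = (\<lambda>x. k * T1 x + (- T c) * Y1 \<xi>0 x)"
  have chi: "system \<omega> \<omega>1 (\<lambda>x. \<xi>0 * \<omega> x)"
  proof -
    have "system \<omega> \<omega>1 (\<lambda>x. k * (\<xi>0 * T x) + (- T c) * (\<xi>0 * Y \<xi>0 x))"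
      unfolding \<omega>_def \<omega>1_def T_def T1_def by (intro sl_system_add sl_system_cmult sol_system)
    moreover have "(\<lambda>x. k * (\<xi>0 * T x) + (- T c) * (\<xi>0 * Y \<xi>0 x)) = (\<lambda>x. \<xi>0 * \<omega> x)"
      by (simp add: \<omega>_def fun_eq_iff algebra_simps)
    ultimately show ?thesis by simp
  qed
  have chic: "\<omega> c = 0" by (simp add: \<omega>_def Yk)
  have wr: "Y \<xi>0 x * \<omega>1 x - Y1 \<xi>0 x * \<omega> x = k" if x: "x \<in> J" for x
  proof -
    have "bracket (Y \<xi>0) (Y1 \<xi>0) \<omega> \<omega>1 x = k * bracket (Y \<xi>0) (Y1 \<xi>0) T T1 x"
      by (simp add: bracket_def \<omega>_def \<omega>1_def algebra_simps)
    also have "bracket (Y \<xi>0) (Y1 \<xi>0) T T1 x = 1"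
      unfolding T_def T1_def by (rule sl_basis.wronskian[OF sl_basis_sol x])
    finally show ?thesis by (simp add: bracket_def)
  qed
  \<comment> \<open>Lagrange's identity for two parameters: the bracket equals \<open>k\<close> at
    both ends, at \<open>a\<close> because initial values do not depend on the parameter, at
    \<open>c\<close> because \<open>\<omega>\<close> vanishes and \<open>Y\<close> is frozen
    there.\<close>
  have orth: "integral {a..c} (\<lambda>x. of_real (w x) * Y \<xi> x * \<omega> x) = 0" if ne: "\<xi> \<noteq> \<xi>0" for \<xi>
  proof -
    have "prim (\<lambda>x. of_real (w x) * ((\<xi> * Y \<xi> x) * \<omega> x - Y \<xi> x * (\<xi>0 * \<omega> x))) (bracket (Y \<xi>) (Y1 \<xi>) \<omega> \<omega>1)"
      by (rule bracket_primitive[OF sol_system chi])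
    then have P: "prim (\<lambda>x. (\<xi> - \<xi>0) * (of_real (w x) * Y \<xi> x * \<omega> x)) (bracket (Y \<xi>) (Y1 \<xi>) \<omega> \<omega>1)"
      by (rule primitive_on_cong_ae[OF _ J negligible_empty]) (simp add: algebra_simps)
    have "bracket (Y \<xi>) (Y1 \<xi>) \<omega> \<omega>1 a = k"
      using wr[OF a_in] by (simp add: bracket_def Y_a)
    moreover have "bracket (Y \<xi>) (Y1 \<xi>) \<omega> \<omega>1 c = k"
      using wr[OF c(1)] by (simp add: bracket_def chic Yk)
    ultimately have "integral {a..c} (\<lambda>x. (\<xi> - \<xi>0) * (of_real (w x) * Y \<xi> x * \<omega> x)) = 0"
      using primitive_on_value[OF P c(1)] by simp
    then show ?thesis using ne by simp
  qed
  \<comment> \<open>Equal parameters are reached by a limit, as the identity divides by their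
    difference. This integral is the derivative of \<open>Y \<xi> c\<close> at
    \<open>\<xi>0\<close>.\<close>
  have orth0: "integral {a..c} (\<lambda>x. of_real (w x) * Y \<xi>0 x * \<omega> x) = 0"
  proof -
    define X where "X = (\<lambda>n::nat. \<xi>0 + 1 / of_nat (Suc n))"
    have "(\<lambda>n. 1 / of_nat (Suc n) :: complex) \<longlonglongrightarrow> 0" by (rule LIMSEQ_Suc[OF lim_1_over_n])
    then have X: "X \<longlonglongrightarrow> \<xi>0 + 0" unfolding X_def by (intro tendsto_add tendsto_const)
    have Xb: "cmod (X n - \<zeta>) \<le> cmod (\<xi>0 - \<zeta>) + 1" for n
    proof -
      have "cmod (X n - \<zeta>) = cmod ((\<xi>0 - \<zeta>) + 1 / of_nat (Suc n))" by (simp add: X_def algebra_simps)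
      also have "\<dots> \<le> cmod (\<xi>0 - \<zeta>) + cmod (1 / of_nat (Suc n))" by (rule norm_triangle_ineq)
      also have "cmod (1 / of_nat (Suc n)) \<le> 1" unfolding norm_divide norm_of_nat by simp
      finally show ?thesis by simp
    qed
    \<comment> \<open>A bound for the coefficients that is uniform along the sequence, whose
      distance from the base point stays bounded.\<close>
    define B where "B = exp ((cmod (\<xi>0 - \<zeta>) + 1) * total c)"
    have "(\<lambda>n. integral {a..c} (\<lambda>x. of_real (w x) * Y (X n) x * \<omega> x)) \<longlonglongrightarrow> integral {a..c} (\<lambda>x. of_real (w x) * Y \<xi>0 x * \<omega> x)"
    proof (rule dominated_convergence(2))
      show "(\<lambda>x. of_real (w x) * Y (X n) x * \<omega> x) integrable_on {a..c}" for n
        unfolding mult.assoc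
        by (intro set_lebesgue_integral_eq_integral(1) continuous_weight_integrable c(1) continuous_on_mult
            system_continuous(1)[OF sol_system c(1)] system_continuous(1)[OF chi c(1)])
      have "(\<lambda>x. complex_of_real (w x) * complex_of_real (B * (cmod (f x) + cmod (g x)) * cmod (\<omega> x))) absolutely_integrable_on {a..c}"
        by (intro continuous_weight_integrable c(1) continuous_intros system_continuous(1)[OF f c(1)]
            system_continuous(1)[OF g c(1)] system_continuous(1)[OF chi c(1)])
      from absolutely_integrable_norm[OF this]
      show "(\<lambda>x. cmod (complex_of_real (w x) * complex_of_real (B * (cmod (f x) + cmod (g x)) * cmod (\<omega> x)))) integrable_on {a..c}"
        by (simp only: o_def set_lebesgue_integral_eq_integral(1))
      fix n x assume "x \<in> {a..c}"
      then have x: "x \<in> J" "x \<le> c" using sub[OF c(1)] by auto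
      have "exp (cmod (X n - \<zeta>) * total c) \<le> B"
        unfolding B_def using Xb[of n] total_nonneg[OF c(1)] by (simp add: mult_right_mono)
      then have cb: "cmod (coef1 1 0 (X n - \<zeta>) x) \<le> B" "cmod (coef2 1 0 (X n - \<zeta>) x) \<le> B"
        using coef_bound[OF x(1) c(1) x(2), of 1 0 "X n - \<zeta>"] by simp_all
      have "cmod (Y (X n) x) \<le> cmod (coef1 1 0 (X n - \<zeta>) x) * cmod (f x) + cmod (coef2 1 0 (X n - \<zeta>) x) * cmod (g x)"
        unfolding sol_def by (metis norm_mult norm_triangle_ineq)
      also have "\<dots> \<le> B * cmod (f x) + B * cmod (g x)"
        using cb by (intro add_mono mult_right_mono) auto
      also have "\<dots> = B * (cmod (f x) + cmod (g x))" by (simp add: algebra_simps)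
      finally have yb: "cmod (Y (X n) x) \<le> B * (cmod (f x) + cmod (g x))" .
      have "0 \<le> B" by (simp add: B_def)
      then have "0 \<le> B * (cmod (f x) + cmod (g x)) * cmod (\<omega> x)" by simp
      then have rhs: "cmod (complex_of_real (w x) * complex_of_real (B * (cmod (f x) + cmod (g x)) * cmod (\<omega> x)))
          = \<bar>w x\<bar> * (B * (cmod (f x) + cmod (g x)) * cmod (\<omega> x))"
        by (simp only: norm_mult[of "complex_of_real (w x)"] norm_of_real abs_of_nonneg)
      have "norm (of_real (w x) * Y (X n) x * \<omega> x) = \<bar>w x\<bar> * (cmod (Y (X n) x) * cmod (\<omega> x))"
        by (simp add: norm_mult)
      also have "\<dots> \<le> \<bar>w x\<bar> * (B * (cmod (f x) + cmod (g x)) * cmod (\<omega> x))"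
        using yb by (intro mult_left_mono mult_right_mono) auto
      finally show "norm (of_real (w x) * Y (X n) x * \<omega> x) \<le> cmod (complex_of_real (w x) * complex_of_real (B * (cmod (f x) + cmod (g x)) * cmod (\<omega> x)))"
        unfolding rhs .
    next
      fix x assume "x \<in> {a..c}"
      then have x: "x \<in> J" using sub[OF c(1)] by auto
      have "isCont (\<lambda>\<xi>. Y \<xi> x) \<xi>0"
        using holomorphic_on_imp_continuous_on[OF sol_holomorphic(1)[OF x, of 1 0]] by (simp add: continuous_on_eq_continuous_at)
      then have "(\<lambda>n. Y (X n) x) \<longlonglongrightarrow> Y \<xi>0 x" using isCont_tendsto_compose[OF _ X, of "\<lambda>\<xi>. Y \<xi> x"] by simp
      then show "(\<lambda>n. of_real (w x) * Y (X n) x * \<omega> x) \<longlonglongrightarrow> of_real (w x) * Y \<xi>0 x * \<omega> x"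
        by (intro tendsto_intros)
    qed
    moreover have "integral {a..c} (\<lambda>x. of_real (w x) * Y (X n) x * \<omega> x) = 0" for n
    proof (rule orth)
      have "(1 / of_nat (Suc n) :: complex) \<noteq> 0" by (simp del: of_nat_Suc)
      then show "X n \<noteq> \<xi>0" unfolding X_def by (metis add_cancel_left_right)
    qed
    ultimately show ?thesis by (simp add: LIMSEQ_const_iff)
  qed
  have int: "(\<lambda>t. of_real (w t) * (Y \<xi>0 t * \<omega> t)) absolutely_integrable_on {a..x}" if "x \<in> J" for x
    by (intro continuous_weight_integrable that continuous_on_mult system_continuous(1)[OF sol_system that] system_continuous(1)[OF chi that])
  define I where "I = (\<lambda>x. 0 + integral {a..x} (\<lambda>t. of_real (w t) * (Y \<xi>0 t * \<omega> t)))"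
  have "prim (\<lambda>t. of_real (w t) * (Y \<xi>0 t * \<omega> t)) I"
    unfolding I_def using int by (rule primitive_on_integral[OF J])
  then have P: "prim (\<lambda>t. - (cis \<eta> * k) * cnj (of_real (w t) * (Y \<xi>0 t * \<omega> t))) (\<lambda>x. - (cis \<eta> * k) * cnj (I x))"
    by (intro primitive_on_cmult primitive_on_cnj)
  have I: "I c = 0" "I a = 0" using orth0 by (simp_all add: I_def mult.assoc)
  obtain N where N: "negligible N"
    "\<And>x. x \<in> J - N \<Longrightarrow> admissible x"
    using sector_exceptional_set by blast
  \<comment> \<open>\<open>\<omega>\<close> has no energy at \<open>c\<close>, so its energy is
    nonpositive to the left of \<open>c\<close>, opposite in sign to that of
    \<open>Y\<close>.\<close>
  have Ech: "energy \<omega> \<omega>1 t \<le> 0" if t: "t \<in> J" "t \<le> c" for t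
  proof -
    have "energy \<omega> \<omega>1 t - 1 * mass \<omega> t \<le> energy \<omega> \<omega>1 c - 1 * mass \<omega> c"
      by (rule energy_mono[OF chi half t(1) c(1) t(2)])
    moreover have "energy \<omega> \<omega>1 c = 0" by (simp add: energy_def chic)
    moreover have "mass \<omega> t \<le> mass \<omega> c" by (rule mass_mono[OF chi t(1) c(1) t(2)])
    ultimately show ?thesis by simp
  qed
  have EY: "mass (Y \<xi>0) t \<le> energy (Y \<xi>0) (Y1 \<xi>0) t" if "t \<in> J" for t
    using energy_Y_ge[OF half that] by simp
  \<comment> \<open>Writing the constant \<open>k\<close> as the Wronskian at \<open>t\<close>
    splits the rotated integrand into the two energies; their opposite signs make both terms
    nonnegative.\<close>
  have dens: "Re (- (cis \<eta> * k) * cnj (of_real (w t) * (Y \<xi>0 t * \<omega> t)))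
      = w t * ((cmod (\<omega> t))\<^sup>2 * energy (Y \<xi>0) (Y1 \<xi>0) t - (cmod (Y \<xi>0 t))\<^sup>2 * energy \<omega> \<omega>1 t)" if t: "t \<in> J" for t
  proof -
    have "- (cis \<eta> * k) * cnj (of_real (w t) * (Y \<xi>0 t * \<omega> t))
      = of_real (w t) * (of_real ((cmod (\<omega> t))\<^sup>2) * (cis \<eta> * (Y1 \<xi>0 t * cnj (Y \<xi>0 t))) - of_real ((cmod (Y \<xi>0 t))\<^sup>2) * (cis \<eta> * (\<omega>1 t * cnj (\<omega> t))))"
      unfolding complex_norm_square wr[OF t, symmetric] by (simp add: algebra_simps)
    moreover have "Re (of_real r1 * (of_real r2 * z2 - of_real r3 * z3)) = r1 * (r2 * Re z2 - r3 * Re z3)" for r1 r2 r3 z2 z3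
      by simp
    ultimately show ?thesis unfolding energy_def by metis
  qed
  have nonneg: "0 \<le> (cmod (\<omega> t))\<^sup>2 * energy (Y \<xi>0) (Y1 \<xi>0) t" "0 \<le> - ((cmod (Y \<xi>0 t))\<^sup>2 * energy \<omega> \<omega>1 t)"
    if t: "t \<in> J" "t \<le> c" for t
  proof -
    have "0 \<le> mass (Y \<xi>0) t"
      using mass_mono[OF sol_system a_in t(1)] initial_interval_sub(2)[OF J t(1)] mass_a by metis
    then have "0 \<le> energy (Y \<xi>0) (Y1 \<xi>0) t" using EY[OF t(1)] by linarith
    then show "0 \<le> (cmod (\<omega> t))\<^sup>2 * energy (Y \<xi>0) (Y1 \<xi>0) t" by simp
    show "0 \<le> - ((cmod (Y \<xi>0 t))\<^sup>2 * energy \<omega> \<omega>1 t)" using Ech[OF t] by (simp add: mult_nonneg_nonpos)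
  qed
  have ac: "a \<le> c" using c by simp
  \<comment> \<open>A nonnegative density with integral 0 vanishes almost everywhere.\<close>
  obtain N' where N': "negligible N'" "\<And>t. t \<in> {a..c} - N' \<Longrightarrow> Re (- (cis \<eta> * k) * cnj (of_real (w t) * (Y \<xi>0 t * \<omega> t))) = 0"
  proof (rule primitive_on_Re_flat[OF J P a_in c(1) ac N(1)])
    fix t assume t: "t \<in> J - N" "t \<in> {a..c}"
    have tJ: "t \<in> J" "t \<le> c" using t by auto
    show "0 \<le> Re (- (cis \<eta> * k) * cnj (of_real (w t) * (Y \<xi>0 t * \<omega> t)))"
      unfolding dens[OF tJ(1)] using nonneg[OF tJ] N(2)[OF t(1)] by (intro mult_nonneg_nonneg) auto
  next
    show "Re (- (cis \<eta> * k) * cnj (I c)) \<le> Re (- (cis \<eta> * k) * cnj (I a))" by (simp only: I)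
  qed blast
  \<comment> \<open>To the right of \<open>a\<close> the energy of \<open>Y\<close> is strictly
    positive, which leaves \<open>\<omega> = 0\<close>, in conflict with the nonzero
    Wronskian.\<close>
  have "\<omega> t = 0" if t: "t \<in> {a..c} - (N \<union> N' \<union> {a})" for t
  proof -
    have tJ: "t \<in> J" "t \<le> c" "t \<in> J - N" "t \<in> {a..c} - N'" "a < t" using t sub[OF c(1)] by auto
    have "w t * ((cmod (\<omega> t))\<^sup>2 * energy (Y \<xi>0) (Y1 \<xi>0) t - (cmod (Y \<xi>0 t))\<^sup>2 * energy \<omega> \<omega>1 t) = 0"
      using N'(2)[OF tJ(4)] unfolding dens[OF tJ(1)] .
    then have "(cmod (\<omega> t))\<^sup>2 * energy (Y \<xi>0) (Y1 \<xi>0) t = 0"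
      using nonneg[OF tJ(1,2)] N(2)[OF tJ(3)] by simp
    moreover have "0 < energy (Y \<xi>0) (Y1 \<xi>0) t"
      using mass_pos[OF sol_system Y_nontrivial tJ(1,5), of \<xi>0] EY[OF tJ(1)] by linarith
    ultimately show ?thesis by simp
  qed
  moreover have "negligible (N \<union> N' \<union> {a})" using N(1) N'(1) by simp
  moreover have "{a..c} \<in> sets lebesgue" by simp
  ultimately have "AE x in lebesgue_on {a..c}. \<omega> x = 0"
    using AE_lebesgue_on_iff_negligible[of "{a..c}" "\<lambda>x. \<omega> x = 0"] by blast
  moreover have "\<omega> a \<noteq> 0 \<or> \<omega>1 a \<noteq> 0" using wr[OF a_in] k by auto
  ultimately show False
    using sl_coefficients.solution_not_AE_zero[OF restrict[OF c(1)] sl_system_subset[OF chi sub[OF c(1)]], of c] c by simp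
qed

lemma zero_exists:
  assumes "c \<in> J" "a < c"
  shows "\<exists>\<xi>. bracket (Y \<xi>) (Y1 \<xi>) g g1 c = 0"
  using zero_exists_dirichlet[OF assms] zero_exists_non_dirichlet[OF assms] by blast

end

section \<open>Zeros of a locally uniform limit\<close>

text \<open>Choosing for \<open>l n\<close> a zero of \<open>D n\<close> nearest to \<open>z\<close>
  defines the sequence for all \<open>n\<close> at once, and Hurwitz's theorem forces it to
  converge. \<open>zeros\<close> provides the terms of small index.\<close>

lemma hurwitz_zero_sets:
  fixes D :: "nat \<Rightarrow> complex \<Rightarrow> complex" and E :: "complex \<Rightarrow> complex"
  assumes hol: "\<And>n. D n holomorphic_on UNIV" and lim: "\<And>C. compact C \<Longrightarrow> uniform_limit C D E sequentially"
    and nz: "E z1 \<noteq> 0" and zeros: "\<And>n. \<exists>z. D n z = 0"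
  shows "E z = 0 \<Longrightarrow> \<exists>l. (\<forall>n. D n (l n) = 0) \<and> l \<longlonglongrightarrow> z"
    and "(\<And>n. D n (l n) = 0) \<Longrightarrow> l \<longlonglongrightarrow> z \<Longrightarrow> E z = 0"
proof -
  have E: "E holomorphic_on UNIV"
    by (rule holomorphic_uniform_sequence[OF open_UNIV hol]) (auto intro!: exI[of _ 1] lim)
  show "\<exists>l. (\<forall>n. D n (l n) = 0) \<and> l \<longlonglongrightarrow> z" if z: "E z = 0"
  proof -
    have nonconst: "\<not> E constant_on ball z e" if e: "e > 0" for e
    proof
      assume "E constant_on ball z e"
      then have "E x = 0" if "x \<in> ball z e" for x
        using that e z unfolding constant_on_def by (metis centre_in_ball)
      then have "E z1 = 0"
        using analytic_continuation_open[of "ball z e" UNIV E "\<lambda>_. 0" z1] e E by auto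
      with nz show False by simp
    qed
    have near: "\<forall>\<^sub>F n in sequentially. \<exists>y\<in>ball z e. D n y = 0" if e: "e > 0" for e
    proof (rule ccontr)
      assume "\<not> ?thesis"
      \<comment> \<open>Hurwitz's theorem is applied to a subsequence without zeros near
        \<open>z\<close>; it would make \<open>E z\<close> nonzero.\<close>
      then have "\<exists>\<^sub>F n in sequentially. \<forall>y\<in>ball z e. D n y \<noteq> 0" by (simp add: frequently_def)
      then have "infinite {n. \<forall>y\<in>ball z e. D n y \<noteq> 0}"
        by (simp add: frequently_cofinite[symmetric] cofinite_eq_sequentially)
      then obtain r :: "nat \<Rightarrow> nat" where r: "strict_mono r" "\<And>k. r k \<in> {n. \<forall>y\<in>ball z e. D n y \<noteq> 0}"
        using infinite_enumerate by blast
      have "E z \<noteq> 0"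
      proof (rule Hurwitz_no_zeros[of "ball z e" "\<lambda>k. D (r k)" E z])
        show "D (r k) holomorphic_on ball z e" for k using hol holomorphic_on_subset by blast
        show "E holomorphic_on ball z e" using E holomorphic_on_subset by blast
        show "uniform_limit C (\<lambda>k. D (r k)) E sequentially" if "compact C" for C
          using filterlim_compose[OF lim[OF that] filterlim_subseq[OF r(1)]] .
        show "D (r k) y \<noteq> 0" if "y \<in> ball z e" for k y using r(2)[of k] that by blast
      qed (use e nonconst in auto)
      with z show False by simp
    qed
    have "\<exists>y. D n y = 0 \<and> infdist z {x. D n x = 0} = dist z y" for n
    proof -
      have "closed (UNIV \<inter> D n -` {0})"
        using hol[of n] by (intro continuous_closed_preimage holomorphic_on_imp_continuous_on) auto
      then have "closed {x. D n x = 0}" by (simp add: vimage_def)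
      then show ?thesis using infdist_attains_inf[of "{x. D n x = 0}" z] zeros[of n] by (metis (mono_tags) empty_Collect_eq mem_Collect_eq)
    qed
    then have "\<exists>l. \<forall>n. D n (l n) = 0 \<and> infdist z {x. D n x = 0} = dist z (l n)" by (intro choice allI)
    then obtain l where l: "\<And>n. D n (l n) = 0" "\<And>n. infdist z {x. D n x = 0} = dist z (l n)" by blast
    have "l \<longlonglongrightarrow> z"
    proof (rule tendstoI)
      fix e :: real assume "e > 0"
      from near[OF this] show "\<forall>\<^sub>F n in sequentially. dist (l n) z < e"
      proof (rule eventually_mono)
        fix n assume "\<exists>y\<in>ball z e. D n y = 0"
        then obtain y where y: "dist z y < e" "D n y = 0" by auto
        then have "infdist z {x. D n x = 0} \<le> dist z y" by (intro infdist_le) simp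
        then show "dist (l n) z < e" using y(1) l(2)[of n] by (simp add: dist_commute)
      qed
    qed
    with l(1) show ?thesis by blast
  qed
  show "E z = 0" if l0: "\<And>n. D n (l n) = 0" and l: "l \<longlonglongrightarrow> z"
  proof -
    have "(\<lambda>n. E (l n)) \<longlonglongrightarrow> 0"
    proof (rule tendstoI)
      fix e :: real assume "e > 0"
      \<comment> \<open>Uniformity on a compact neighbourhood is what allows the argument
        \<open>l n\<close> to move with \<open>n\<close>.\<close>
      have "\<forall>\<^sub>F n in sequentially. \<forall>x\<in>cball z 1. dist (D n x) (E x) < e"
        using uniform_limitD[OF lim[OF compact_cball] \<open>e > 0\<close>] .
      moreover have "\<forall>\<^sub>F n in sequentially. dist (l n) z < 1" using tendstoD[OF l, of 1] by simp
      ultimately show "\<forall>\<^sub>F n in sequentially. dist (E (l n)) 0 < e"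
      proof eventually_elim
        case (elim n)
        then have "dist (D n (l n)) (E (l n)) < e" by (simp add: dist_commute less_imp_le)
        then show ?case using l0[of n] by (simp add: dist_commute)
      qed
    qed
    moreover have "(\<lambda>n. E (l n)) \<longlonglongrightarrow> E z"
      using isCont_tendsto_compose[OF _ l, of E] holomorphic_on_imp_continuous_on[OF E]
      by (simp add: continuous_on_eq_continuous_at)
    ultimately show "E z = 0" by (rule LIMSEQ_unique[symmetric])
  qed
qed

section \<open>Square-integrability of all solutions, and the endpoint\<close>

context sl_coefficients
begin

lemma L2w_restrict:
  assumes f: "f \<in> L2w J w" and c: "c \<in> J"
  shows "f \<in> L2w {a..c} w"
proof -
  have rr: "restrict_space (lebesgue_on J) {a..c} = lebesgue_on {a..c}"
    using sub[OF c] by (simp add: restrict_restrict_space Int_absorb1 J_lebesgue)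
  have "f \<in> borel_measurable (lebesgue_on {a..c})"
    using measurable_restrict_space1[OF L2w_measurable[OF f], of "{a..c}"] rr by simp
  moreover have "set_integrable lebesgue J (\<lambda>x. (cmod (f x))\<^sup>2 * w x)"
    using L2w_integrable[OF f] J_lebesgue by (simp add: integrable_restrict_space set_integrable_def)
  then have "set_integrable lebesgue {a..c} (\<lambda>x. (cmod (f x))\<^sup>2 * w x)"
    by (rule set_integrable_subset) (use sub[OF c] in auto)
  then have "integrable (lebesgue_on {a..c}) (\<lambda>x. (cmod (f x))\<^sup>2 * w x)"
    by (simp add: integrable_restrict_space set_integrable_def)
  ultimately show ?thesis by (simp add: L2w_def)
qed

text \<open>What remains beyond \<open>x\<close> is the integral over t > x, dominated by the tail
  of |h|; along an exhausting sequence these tails tend to 0. The bound holds for all later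
  \<open>x\<close>, which gives convergence in the filter at the end point.\<close>

lemma primitive_tail:
  assumes y: "prim h y" and h: "integrable (lebesgue_on J) h" and e: "e > 0"
  obtains x0 where "x0 \<in> J" "\<And>x. x \<in> J \<Longrightarrow> x0 \<le> x \<Longrightarrow> cmod (y x - (y a + integral\<^sup>L (lebesgue_on J) h)) < e"
proof -
  obtain X :: "nat \<Rightarrow> real" where X: "\<And>n. X n \<in> J" "\<And>x. x \<in> J \<Longrightarrow> eventually (\<lambda>n. x \<le> X n) sequentially"
    using initial_interval_exhaustion[OF J] by blast
  have m: "(\<lambda>t. indicator {x<..} t *\<^sub>R h t) \<in> borel_measurable (lebesgue_on J)" for x
  proof -
    have "(\<lambda>t. indicator {x<..} t :: real) \<in> borel_measurable (lebesgue_on J)"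
      by (intro measurable_restrict_space1 borel_measurable_indicator) (simp add: borel_open)
    then show ?thesis using borel_measurable_integrable[OF h] by measurable
  qed
  have i: "integrable (lebesgue_on J) (\<lambda>t. indicator {x<..} t *\<^sub>R h t)" for x
    by (rule Bochner_Integration.integrable_bound[OF h m]) (auto simp: indicator_def)
  have eq: "y a + integral\<^sup>L (lebesgue_on J) h - y x = integral\<^sup>L (lebesgue_on J) (\<lambda>t. indicator {x<..} t *\<^sub>R h t)" if x: "x \<in> J" for x
  proof -
    have "integral {a..x} h = integral\<^sup>L (lebesgue_on J) (\<lambda>t. h t - indicator {x<..} t *\<^sub>R h t)"
    proof -
      have "integral {a..x} h = (LINT t:{a..x}|lebesgue. h t)"
        using set_lebesgue_integral_eq_integral(2)[OF integrable_on_initial[OF h x]] by simp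
      also have "\<dots> = (LINT t:J|lebesgue. (h t - indicator {x<..} t *\<^sub>R h t))"
        unfolding set_lebesgue_integral_def using sub[OF x] J
        by (intro Bochner_Integration.integral_cong) (auto simp: indicator_def initial_interval_def)
      also have "\<dots> = integral\<^sup>L (lebesgue_on J) (\<lambda>t. h t - indicator {x<..} t *\<^sub>R h t)"
        using J_lebesgue by (simp add: integral_restrict_space set_lebesgue_integral_def)
      finally show ?thesis .
    qed
    also have "\<dots> = integral\<^sup>L (lebesgue_on J) h - integral\<^sup>L (lebesgue_on J) (\<lambda>t. indicator {x<..} t *\<^sub>R h t)"
      by (rule Bochner_Integration.integral_diff[OF h i])
    finally show ?thesis using primitive_on_value[OF y x] by (simp add: algebra_simps)
  qed
  have i': "integrable (lebesgue_on J) (\<lambda>t. indicator {x<..} t * cmod (h t))" for x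
    using integrable_norm[OF i[of x]] by simp
  have "(\<lambda>n. integral\<^sup>L (lebesgue_on J) (\<lambda>t. indicator {X n<..} t * cmod (h t))) \<longlonglongrightarrow> integral\<^sup>L (lebesgue_on J) (\<lambda>t. 0 :: real)"
  proof (rule integral_dominated_convergence)
    show "integrable (lebesgue_on J) (\<lambda>t. cmod (h t))" using h by simp
    show "(\<lambda>t. indicator {X n<..} t * cmod (h t)) \<in> borel_measurable (lebesgue_on J)" for n
      using borel_measurable_integrable[OF i'] .
    have "(\<lambda>n. indicator {X n<..} t * cmod (h t)) \<longlonglongrightarrow> 0" if t: "t \<in> J" for t
      by (rule tendsto_eventually, rule eventually_mono[OF X(2)[OF t]]) simp
    then show "AE t in lebesgue_on J. (\<lambda>n. indicator {X n<..} t * cmod (h t)) \<longlonglongrightarrow> 0"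
      by (intro AE_I2) simp
    show "AE t in lebesgue_on J. norm (indicator {X n<..} t * cmod (h t)) \<le> cmod (h t)" for n
      by (intro AE_I2) (simp add: indicator_def)
  qed simp
  then have "(\<lambda>n. integral\<^sup>L (lebesgue_on J) (\<lambda>t. indicator {X n<..} t * cmod (h t))) \<longlonglongrightarrow> 0" by simp
  from order_tendstoD(2)[OF this e] obtain n where n: "integral\<^sup>L (lebesgue_on J) (\<lambda>t. indicator {X n<..} t * cmod (h t)) < e"
    by (auto simp: eventually_sequentially)
  have "cmod (y x - (y a + integral\<^sup>L (lebesgue_on J) h)) < e" if x: "x \<in> J" "X n \<le> x" for x
  proof -
    have "cmod (y x - (y a + integral\<^sup>L (lebesgue_on J) h)) = cmod (integral\<^sup>L (lebesgue_on J) (\<lambda>t. indicator {x<..} t *\<^sub>R h t))"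
      using eq[OF x(1)] by (metis norm_minus_commute)
    also have "\<dots> \<le> integral\<^sup>L (lebesgue_on J) (\<lambda>t. cmod (indicator {x<..} t *\<^sub>R h t))" by (rule integral_norm_bound)
    also have "\<dots> \<le> integral\<^sup>L (lebesgue_on J) (\<lambda>t. indicator {X n<..} t * cmod (h t))"
      using x(2) by (intro integral_mono integrable_norm i i') (auto simp: indicator_def)
    finally show ?thesis using n by simp
  qed
  with X(1)[of n] that show ?thesis by blast
qed

end

context sl_basis
begin

section \<open>From one spectral parameter to all\<close>

text \<open>\<open>kernel\<close> is the weighted square of |f| + |g|, hence integrable over all of
  \<open>J\<close> when both basis solutions are square integrable.\<close>

lemma total_bounded:
  assumes "f \<in> L2w J w" "g \<in> L2w J w"
  obtains T where "\<And>x. x \<in> J \<Longrightarrow> total x \<le> T"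
proof -
  have 1: "(\<lambda>x. cmod (f x) + cmod (g x)) \<in> borel_measurable (lebesgue_on J)"
    using L2w_measurable[OF assms(1)] L2w_measurable[OF assms(2)] by measurable
  have "(\<lambda>x. complex_of_real (cmod (f x) + cmod (g x))) \<in> L2w J w"
  proof (rule L2w_dominated(1)[OF assms])
    show "(\<lambda>x. complex_of_real (cmod (f x) + cmod (g x))) \<in> borel_measurable (lebesgue_on J)"
      using 1 by measurable
    show "AE x in lebesgue_on J. cmod (complex_of_real (cmod (f x) + cmod (g x))) \<le> 1 * (cmod (f x) + cmod (g x))"
      unfolding norm_of_real by simp
  qed
  from L2w_product[OF this this]
  have i: "integrable (lebesgue_on J) (\<lambda>t. complex_of_real (kernel t))"
    by (simp add: kernel_def power2_eq_square mult.assoc)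
  have "total x \<le> integral\<^sup>L (lebesgue_on J) (\<lambda>t. cmod (complex_of_real (kernel t)))" if x: "x \<in> J" for x
    using increment_norm_bound[OF total_primitive i x order.refl] by (simp add: total_a)
  then show ?thesis using that by blast
qed

lemma sol_L2w:
  assumes "f \<in> L2w J w" "g \<in> L2w J w"
  shows "sol u0 v0 \<xi> \<in> L2w J w"
proof -
  obtain T where T: "\<And>x. x \<in> J \<Longrightarrow> total x \<le> T" using total_bounded[OF assms] by blast
  define B where "B = (cmod u0 + cmod v0) * exp (cmod (\<xi> - \<zeta>) * T)"
  show ?thesis
  proof (rule L2w_dominated(1)[OF assms])
    show "sol u0 v0 \<xi> \<in> borel_measurable (lebesgue_on J)" by (rule measurableI[OF system_continuous(1)[OF sol_system]])
    have "cmod (sol u0 v0 \<xi> x) \<le> B * (cmod (f x) + cmod (g x))" if x: "x \<in> J" for x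
    proof -
      have "(cmod u0 + cmod v0) * exp (cmod (\<xi> - \<zeta>) * total x) \<le> B"
        unfolding B_def using T[OF x] by (intro mult_left_mono) (auto simp: mult_left_mono)
      then have b: "cmod (coef1 u0 v0 (\<xi> - \<zeta>) x) \<le> B" "cmod (coef2 u0 v0 (\<xi> - \<zeta>) x) \<le> B"
        using coef_bound[OF x x order.refl, of u0 v0 "\<xi> - \<zeta>"] by linarith+
      have "cmod (sol u0 v0 \<xi> x) \<le> cmod (coef1 u0 v0 (\<xi> - \<zeta>) x) * cmod (f x) + cmod (coef2 u0 v0 (\<xi> - \<zeta>) x) * cmod (g x)"
        unfolding sol_def by (metis norm_mult norm_triangle_ineq)
      also have "\<dots> \<le> B * cmod (f x) + B * cmod (g x)"
        using b by (intro add_mono mult_right_mono) auto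
      finally show ?thesis by (simp add: algebra_simps)
    qed
    then show "AE x in lebesgue_on J. cmod (sol u0 v0 \<xi> x) \<le> B * (cmod (f x) + cmod (g x))"
      by (intro AE_I2) simp
  qed
qed

text \<open>Any solution is the one constructed from its initial values, and bounded coefficients
  dominate that one by |f| + |g|.\<close>

lemma all_solutions_L2w:
  assumes L2: "f \<in> L2w J w" "g \<in> L2w J w" and y: "system y y1 (\<lambda>x. \<xi> * y x)"
  shows "y \<in> L2w J w"
proof -
  define u0 where "u0 = bracket y y1 g g1 a"
  define v0 where "v0 = - bracket y y1 f f1 a"
  have init: "y a = sol u0 v0 \<xi> a" "y1 a = sol1 u0 v0 \<xi> a"
    using decompose(1)[OF a_in, of y y1] decompose(2)[OF a_in, of y1 y] by (simp_all add: sol_a u0_def v0_def)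
  interpret S: sl_basis a J w p q \<xi> "sol 1 0 \<xi>" "sol1 1 0 \<xi>" "sol 0 1 \<xi>" "sol1 0 1 \<xi>" by (rule sl_basis_sol)
  have eq: "y x = sol u0 v0 \<xi> x" if "x \<in> J" for x
    by (rule solution_determined_by_initial_values(1)[OF y sol_system S.f S.g S.wronskian_a init that])
  show ?thesis
  proof (rule L2w_dominated(1)[OF sol_L2w[OF L2] sol_L2w[OF L2]])
    show "y \<in> borel_measurable (lebesgue_on J)" by (rule measurableI[OF system_continuous(1)[OF y]])
    show "AE x in lebesgue_on J. cmod (y x) \<le> 1 * (cmod (sol u0 v0 \<xi> x) + cmod (sol u0 v0 \<xi> x))"
      by (intro AE_I2) (simp add: eq)
  qed
qed

text \<open>Between two points the coefficient varies by at most a constant times the increase of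
  \<open>total\<close>, with a constant common to the compact set. As \<open>total\<close> converges
  along \<open>X\<close>, the coefficient converges at a uniform rate.\<close>

lemma coef1_uniform_limit:
  assumes L2: "f \<in> L2w J w" "g \<in> L2w J w" and X: "incseq X" "\<And>n. X n \<in> J"
    and lim: "\<And>\<mu>. (\<lambda>n. coef1 1 0 \<mu> (X n)) \<longlonglongrightarrow> E \<mu>" and C: "compact C"
  shows "uniform_limit C (\<lambda>n \<mu>. coef1 1 0 \<mu> (X n)) E sequentially"
proof (rule uniform_limitI)
  fix e :: real assume e: "e > 0"
  obtain T where T: "\<And>x. x \<in> J \<Longrightarrow> total x \<le> T" using total_bounded[OF L2] by blast
  obtain r where r: "r > 0" "\<And>\<mu>. \<mu> \<in> C \<Longrightarrow> cmod \<mu> \<le> r"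
    using compact_imp_bounded[OF C] unfolding bounded_pos by blast
  \<comment> \<open>The factor \<open>r\<close> bounds the parameter in front of the integrand, and
    \<open>exp (r * T)\<close> bounds both coefficients inside it.\<close>
  define B where "B = r * exp (r * T)"
  have B: "B > 0" using r by (simp add: B_def)
  have inc: "incseq (\<lambda>n. total (X n))" using X total_mono by (auto simp: incseq_def)
  then obtain L where L: "(\<lambda>n. total (X n)) \<longlonglongrightarrow> L" "\<And>n. total (X n) \<le> L"
    using incseq_convergent[of "\<lambda>n. total (X n)" T] T X(2) by metis
  obtain N0 where N0: "negligible N0" "\<And>x. x \<in> J - N0 \<Longrightarrow> w x > 0" "\<And>x. x \<in> J - N0 \<Longrightarrow> p x \<noteq> 0"
    using exceptional_set by blast
  have T0: "0 \<le> T" using T[OF a_in] by (simp add: total_a)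
  have step: "cmod (coef1 1 0 \<mu> (X m) - coef1 1 0 \<mu> (X n)) \<le> B * (total (X m) - total (X n))"
    if \<mu>: "\<mu> \<in> C" and mn: "n \<le> m" for \<mu> m n
  proof -
    have le: "X n \<le> X m" using X(1) mn by (simp add: incseq_def)
    have "cmod (coef1 1 0 \<mu> (X m) - coef1 1 0 \<mu> (X n)) \<le> Re (of_real B * of_real (total (X m)) - of_real B * of_real (total (X n)))"
    proof (rule primitive_on_norm_le[OF J coef_primitive(1) primitive_on_cmult[OF total_primitive] X(2) X(2) le N0(1)])
      fix t assume t: "t \<in> J - N0"
      then have tJ: "t \<in> J" by simp
      have "exp (cmod \<mu> * total t) \<le> exp (r * T)"
        using r(2)[OF \<mu>] T[OF tJ] total_nonneg[OF tJ] r(1) by (simp add: mult_mono)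
      then have b: "cmod (coef1 1 0 \<mu> t) \<le> exp (r * T)" "cmod (coef2 1 0 \<mu> t) \<le> exp (r * T)"
        using coef_bound[OF tJ tJ order.refl, of 1 0 \<mu>] unfolding norm_one norm_zero add_0_right mult_1_left by linarith+
      have "cmod (of_real (w t) * g t * (\<mu> * (coef1 1 0 \<mu> t * f t + coef2 1 0 \<mu> t * g t)))
          = cmod \<mu> * cmod (of_real (w t) * g t * (coef1 1 0 \<mu> t * f t + coef2 1 0 \<mu> t * g t))"
        by (simp add: norm_mult mult_ac)
      also have "\<dots> \<le> r * (exp (r * T) * (\<bar>w t\<bar> * (cmod (f t) + cmod (g t))\<^sup>2))"
        using r(1) r(2)[OF \<mu>] by (intro mult_mono combination_bound(1) b) auto
      also have "\<dots> = B * kernel t" using N0(2)[OF t] by (simp add: B_def kernel_def)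
      finally show "cmod (of_real (w t) * g t * (\<mu> * (coef1 1 0 \<mu> t * f t + coef2 1 0 \<mu> t * g t))) \<le> Re (of_real B * of_real (kernel t))"
        by simp
    qed
    then show ?thesis by (simp add: algebra_simps)
  qed
  have "\<forall>\<^sub>F n in sequentially. L - e / B < total (X n)"
    using order_tendstoD(1)[OF L(1), of "L - e / B"] e B by simp
  then show "\<forall>\<^sub>F n in sequentially. \<forall>\<mu>\<in>C. dist (coef1 1 0 \<mu> (X n)) (E \<mu>) < e"
  proof (rule eventually_mono, intro ballI)
    fix n \<mu> assume n: "L - e / B < total (X n)" and \<mu>: "\<mu> \<in> C"
    have "cmod (E \<mu> - coef1 1 0 \<mu> (X n)) \<le> B * (L - total (X n))"
    proof (rule tendsto_upperbound[OF tendsto_norm[OF tendsto_diff[OF lim tendsto_const]]])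
      show "\<forall>\<^sub>F m in sequentially. cmod (coef1 1 0 \<mu> (X m) - coef1 1 0 \<mu> (X n)) \<le> B * (L - total (X n))"
        using eventually_ge_at_top[of n]
      proof (rule eventually_mono)
        fix m assume "n \<le> m"
        from step[OF \<mu> this] show "cmod (coef1 1 0 \<mu> (X m) - coef1 1 0 \<mu> (X n)) \<le> B * (L - total (X n))"
          using mult_left_mono[of "total (X m) - total (X n)" "L - total (X n)" B] L(2)[of m] B by linarith
      qed
    qed simp
    also have "\<dots> < e" using n B by (simp add: field_simps)
    finally show "dist (coef1 1 0 \<mu> (X n)) (E \<mu>) < e" by (simp add: dist_norm norm_minus_commute)
  qed
qed

end

text \<open>At a regular end point the limit is a value: convergence along the principal filter of
  \<open>c\<close> means equality at \<open>c\<close>.\<close>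

lemma regular_endpoint_limit:
  fixes y h :: "real \<Rightarrow> complex"
  assumes y: "primitive_on {a..c} a h y" and h: "integrable (lebesgue_on {a..c}) h" and ac: "a \<le> c"
  shows "(y \<longlongrightarrow> y a + integral\<^sup>L (lebesgue_on {a..c}) h) (principal {c})"
proof -
  have "y c = y a + integral {a..c} h" by (rule primitive_on_value[OF y]) (use ac in simp)
  moreover have "integral {a..c} h = integral\<^sup>L (lebesgue_on {a..c}) h"
    by (rule lebesgue_integral_eq_integral[OF h, symmetric]) simp
  ultimately show ?thesis by (intro tendsto_eventually) (simp add: eventually_principal)
qed

text \<open>Left neighbourhoods of \<open>b\<close> live in the extended reals because
  \<open>b\<close> may be infinite; here they are expressed by points of the interval.\<close>

lemma eventually_at_left_co_interval:
  assumes "ereal a < b"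
  shows "eventually P (filtermap real_of_ereal (at_left b)) \<longleftrightarrow>
    (\<exists>x0\<in>co_interval a b. \<forall>x\<in>co_interval a b. x0 < x \<longrightarrow> P x)"
proof -
  have "eventually P (filtermap real_of_ereal (at_left b)) \<longleftrightarrow> (\<exists>b'<b. \<forall>y>b'. y < b \<longrightarrow> P (real_of_ereal y))"
    unfolding eventually_filtermap by (rule eventually_at_left[OF assms])
  also have "\<dots> \<longleftrightarrow> (\<exists>x0\<in>co_interval a b. \<forall>x\<in>co_interval a b. x0 < x \<longrightarrow> P x)"
  proof
    assume "\<exists>b'<b. \<forall>y>b'. y < b \<longrightarrow> P (real_of_ereal y)"
    then obtain b' where b': "b' < b" "\<And>y. b' < y \<Longrightarrow> y < b \<Longrightarrow> P (real_of_ereal y)" by blast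
    have "max b' (ereal a) < b" using b'(1) assms by simp
    then obtain r where r: "max b' (ereal a) < ereal r" "ereal r < b" using ereal_dense2 by blast
    show "\<exists>x0\<in>co_interval a b. \<forall>x\<in>co_interval a b. x0 < x \<longrightarrow> P x"
    proof (intro bexI[of _ r] ballI impI)
      show "r \<in> co_interval a b" using r by (auto simp: co_interval_def)
      fix x assume x: "x \<in> co_interval a b" "r < x"
      have "b' < ereal x" using r(1) x(2) by (meson less_ereal.simps(1) max.strict_boundedE order.strict_trans)
      moreover have "ereal x < b" using x by (simp add: co_interval_def)
      ultimately show "P x" using b'(2)[of "ereal x"] by simp
    qed
  next
    assume "\<exists>x0\<in>co_interval a b. \<forall>x\<in>co_interval a b. x0 < x \<longrightarrow> P x"
    then obtain x0 where x0: "x0 \<in> co_interval a b" "\<And>x. x \<in> co_interval a b \<Longrightarrow> x0 < x \<Longrightarrow> P x" by blast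
    show "\<exists>b'<b. \<forall>y>b'. y < b \<longrightarrow> P (real_of_ereal y)"
    proof (intro exI[of _ "ereal x0"] conjI allI impI)
      show "ereal x0 < b" using x0(1) by (simp add: co_interval_def)
      fix y assume y: "ereal x0 < y" "y < b"
      then obtain r where r: "y = ereal r" by (cases y) auto
      show "P (real_of_ereal y)"
        using y x0(1) by (intro x0(2)) (auto simp: r co_interval_def)
    qed
  qed
  finally show ?thesis .
qed

text \<open>Large \<open>r\<close> isolates the slope, small \<open>r\<close> the constant. This
  separates the condition on r p + q / w - K into one on \<open>p\<close> and one on
  \<open>q\<close>.\<close>

lemma affine_nonneg_on_positive_reals:
  fixes A B :: real
  assumes "\<And>r. 0 < r \<Longrightarrow> 0 \<le> r * A + B"
  shows "0 \<le> A" "0 \<le> B"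
proof -
  show "0 \<le> A"
  proof (rule ccontr)
    assume "\<not> 0 \<le> A"
    then have A: "A < 0" by simp
    then have "0 < (\<bar>B\<bar> + 1) / (- A)" by (intro divide_pos_pos) auto
    from assms[OF this] A show False by simp
  qed
  show "0 \<le> B"
  proof (rule field_le_epsilon)
    fix e :: real assume "e > 0"
    have "0 < e / (A + 1)" using \<open>e > 0\<close> \<open>0 \<le> A\<close> by simp
    from assms[OF this] have "0 \<le> e * (A / (A + 1)) + B" by simp
    moreover have "e * (A / (A + 1)) \<le> e * 1" using \<open>e > 0\<close> \<open>0 \<le> A\<close> by (intro mult_left_mono) auto
    ultimately show "0 \<le> B + e" by simp
  qed
qed

section \<open>Spectra as zero sets\<close>

context sl_basis
begin

text \<open>The basis is moved to \<open>\<xi>\<close> while the boundary function stays the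
  solution \<open>g\<close> at \<open>\<zeta>\<close>; the characteristic value is then the
  coefficient of \<open>f\<close> at \<open>c\<close>.\<close>

lemma regular_spectrum_iff:
  assumes L2: "f \<in> L2w J w" "g \<in> L2w J w" and f_a: "f a = sin \<alpha>" "f1 a = - cos \<alpha>" and c: "c \<in> J" "a < c"
  shows "\<xi> \<in> L2w_spectrum {a..c} w (sl_operator_regular a c w p q \<alpha> g g1) \<longleftrightarrow> coef1 1 0 (\<xi> - \<zeta>) c = 0"
proof -
  interpret S: sl_spectral a "{a..c}" w p q \<xi> "sol 1 0 \<xi>" "sol1 1 0 \<xi>" "sol 0 1 \<xi>" "sol1 0 1 \<xi>" "principal {c}" \<alpha> \<zeta> g g1
  proof (intro sl_spectral.intro sl_basis.intro restrict[OF c(1)] sl_basis_axioms.intro sl_spectral_axioms.intro)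
    show "sl_system {a..c} a w p q (sol 1 0 \<xi>) (sol1 1 0 \<xi>) (\<lambda>x. \<xi> * sol 1 0 \<xi> x)"
      "sl_system {a..c} a w p q (sol 0 1 \<xi>) (sol1 0 1 \<xi>) (\<lambda>x. \<xi> * sol 0 1 \<xi> x)"
      "sl_system {a..c} a w p q g g1 (\<lambda>x. \<zeta> * g x)"
      by (intro sl_system_subset[OF _ sub[OF c(1)]] sol_system g)+
    show "bracket (sol 1 0 \<xi>) (sol1 1 0 \<xi>) (sol 0 1 \<xi>) (sol1 0 1 \<xi>) a = 1"
      by (rule sl_basis.wronskian_a[OF sl_basis_sol])
    show "principal {c} \<noteq> bot" by (simp add: principal_eq_bot_iff)
    show "\<forall>\<^sub>F x in principal {c}. x \<in> {a..c}" using c by (simp add: eventually_principal)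
    show "(y \<longlongrightarrow> y a + integral\<^sup>L (lebesgue_on {a..c}) h) (principal {c})"
      if "primitive_on {a..c} a h y" "integrable (lebesgue_on {a..c}) h" for h y
      by (rule regular_endpoint_limit[OF that]) (use c in simp)
    show "sol 1 0 \<xi> \<in> L2w {a..c} w" "sol 0 1 \<xi> \<in> L2w {a..c} w" "g \<in> L2w {a..c} w"
      by (intro L2w_restrict[OF _ c(1)] sol_L2w L2)+
    show "sol 1 0 \<xi> a = sin \<alpha>" "sol1 1 0 \<xi> a = - cos \<alpha>" using f_a by (simp_all add: sol_a)
    show "\<exists>x\<in>{a..c}. a < x" using c by auto
  qed
  have lim: "(h \<longlongrightarrow> 0) (principal {c}) \<longleftrightarrow> h c = 0" for h :: "real \<Rightarrow> complex"
  proof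
    assume "(h \<longlongrightarrow> 0) (principal {c})"
    moreover have "(h \<longlongrightarrow> h c) (principal {c})" by (intro tendsto_eventually) (simp add: eventually_principal)
    ultimately show "h c = 0" using tendsto_unique[OF S.F_nonbot] by blast
  next
    assume "h c = 0"
    then show "(h \<longlongrightarrow> 0) (principal {c})" by (intro tendsto_eventually) (simp add: eventually_principal)
  qed
  have "S.G = sl_operator_regular a c w p q \<alpha> g g1"
    unfolding S.G_def sl_operator_regular_def lim ..
  then show ?thesis using S.spectrum_iff bracket_sol(1)[OF c(1), of 1 0 \<xi>] by (simp add: lim)
qed

text \<open>The limit at \<open>b\<close> is also recorded along the sequence \<open>X\<close>, the
  form in which it can be compared with the regular problems.\<close>

lemma singular_spectrum_iff:
  assumes L2: "f \<in> L2w J w" "g \<in> L2w J w" and f_a: "f a = sin \<alpha>" "f1 a = - cos \<alpha>"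
    and Jb: "J = co_interval a b" "ereal a < b" and X: "\<And>n. X n \<in> J" "(\<lambda>n. ereal (X n)) \<longlonglongrightarrow> b"
  obtains D where "(\<lambda>n. coef1 1 0 (\<xi> - \<zeta>) (X n)) \<longlonglongrightarrow> D"
    "\<xi> \<in> L2w_spectrum J w (sl_operator_singular a b w p q \<alpha> g g1) \<longleftrightarrow> D = 0"
proof -
  let ?F = "filtermap real_of_ereal (at_left b)"
  note ev = eventually_at_left_co_interval[OF Jb(2), folded Jb(1)]
  have beyond: "\<exists>y\<in>J. x < y" if "x \<in> J" for x
  proof -
    have "ereal x < b" using that by (simp add: Jb(1) co_interval_def)
    then obtain y where "ereal x < ereal y" "ereal y < b" using ereal_dense2 by blast
    then show ?thesis using that by (intro bexI[of _ y]) (auto simp: Jb(1) co_interval_def)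
  qed
  interpret S: sl_spectral a J w p q \<xi> "sol 1 0 \<xi>" "sol1 1 0 \<xi>" "sol 0 1 \<xi>" "sol1 0 1 \<xi>" ?F \<alpha> \<zeta> g g1
  proof (intro sl_spectral.intro sl_basis_sol sl_spectral_axioms.intro)
    show "?F \<noteq> bot"
    proof
      assume "?F = bot"
      then have "eventually (\<lambda>x. False) ?F" by simp
      then show False unfolding ev using beyond by blast
    qed
    show "\<forall>\<^sub>F x in ?F. x \<in> J" unfolding ev using a_in by blast
    show "(y \<longlongrightarrow> y a + integral\<^sup>L (lebesgue_on J) h) ?F"
      if "prim h y" "integrable (lebesgue_on J) h" for h y
    proof (rule tendstoI)
      fix e :: real assume "e > 0"
      from primitive_tail[OF that this] obtain x0 where "x0 \<in> J"
        "\<And>x. x \<in> J \<Longrightarrow> x0 \<le> x \<Longrightarrow> cmod (y x - (y a + integral\<^sup>L (lebesgue_on J) h)) < e" by blast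
      then show "\<forall>\<^sub>F x in ?F. dist (y x) (y a + integral\<^sup>L (lebesgue_on J) h) < e"
        unfolding ev dist_norm by (meson less_imp_le)
    qed
    show "sol 1 0 \<xi> \<in> L2w J w" "sol 0 1 \<xi> \<in> L2w J w" by (rule sol_L2w[OF L2])+
    show "g \<in> L2w J w" by (rule L2(2))
    show "sol 1 0 \<xi> a = sin \<alpha>" "sol1 1 0 \<xi> a = - cos \<alpha>" using f_a by (simp_all add: sol_a)
    show "sl_system J a w p q g g1 (\<lambda>x. \<zeta> * g x)" by (rule g)
    show "\<exists>x\<in>J. a < x" by (rule beyond[OF a_in])
  qed
  have "filterlim X ?F sequentially"
  proof -
    have "filterlim (\<lambda>n. ereal (X n)) (at_left b) sequentially"
      using X by (auto simp: filterlim_at Jb(1) co_interval_def order.strict_implies_not_eq)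
    then have "filterlim (\<lambda>n. real_of_ereal (ereal (X n))) ?F sequentially"
      by (rule filterlim_compose[rotated]) (simp add: filterlim_def)
    then show ?thesis by simp
  qed
  from filterlim_compose[OF S.D1_lim this]
  have "(\<lambda>n. coef1 1 0 (\<xi> - \<zeta>) (X n)) \<longlonglongrightarrow> S.D1"
    by (simp add: bracket_sol(1)[OF X(1)])
  moreover have "S.G = sl_operator_singular a b w p q \<alpha> g g1"
    unfolding S.G_def sl_operator_singular_def Jb(1)[symmetric] filterlim_filtermap o_def ..
  moreover have "(bracket (sol 1 0 \<xi>) (sol1 1 0 \<xi>) g g1 \<longlongrightarrow> 0) ?F \<longleftrightarrow> S.D1 = 0"
  proof
    assume "(bracket (sol 1 0 \<xi>) (sol1 1 0 \<xi>) g g1 \<longlongrightarrow> 0) ?F"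
    then show "S.D1 = 0" by (rule tendsto_unique[OF S.F_nonbot S.D1_lim])
  next
    assume "S.D1 = 0"
    then show "(bracket (sol 1 0 \<xi>) (sol1 1 0 \<xi>) g g1 \<longlongrightarrow> 0) ?F" using S.D1_lim by simp
  qed
  ultimately show ?thesis using that S.spectrum_iff by metis
qed

end

theorem theorem4p7:
  fixes a :: real and b :: ereal
    and w :: "real \<Rightarrow> real" and p q :: "real \<Rightarrow> complex"
    and \<alpha> K \<zeta>' m :: complex and \<eta> :: real
    and \<theta> \<theta>1 \<phi> \<phi>1 \<psi> \<psi>1 :: "real \<Rightarrow> complex"
    and bn :: "nat \<Rightarrow> real"
  defines "I \<equiv> co_interval a b"
  assumes "ereal a < b"
    and "AE x in lebesgue_on I. w x > 0" and "AE x in lebesgue_on I. p x \<noteq> 0"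
    and "loc_integrable_on I w" and "loc_integrable_on I (\<lambda>x. 1 / p x)"
    and "loc_integrable_on I q"
    and "sims_Q I w p q \<noteq> UNIV"
    and b_singular: "b = \<infinity> \<or>
           (\<integral>\<^sup>+x. ennreal (w x + 1 / cmod (p x) + cmod (q x)) \<partial>lebesgue_on I) = \<infinity>"
    and "(\<eta>, K) \<in> sims_S_bc I w p q \<alpha>"
    and sims_type: "(\<exists>\<zeta>\<in>sims_Lambda \<eta> K. sims_case_II I w p q \<eta> K \<zeta>) \<or>
                    (\<exists>\<zeta>\<in>sims_Lambda \<eta> K. sims_case_III I w p q \<eta> K \<zeta>)"
    and "\<zeta>' \<in> sims_Lambda \<eta> K"
    and "sl_solution I w p q \<zeta>' \<theta> \<theta>1" and "\<theta> a = cos \<alpha>" and "\<theta>1 a = sin \<alpha>"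
    and "sl_solution I w p q \<zeta>' \<phi> \<phi>1" and "\<phi> a = sin \<alpha>" and "\<phi>1 a = - cos \<alpha>"
    and "\<psi> = (\<lambda>x. \<theta> x + m * \<phi> x)" and "\<psi>1 = (\<lambda>x. \<theta>1 x + m * \<phi>1 x)"
    and "\<psi> \<in> L2w I w"
    and "incseq bn" and "\<And>n. bn n \<in> {x. a < x \<and> ereal x < b}"
    and "(\<lambda>n. ereal (bn n)) \<longlonglongrightarrow> b"
  shows "(\<forall>\<zeta>\<in>L2w_spectrum I w (sl_operator_singular a b w p q \<alpha> \<psi> \<psi>1).
            \<exists>l :: nat \<Rightarrow> complex.
              (\<forall>n. l n \<in> L2w_spectrum {a..bn n} w (sl_operator_regular a (bn n) w p q \<alpha> \<psi> \<psi>1)) \<and>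
              l \<longlonglongrightarrow> \<zeta>) \<and>
         (\<forall>(l :: nat \<Rightarrow> complex) \<zeta>.
            (\<forall>n. l n \<in> L2w_spectrum {a..bn n} w (sl_operator_regular a (bn n) w p q \<alpha> \<psi> \<psi>1)) \<and>
            l \<longlonglongrightarrow> \<zeta> \<longrightarrow>
            \<zeta> \<in> L2w_spectrum I w (sl_operator_singular a b w p q \<alpha> \<psi> \<psi>1))"
proof -
  note ab = \<open>ereal a < b\<close>
  interpret C: sl_coefficients a I w p q
    by standard (use assms initial_interval_co_interval[OF ab] in \<open>simp_all only: I_def\<close>)
  have phi: "C.system \<phi> \<phi>1 (\<lambda>x. \<zeta>' * \<phi> x)" and theta: "C.system \<theta> \<theta>1 (\<lambda>x. \<zeta>' * \<theta> x)"
    using assms(13,16) by (simp_all only: C.system_of_solution)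
  have "C.system \<psi> \<psi>1 (\<lambda>x. \<zeta>' * \<theta> x + m * (\<zeta>' * \<phi> x))"
    unfolding assms(19,20) by (intro sl_system_add sl_system_cmult phi theta)
  then have psi: "C.system \<psi> \<psi>1 (\<lambda>x. \<zeta>' * \<psi> x)"
    by (simp add: assms(19) algebra_simps)
  have init: "\<phi> a = sin \<alpha>" "\<phi>1 a = - cos \<alpha>" by fact+
  \<comment> \<open>The Wronskian of phi and psi at \<open>a\<close> is sin^2 + cos^2 = 1 for every
    \<open>m\<close>, since the multiple of phi contained in psi drops out.\<close>
  interpret B: sl_basis a I w p q \<zeta>' \<phi> \<phi>1 \<psi> \<psi>1
  proof unfold_locales
    show "bracket \<phi> \<phi>1 \<psi> \<psi>1 a = 1"
      using sin_cos_squared_add3[of \<alpha>]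
      by (simp add: bracket_def assms(14,15,17,18,19,20) algebra_simps)
  qed (fact phi psi)+
  \<comment> \<open>Either case provides some parameter at which all solutions are square
    integrable. It may differ from \<open>\<zeta>'\<close>, so a basis at that parameter is used to
    carry the property over.\<close>
  obtain \<zeta>0 where all0: "\<And>y y1. sl_solution I w p q \<zeta>0 y y1 \<Longrightarrow> y \<in> L2w I w"
    using sims_type unfolding sims_case_II_def sims_case_III_def by blast
  interpret B0: sl_basis a I w p q \<zeta>0 "B.sol 1 0 \<zeta>0" "B.sol1 1 0 \<zeta>0" "B.sol 0 1 \<zeta>0" "B.sol1 0 1 \<zeta>0"
    by (rule B.sl_basis_sol)
  have L20: "B.sol 1 0 \<zeta>0 \<in> L2w I w" "B.sol 0 1 \<zeta>0 \<in> L2w I w"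
    by (rule all0[OF C.solution_of_system[OF B.sol_system]])+
  have L2: "\<phi> \<in> L2w I w" "\<psi> \<in> L2w I w"
    using B0.all_solutions_L2w[OF L20 phi] B0.all_solutions_L2w[OF L20 psi] by blast+
  have S: "(\<eta>, K) \<in> sims_S I w p q" and bc: "Re (cis \<eta> * cos \<alpha> * cnj (sin \<alpha>)) \<le> 0"
    using assms(10) by (auto simp: sims_S_bc_def)
  \<comment> \<open>Letting \<open>r\<close> range over all positive reals at a fixed
    \<open>x\<close> decouples \<open>p\<close> from \<open>q\<close>; multiplication by
    \<open>w x > 0\<close> then clears the denominator.\<close>
  have half_plane: "0 \<le> Re (cis \<eta> * p x)" "0 \<le> Re (cis \<eta> * (q x - K * of_real (w x)))" if x: "x \<in> I" "0 < w x" for x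
  proof -
    have "0 \<le> r * Re (cis \<eta> * p x) + Re (cis \<eta> * (q x / of_real (w x) - K))" if "0 < r" for r
    proof -
      have "0 \<le> Re ((of_real r * p x + q x / of_real (w x) - K) * cis \<eta>)"
        using S x that unfolding sims_S_def by auto
      also have "(of_real r * p x + q x / of_real (w x) - K) * cis \<eta>
          = of_real r * (cis \<eta> * p x) + cis \<eta> * (q x / of_real (w x) - K)" by (simp add: algebra_simps)
      finally show ?thesis by simp
    qed
    note A = affine_nonneg_on_positive_reals[OF this]
    show "0 \<le> Re (cis \<eta> * p x)" by (rule A(1))
    have "cis \<eta> * (q x - K * of_real (w x)) = of_real (w x) * (cis \<eta> * (q x / of_real (w x) - K))"
      using x(2) by (simp add: field_simps)
    moreover have "Re (of_real r * z) = r * Re z" for r z by simp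
    ultimately have "Re (cis \<eta> * (q x - K * of_real (w x))) = w x * Re (cis \<eta> * (q x / of_real (w x) - K))"
      by metis
    then show "0 \<le> Re (cis \<eta> * (q x - K * of_real (w x)))" using A(2) x(2) by simp
  qed
  have w_AE: "AE x in lebesgue_on I. x \<in> I \<and> 0 < w x"
    using assms(3) by (auto intro: AE_conjI AE_I2)
  interpret H: sl_sector a I w p q \<zeta>' \<phi> \<phi>1 \<psi> \<psi>1 \<eta> K
  proof unfold_locales
    show "AE x in lebesgue_on I. 0 \<le> Re (cis \<eta> * p x)"
      using w_AE by eventually_elim (simp only: half_plane)
    show "AE x in lebesgue_on I. 0 \<le> Re (cis \<eta> * (q x - K * of_real (w x)))"
      using w_AE by eventually_elim (simp only: half_plane)
    \<comment> \<open>The admissibility of alpha, with its sign turned by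
      \<open>\<phi>1 a = - cos \<alpha>\<close>.\<close>
    show "0 \<le> Re (cis \<eta> * (\<phi>1 a * cnj (\<phi> a)))"
      using bc by (simp add: init mult.assoc)
  qed
  have bI: "bn n \<in> I" "a < bn n" for n using assms(23) by (auto simp: I_def co_interval_def less_imp_le)
  \<comment> \<open>By the bracket formula this coefficient is [phi(., xi), psi](b_n).\<close>
  define D where "D = (\<lambda>n \<xi>. B.coef1 1 0 (\<xi> - \<zeta>') (bn n))"
  obtain E where E: "\<And>\<xi>. (\<lambda>n. D n \<xi>) \<longlonglongrightarrow> E \<xi>"
    "\<And>\<xi>. \<xi> \<in> L2w_spectrum I w (sl_operator_singular a b w p q \<alpha> \<psi> \<psi>1) \<longleftrightarrow> E \<xi> = 0"
  proof -
    have "\<exists>d. (\<lambda>n. D n \<xi>) \<longlonglongrightarrow> d \<and> (\<xi> \<in> L2w_spectrum I w (sl_operator_singular a b w p q \<alpha> \<psi> \<psi>1) \<longleftrightarrow> d = 0)" for \<xi>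
      using B.singular_spectrum_iff[OF L2 init I_def[THEN meta_eq_to_obj_eq] ab bI(1) assms(24), of \<xi>]
      unfolding D_def by metis
    then show ?thesis using that by metis
  qed
  have R: "\<xi> \<in> L2w_spectrum {a..bn n} w (sl_operator_regular a (bn n) w p q \<alpha> \<psi> \<psi>1) \<longleftrightarrow> D n \<xi> = 0" for n \<xi>
    unfolding D_def by (rule B.regular_spectrum_iff[OF L2 init bI])
  have hol: "D n holomorphic_on UNIV" for n
    unfolding D_def using holomorphic_on_compose_gen[of "\<lambda>\<xi>. \<xi> - \<zeta>'" UNIV "\<lambda>\<mu>. B.coef1 1 0 \<mu> (bn n)" UNIV, unfolded o_def]
      B.coef_holomorphic(1)[OF bI(1), of 1 0 n] by (simp add: holomorphic_intros)
  have unif: "uniform_limit A D E sequentially" if A: "compact A" for A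
  proof -
    \<comment> \<open>The series is expanded in xi - zeta', so the compact set is translated
      first.\<close>
    have "uniform_limit ((\<lambda>\<xi>. \<xi> - \<zeta>') ` A) (\<lambda>n \<mu>. B.coef1 1 0 \<mu> (bn n)) (\<lambda>\<mu>. E (\<mu> + \<zeta>')) sequentially"
    proof (rule B.coef1_uniform_limit[OF L2 \<open>incseq bn\<close> bI(1)])
      show "(\<lambda>n. B.coef1 1 0 \<mu> (bn n)) \<longlonglongrightarrow> E (\<mu> + \<zeta>')" for \<mu>
        using E(1)[of "\<mu> + \<zeta>'"] by (simp add: D_def)
      show "compact ((\<lambda>\<xi>. \<xi> - \<zeta>') ` A)"
        using A by (intro compact_continuous_image continuous_intros)
    qed
    then have "uniform_limit A (\<lambda>n \<xi>. B.coef1 1 0 (\<xi> - \<zeta>') (bn n)) (\<lambda>\<xi>. E (\<xi> - \<zeta>' + \<zeta>')) sequentially"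
      unfolding uniform_limit_iff by fastforce
    then show ?thesis by (simp add: D_def)
  qed
  have "D n \<zeta>' = 1" for n
    using H.characteristic_at_base[OF bI(1), of n] B.bracket_sol(1)[OF bI(1), of 1 0 \<zeta>' n] by (simp add: D_def)
  then have "E \<zeta>' = 1" using E(1)[of \<zeta>'] by (simp add: LIMSEQ_const_iff)
  then have nz: "E \<zeta>' \<noteq> 0" by simp
  have zeros: "\<exists>\<xi>. D n \<xi> = 0" for n
    unfolding D_def using H.zero_exists[OF bI, of n] B.bracket_sol(1)[OF bI(1), of 1 0 _ n] by metis
  note zero_sets = hurwitz_zero_sets[OF hol unif nz zeros]
  show ?thesis
  proof (intro conjI ballI allI impI)
    fix \<xi> assume "\<xi> \<in> L2w_spectrum I w (sl_operator_singular a b w p q \<alpha> \<psi> \<psi>1)"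
    then have "E \<xi> = 0" by (simp only: E(2))
    then show "\<exists>l. (\<forall>n. l n \<in> L2w_spectrum {a..bn n} w (sl_operator_regular a (bn n) w p q \<alpha> \<psi> \<psi>1)) \<and> l \<longlonglongrightarrow> \<xi>"
      unfolding R by (rule zero_sets(1)[rotated])
  next
    fix l \<xi> assume "(\<forall>n. l n \<in> L2w_spectrum {a..bn n} w (sl_operator_regular a (bn n) w p q \<alpha> \<psi> \<psi>1)) \<and> l \<longlonglongrightarrow> \<xi>"
    then show "\<xi> \<in> L2w_spectrum I w (sl_operator_singular a b w p q \<alpha> \<psi> \<psi>1)"
      unfolding R E(2) using zero_sets(2) by blast
  qed
qed

end
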